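(* Let $\alpha \in \mathcal K$ and $\gamma, \delta \in \mathbb R$. Then there exists a set $\mathcal G = \mathcal G(\alpha,\gamma,\delta) \subseteq \mathbf{Bad}$ of Hausdorff dimension $\dim_{\mathrm H}(\mathcal G) = 1$ such that for every $\beta \in \mathcal G$ we have \[ \#\{ n \in [N] : n \| n\alpha - \gamma \| \cdot \| n\beta - \delta \| \leqslant 1/\log n \} \gg \log \log N \] for all sufficiently large $N \in \mathbb N$; that is, there are constants $c>0$ and $N_0$ (possibly depending on $\alpha,\gamma,\delta,\beta$) such that the left-hand side is at least $c \log\log N$ for all $N \geqslant N_0$.
   Context: For $x \in \mathbb R$, $\|x\| = \min\{|x-k| : k \in \mathbb Z\}$ denotes the distance to the nearest integer, and $[N] = \{1,2,\ldots,N\}$. The set of badly approximable numbers is $\mathbf{Bad} = \{\alpha \in \mathbb R : \liminf_{n\to\infty} n\|n\alpha\| > 0\}$. For irrational $\alpha = [a_0; a_1, a_2, \ldots]$ (continued fraction expansion, $a_0 \in \mathbb Z$, $a_k \in \mathbb N$ for $k\ge1$), the continued fraction convergent denominators are defined by $q_{-1} = 0$, $q_0 = 1$, $q_k = a_k q_{k-1} + q_{k-2}$ for $k \in \mathbb N$. The set $\mathcal K$ is defined as $\mathcal K = \{\alpha \in \mathbb R \setminus \mathbb Q : \sup\{ t^{-1}\log q_t(\alpha) : t \in \mathbb N\} < \infty\}$, where $q_t(\alpha)$ are the continued fraction denominators of $\alpha$. *)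

theory Defs
  imports "HOL-Analysis.Analysis"
begin

definition dist_int :: "real \<Rightarrow> real"  where
  "dist_int x = (INF k::int. \<bar>x - of_int k\<bar>)"

text \<open>The infimum is a minimum, attained at the nearest integer.\<close>

lemma dist_int_eq_round: "dist_int x = \<bar>x - of_int (round x)\<bar>"
  unfolding dist_int_def
  by (rule cInf_eq_minimum) (auto simp: round_diff_minimal)

definition Bad :: "real set" where
  "Bad = {\<alpha>. liminf (\<lambda>n. ereal (real n * dist_int (real n * \<alpha>))) > 0}"


text \<open>Everything below on continued fractions is meant for irrational arguments only; there
  every complete quotient is irrational, so no division by zero occurs.\<close>

fun cf_complete_quotient :: "real \<Rightarrow> nat \<Rightarrow> real" where
  "cf_complete_quotient \<alpha> 0 = \<alpha>"
| "cf_complete_quotient \<alpha> (Suc k) = 1 / frac (cf_complete_quotient \<alpha> k)"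

definition cf_partial_quotient :: "real \<Rightarrow> nat \<Rightarrow> int" where
  "cf_partial_quotient \<alpha> k = \<lfloor>cf_complete_quotient \<alpha> k\<rfloor>"

text \<open>The usual recursion from \<open>q\<^sub>-\<^sub>1 = 0\<close> and \<open>q\<^sub>0 = 1\<close>; as indices are natural numbers, the
  step \<open>q\<^sub>1 = a\<^sub>1 q\<^sub>0 + q\<^sub>-\<^sub>1\<close> is written out separately.\<close>

fun cf_denom :: "real \<Rightarrow> nat \<Rightarrow> int" where
  "cf_denom \<alpha> 0 = 1"
| "cf_denom \<alpha> (Suc 0) = cf_partial_quotient \<alpha> 1 * cf_denom \<alpha> 0 + 0"
| "cf_denom \<alpha> (Suc (Suc k)) =
     cf_partial_quotient \<alpha> (Suc (Suc k)) * cf_denom \<alpha> (Suc k) + cf_denom \<alpha> k"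

definition K_set :: "real set" where
  "K_set = {\<alpha>. \<alpha> \<notin> \<rat> \<and>
      (SUP t\<in>{1..}. ereal (ln (real_of_int (cf_denom \<alpha> t)) / real t)) < \<infinity>}"


text \<open>The \<open>s\<close>-th power of the diameter, with the conventions that the empty set contributes
  \<open>0\<close> and that \<open>0\<close> to the power \<open>0\<close> is \<open>1\<close> (whereas \<open>0 powr 0 = 0\<close>).\<close>

definition diam_power :: "real \<Rightarrow> 'a::metric_space set \<Rightarrow> ennreal" where
  "diam_power s U =
     (if U = {} then 0 else if s = 0 then 1 else ennreal (diameter U powr s))"

text \<open>Boundedness is required because \<^const>\<open>diameter\<close> is only meaningful for bounded sets.
  Finite covers are included, since members of the sequence may be empty.\<close>

definition hausdorff_premeasure ::
    "real \<Rightarrow> real \<Rightarrow> 'a::metric_space set \<Rightarrow> ennreal" where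
  "hausdorff_premeasure s \<rho> A =
     (INF U \<in> {U :: nat \<Rightarrow> 'a set. A \<subseteq> (\<Union>i. U i) \<and>
                  (\<forall>i. bounded (U i) \<and> diameter (U i) \<le> \<rho>)}.
        (\<Sum>i. diam_power s (U i)))"

definition hausdorff_outer_measure :: "real \<Rightarrow> 'a::metric_space set \<Rightarrow> ennreal" where
  "hausdorff_outer_measure s A = (SUP \<rho>\<in>{0<..}. hausdorff_premeasure s \<rho> A)"

definition hausdorff_dim :: "'a::metric_space set \<Rightarrow> ennreal" where
  "hausdorff_dim A = Inf (ennreal ` {s. 0 \<le> s \<and> hausdorff_outer_measure s A = 0})"

end

theory Submission
  imports Defs "HOL-Library.Sublist" "HOL-Real_Asymp.Real_Asymp"
begin

text \<open>
  Since \<open>\<alpha>\<close> lies in \<^const>\<open>K_set\<close>, the residues \<open>n p\<^sub>t\<close> modulo \<open>q\<^sub>t\<close> give for every \<open>t\<close> some \<open>n\<close> between \<open>q\<^sub>t\<close> and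
  \<open>2 q\<^sub>t\<close> with \<open>n \<parallel>n \<alpha> - \<gamma>\<parallel> \<le> 5\<close>, and \<open>log n\<close> is comparable to \<open>t\<close>. Taking \<open>t = B\<^sup>j\<close> gives a doubly exponential sequence
  \<open>m\<^sub>j\<close>, of which about \<open>log log N\<close> members lie below \<open>N\<close>. So it suffices that \<open>\<parallel>m\<^sub>j \<beta> - \<delta>\<parallel> \<le> 1 / (5 log m\<^sub>j)\<close>
  for all large \<open>j\<close>.

  Such \<open>\<beta>\<close> are found in the tree of continued fractions with digits at most \<open>K\<close>, which has dimension close to \<open>1\<close>.
  When the squared denominator of a word \<open>w\<close> reaches \<open>m\<^sub>j\<close> up to a power of \<open>log m\<^sub>j\<close>, a block of digits forcing the
  \<open>j\<close>-th condition is appended. It costs only \<open>O(log log m\<^sub>j)\<close> digits, which does not affect the dimension. That such a block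
  exists is seen as in Kaufman's work on badly approximable numbers: write the block as \<open>u @ e\<close>. The functions
  \<open>z \<mapsto> m\<^sub>j [w, u, z]\<close> for different \<open>u\<close> have different derivatives, so their values are equidistributed modulo \<open>1\<close> in
  mean square over \<open>z\<close>; the exceptional set of \<open>z\<close> is too small to contain the cylinders of all words \<open>e\<close>.
\<close>

section \<open>Continued fraction words\<close>

text \<open>The obstacle is that \<beta> must have bounded digits. For a given bound such numbers
  form a Lebesgue null set, so no almost-everywhere argument reaches them, and no large digit may be
  used to steer m_j \<beta> to its target. The way out is quantitative. Equidistribution is proved
  for Lebesgue measure in the tail z, with an exceptional set of length O(H^-2) for a parameter H.
  The words e with digits at most K, stopped at size H^16, have lengths whose s-th powers sum to at
  least 1; as s >= 19/20, their cylinders still have total length of order at least H^(-8/5). So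
  some cylinder escapes, and a single block per node is enough: a node with a forced block has one
  child. The price is a factor 2 H_j^60 in mass. Since H_j is a power of log m_j up to constants,
  hence exponential in j, the product of the first n factors is exp(O(n^2)), while m_n is at least
  exp(c 2^n). The product is smaller than any power of m_n, so it disappears in the difference of
  two exponents t < s.\<close>

text \<open>\<open>(row1 w x y, row2 w x y)\<close> is the row vector \<open>(x, y)\<close> times the product of the matrices
  with rows \<open>(k, 1)\<close> and \<open>(1, 0)\<close> over the digits \<open>k\<close> of \<open>w\<close>. So \<open>(x, y) = (1, 0)\<close> gives the numerators and
  \<open>(0, 1)\<close> the denominators of the last two convergents of \<open>w\<close>.\<close>

primrec row1 :: "nat list \<Rightarrow> 'a::comm_semiring_1 \<Rightarrow> 'a \<Rightarrow> 'a" where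
  "row1 [] x y = x"
| "row1 (k # w) x y = row1 w (of_nat k * x + y) x"

primrec row2 :: "nat list \<Rightarrow> 'a::comm_semiring_1 \<Rightarrow> 'a \<Rightarrow> 'a" where
  "row2 [] x y = y"
| "row2 (k # w) x y = row2 w (of_nat k * x + y) x"

primrec cfv :: "nat list \<Rightarrow> real \<Rightarrow> real" where
  "cfv [] z = z"
| "cfv (k # w) z = real k + 1 / cfv w z"

definition digits_le :: "nat \<Rightarrow> nat list \<Rightarrow> bool" where
  "digits_le K w \<longleftrightarrow> set w \<subseteq> {1..K}"

lemma digits_le_Nil [simp]: "digits_le K []"
  and digits_le_Cons [simp]: "digits_le K (k # w) \<longleftrightarrow> k \<in> {1..K} \<and> digits_le K w"
  and digits_le_append [simp]: "digits_le K (u @ w) \<longleftrightarrow> digits_le K u \<and> digits_le K w"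
  by (auto simp: digits_le_def)

lemma row_append:
  "row1 (u @ w) x y = row1 w (row1 u x y) (row2 u x y)"
  "row2 (u @ w) x y = row2 w (row1 u x y) (row2 u x y)"
  by (induction u arbitrary: x y) auto

lemma row_of_nat:
  "row1 w (of_nat x) (of_nat y) = of_nat (row1 w x y)"
  "row2 w (of_nat x) (of_nat y) = of_nat (row2 w x y)"
  by (induction w arbitrary: x y) (simp_all flip: of_nat_mult of_nat_add)

lemma row_add:
  "row1 w (x + x') (y + y') = row1 w x y + row1 w x' y'"
  "row2 w (x + x') (y + y') = row2 w x y + row2 w x' y'"
proof (induction w arbitrary: x y x' y')
  case (Cons k w)
  { case 1
    have "row1 (k # w) (x + x') (y + y') = row1 w ((of_nat k * x + y) + (of_nat k * x' + y')) (x + x')"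
      by (simp add: algebra_simps)
    then show ?case unfolding Cons by simp
  next
    case 2
    have "row2 (k # w) (x + x') (y + y') = row2 w ((of_nat k * x + y) + (of_nat k * x' + y')) (x + x')"
      by (simp add: algebra_simps)
    then show ?case unfolding Cons by simp }
qed auto

lemma row_scale:
  "row1 w (c * x) (c * y) = c * row1 w x y"
  "row2 w (c * x) (c * y) = c * row2 w x y"
proof (induction w arbitrary: x y)
  case (Cons k w)
  { case 1
    show ?case using Cons(1)[of "of_nat k * x + y" x] by (simp add: algebra_simps)
  next
    case 2
    show ?case using Cons(2)[of "of_nat k * x + y" x] by (simp add: algebra_simps) }
qed auto

lemma row_linear:
  "row1 w x y = x * row1 w 1 0 + y * row1 w 0 1"
  "row2 w x y = x * row2 w 1 0 + y * row2 w 0 1"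
  using row_add[of w "x * 1" "y * 0" "x * 0" "y * 1"] row_scale[of w x 1 0] row_scale[of w y 0 1]
  by (simp_all)

lemma row_bounds:
  fixes x y :: real
  assumes "digits_le K w" "0 \<le> y" "y \<le> x"
  shows "0 \<le> row2 w x y" "row2 w x y \<le> row1 w x y" "x \<le> row1 w x y"
proof -
  have "0 \<le> row2 w x y \<and> row2 w x y \<le> row1 w x y \<and> x \<le> row1 w x y"
    using assms
  proof (induction w arbitrary: x y)
    case (Cons k w)
    have "1 * x \<le> real k * x"
      using Cons.prems by (intro mult_right_mono) auto
    then have "x \<le> real k * x + y" using Cons.prems by linarith
    with Cons.IH[of x "real k * x + y"] Cons.prems show ?case by auto
  qed auto
  then show "0 \<le> row2 w x y" "row2 w x y \<le> row1 w x y" "x \<le> row1 w x y" by auto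
qed

lemma row2_ge:
  fixes x y :: real
  assumes "digits_le K w" "0 \<le> y" "y \<le> x" "w \<noteq> []"
  shows "x \<le> row2 w x y"
proof -
  obtain u k where w: "w = u @ [k]" using assms(4) by (cases w rule: rev_cases) auto
  have "x \<le> row1 u x y" using row_bounds(3)[of K u y x] assms w by simp
  then show ?thesis by (simp add: w row_append)
qed

lemma row_sum_grows:
  fixes x y :: real
  assumes "digits_le K w" "1 \<le> x" "0 \<le> y" "y \<le> x"
  shows "real (length w) \<le> row1 w x y"
proof -
  \<comment> \<open>The sum of both entries carries the induction: appending \<open>k\<close> turns
    it into \<open>k * row1 + row2 + row1\<close>, a gain of at least \<open>row1 >= 1\<close>, and
    the new first entry \<open>k * row1 + row2\<close> is at least the old sum.\<close>
  have "real (length w) + (if w = [] then 0 else x - 1) \<le> row1 w x y \<and>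
     real (length w) + x + y \<le> row1 w x y + row2 w x y"
    using assms
  proof (induction w rule: rev_induct)
    case (snoc k w)
    have b: "0 \<le> row2 w x y" "row2 w x y \<le> row1 w x y" "x \<le> row1 w x y"
      using row_bounds snoc.prems by auto
    have "1 * row1 w x y \<le> real k * row1 w x y"
      using snoc.prems b by (intro mult_right_mono) auto
    moreover have "real (length w) + x + y \<le> row1 w x y + row2 w x y"
      using snoc by auto
    moreover define c where "c = real k * row1 w x y"
    ultimately have "real (length w) + 1 + (x - 1) \<le> c + row2 w x y"
      "real (length w) + 1 + x + y \<le> c + row2 w x y + row1 w x y"
      using b snoc.prems(2-4) by linarith+
    then show ?case by (simp add: row_append c_def)
  qed auto
  then show ?thesis using assms by (auto split: if_splits)
qed

lemma cfv_range:
  assumes "digits_le K w" "z \<in> {1..real K + 1}"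
  shows "cfv w z \<in> {1..real K + 1}"
  using assms
proof (induction w)
  case (Cons k w)
  then have "cfv w z \<ge> 1" by simp
  then have "0 < 1 / cfv w z" "1 / cfv w z \<le> 1" by auto
  moreover have "1 \<le> real k" "real k \<le> K" using Cons.prems by auto
  ultimately have "1 \<le> real k + 1 / cfv w z" "real k + 1 / cfv w z \<le> real K + 1" by linarith+
  then show ?case by simp
qed auto

lemma cfv_append: "cfv (u @ w) z = cfv u (cfv w z)"
  by (induction u) auto

lemma row_pos:
  fixes z :: real
  assumes "digits_le K w" "z > 0"
  shows "row1 w 1 0 * z + row2 w 1 0 > 0" "row1 w 0 1 * z + row2 w 0 1 > 0"
proof -
  have 1: "row1 u 1 0 * z + row2 u 1 0 > 0" if "digits_le K u" for u
  proof -
    have "row1 u (1::real) 0 \<ge> 1" "row2 u (1::real) 0 \<ge> 0"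
      using row_bounds[of K u "0::real" 1] that by auto
    then show ?thesis using assms(2) by (smt (verit) mult_pos_pos)
  qed
  show "row1 w 1 0 * z + row2 w 1 0 > 0" using 1 assms by auto
  show "row1 w 0 1 * z + row2 w 0 1 > 0"
    using 1 assms by (cases w) auto
qed

lemma cfv_eq:
  assumes "digits_le K w" "z > 0"
  shows "cfv w z = (row1 w 1 0 * z + row2 w 1 0) / (row1 w 0 1 * z + row2 w 0 1)"
  using assms
proof (induction w)
  case (Cons k w)
  have p: "row1 w 1 0 * z + row2 w 1 0 > 0" "row1 w 0 1 * z + row2 w 0 1 > 0"
    using row_pos Cons.prems by auto
  have "cfv (k # w) z = k + (row1 w 0 1 * z + row2 w 0 1) / (row1 w 1 0 * z + row2 w 1 0)"
    using Cons by simp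
  also have "\<dots> = ((real k * row1 w 1 0 + row1 w 0 1) * z + (real k * row2 w 1 0 + row2 w 0 1)) / (row1 w 1 0 * z + row2 w 1 0)"
    using p by (simp add: field_simps)
  also have "real k * row1 w 1 0 + row1 w 0 1 = row1 (k # w) 1 0"
    using row_linear(1)[of w "real k" 1] by simp
  also have "real k * row2 w 1 0 + row2 w 0 1 = row2 (k # w) 1 0"
    using row_linear(2)[of w "real k" 1] by simp
  finally show ?case by simp
qed auto

lemma row_det:
  "row1 w 1 0 * row2 w 0 1 - row2 w 1 0 * row1 w 0 1 = ((-1) ^ length w :: 'a::comm_ring_1)"
proof (induction w)
  case (Cons k w)
  have "row1 (k # w) 1 0 * row2 (k # w) 0 1 - row2 (k # w) 1 0 * row1 (k # w) 0 1
     = - (row1 w 1 0 * row2 w 0 1 - row2 w 1 0 * row1 w 0 1 :: 'a)"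
    using row_linear[of w "of_nat k :: 'a" 1] by (simp add: algebra_simps)
  then show ?case using Cons by simp
qed auto

text \<open>The cross terms of the two fractions cancel up to the determinant, which is a sign. For
  words of even length the map \<open>cfv w\<close> is therefore increasing.\<close>

lemma cfv_diff:
  assumes "digits_le K w" "z > 0" "z' > 0"
  shows "cfv w z - cfv w z' = (-1) ^ length w * (z - z') /
     ((row1 w 0 1 * z + row2 w 0 1) * (row1 w 0 1 * z' + row2 w 0 1))"
proof -
  have p: "row1 w 0 1 * z + row2 w 0 1 > 0" "row1 w 0 1 * z' + row2 w 0 1 > 0"
    using row_pos assms by auto
  have "cfv w z - cfv w z' = ((row1 w 1 0 * z + row2 w 1 0) * (row1 w 0 1 * z' + row2 w 0 1)
      - (row1 w 1 0 * z' + row2 w 1 0) * (row1 w 0 1 * z + row2 w 0 1)) /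
     ((row1 w 0 1 * z + row2 w 0 1) * (row1 w 0 1 * z' + row2 w 0 1))"
    unfolding cfv_eq[OF assms(1,2)] cfv_eq[OF assms(1,3)] using p by (simp add: diff_frac_eq)
  also have "(row1 w 1 0 * z + row2 w 1 0) * (row1 w 0 1 * z' + row2 w 0 1)
      - (row1 w 1 0 * z' + row2 w 1 0) * (row1 w 0 1 * z + row2 w 0 1)
     = (row1 w 1 0 * row2 w 0 1 - row2 w 1 0 * row1 w 0 1) * (z - z')"
    by (simp add: algebra_simps)
  finally show ?thesis using row_det[of w, where ?'a = real] by simp
qed

text \<open>A rational has two continued fraction expansions, one ending in \<open>a, 1\<close> and
  the other in \<open>a + 1\<close>. Their lengths differ by one, so the parity separates
  them.\<close>

lemma row_inj:
  assumes "digits_le K u" "digits_le K' w" "row1 u 1 0 = (row1 w 1 0 :: nat)" "row1 u 0 1 = (row1 w 0 1 :: nat)"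
    "even (length u) \<longleftrightarrow> even (length w)"
  shows "u = w"
proof -
  have pos: "row1 v 1 0 \<ge> (1::nat)" if "digits_le K v" for v K
    using row_bounds(3)[of K v 0 1] that row_of_nat(1)[of v 1 0, where ?'a = real] by simp
  have le: "row1 v 0 1 \<le> (row1 v 1 0 :: nat)" if "digits_le K v" for v K
  proof (cases v)
    case (Cons k v')
    have "row1 v' 1 0 \<le> real k * row1 v' 1 0 + row1 v' 0 1"
    proof -
      have a: "digits_le K v'" "1 \<le> real k" using that Cons by auto
      have "0 \<le> row1 v' 0 (1::real)"
        by (cases v') (use a row_bounds[of K _ 0 "1::real"] in \<open>auto intro: order_trans[OF zero_le_one]\<close>)
      moreover have "1 * row1 v' 1 0 \<le> real k * row1 v' 1 0"
        using a row_bounds[of K v' 0 "1::real"] by (intro mult_right_mono) auto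
      ultimately show ?thesis by simp
    qed
    then have "real (row1 v 0 1) \<le> real (row1 v 1 0)"
      using row_of_nat(1)[of v 0 1, where ?'a = real] row_of_nat(1)[of v 1 0, where ?'a = real]
        row_linear(1)[of v' "real k" 1] by (simp add: Cons)
    then show ?thesis by simp
  qed auto
  \<comment> \<open>Different first digits leave only the ambiguity just named: the equations force
    \<open>u = [1]\<close> and \<open>w = []\<close>, and the parity excludes it.\<close>
  have main: False if ab: "a < (b::nat)" and that: "digits_le K (a # u)" "digits_le K' (b # w)"
     "row1 (a # u) 1 0 = (row1 (b # w) 1 0 :: nat)" "row1 (a # u) 0 1 = (row1 (b # w) 0 1 :: nat)"
    "even (length u) \<longleftrightarrow> even (length w)" for a b u w K K'
  proof -
    let ?t = "row1 u 1 0 :: nat"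
    have t: "row1 w 1 0 = ?t" using that by simp
    have d: "digits_le K u" "digits_le K' w" using that by auto
    have "a * ?t + row1 u 0 1 = b * ?t + row1 w 0 1"
      using that row_linear(1)[of u a 1] row_linear(1)[of w b 1] by simp
    moreover obtain c where "b = a + Suc c" using less_iff_Suc_add[of a b] ab by auto
    ultimately have e: "row1 u 0 1 = Suc c * ?t + row1 w 0 1" by (simp add: algebra_simps)
    have "row1 u 0 1 \<le> ?t" using le d by auto
    with e have e2: "row1 w 0 1 = (0::nat)" "row1 u 0 1 = ?t" using pos[OF d(1)] by auto
    have w: "w = []"
    proof (cases w)
      case (Cons x w') then show ?thesis using e2 pos[of K' w'] d by auto
    qed auto
    then have t1: "?t = 1" using t by simp
    obtain x u' where u: "u = x # u'" using e2 t1 by (cases u) auto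
    have "row1 u' 1 0 = (1::nat)" using e2 t1 u by simp
    moreover have "x * row1 u' 1 0 + row1 u' 0 1 = (1::nat)"
      using t1 u row_linear(1)[of u' x 1] by simp
    moreover have "x \<ge> 1" using d u by auto
    ultimately have z: "row1 u' 0 1 = (0::nat)" by (simp)
    have "u' = []"
    proof (cases u')
      case (Cons y u'') then show ?thesis using z pos[of K u''] d u by auto
    qed auto
    then show False using that(5) w u by simp
  qed
  show ?thesis using assms
  proof (induction u arbitrary: w)
    case Nil
    then show ?case using pos[of K' "tl w"] by (cases w) auto
  next
    case (Cons a u)
    then obtain b w' where w: "w = b # w'" using pos[of K u] by (cases w) auto
    have "a = b"
    proof (rule ccontr)
      assume "a \<noteq> b"
      moreover have "even (length u) \<longleftrightarrow> even (length w')" using Cons.prems w by auto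
      ultimately show False
        using main[of a b K u K' w'] main[of b a K' w' K u] Cons.prems(1-4) unfolding w
        by (cases "a < b") auto
    qed
    moreover have "u = w'"
    proof (rule Cons.IH)
      have "row1 u 1 0 = (row1 w' 1 0 :: nat)" using Cons.prems w by simp
      then show "row1 u 0 1 = (row1 w' 0 1 :: nat)" "row1 u 1 0 = (row1 w' 1 0 :: nat)"
        using Cons.prems(3) w \<open>a = b\<close> row_linear(1)[of u a 1] row_linear(1)[of w' a 1] by auto
    qed (use Cons.prems w in auto)
    ultimately show ?case using w by simp
  qed
qed

section \<open>Cylinder lengths and stopping families\<close>

lemma cfv_Cons_inj:
  assumes "real k + 1 / t = real k' + 1 / t'" "t \<ge> 1" "t' \<ge> 1"
  shows "k = k'" "t = t'"
proof -
  \<comment> \<open>Both reciprocals lie in the half-open interval from 0 to 1, so they differ by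
    less than 1.\<close>
  have "0 < 1 / t" "1 / t \<le> 1" "0 < 1 / t'" "1 / t' \<le> 1" using assms by auto
  then show "k = k'" using assms(1) by linarith
  then show "t = t'" using assms by auto
qed


text \<open>For \<open>x = row1 w 0 1\<close> and \<open>y = row2 w 0 1\<close> this is the length of the cylinder of \<open>w\<close>.\<close>

definition cyl :: "real \<Rightarrow> real \<Rightarrow> real" where
  "cyl x y = 1 / (x * (x + y))"

text \<open>Each summand is \<open>(1 / (k * x + y) - 1 / ((k + 1) * x + y)) / x\<close>, so the sum
  telescopes.\<close>

lemma cyl_sum:
  assumes "0 < x" "0 \<le> y"
  shows "(\<Sum>k=1..K. cyl (real k * x + y) x) = (1 / (x + y) - 1 / (real (Suc K) * x + y)) / x"
proof (induction K)
  case (Suc K)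
  define a where "a = real (Suc K) * x + y"
  have a: "a > 0" "a + x > 0" using assms unfolding a_def by (auto intro!: add_pos_nonneg mult_pos_pos)
  have "cyl a x = (1 / a - 1 / (a + x)) / x"
  proof -
    have "1 / a - 1 / (a + x) = x / (a * (a + x))" using a by (simp add: diff_frac_eq)
    then show ?thesis using assms by (simp add: cyl_def)
  qed
  moreover have "real (Suc (Suc K)) * x + y = a + x" by (simp add: a_def algebra_simps)
  moreover have "(\<Sum>k=1..Suc K. cyl (real k * x + y) x) = (\<Sum>k=1..K. cyl (real k * x + y) x) + cyl a x"
    by (simp add: a_def)
  ultimately show ?case unfolding Suc by (simp add: a_def diff_divide_distrib ac_simps)
qed auto

text \<open>The digits up to \<open>K\<close> keep at least the proportion
  \<open>1 - 2 / (K + 1)\<close> of the length. Every child has at most half the length of its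
  parent, so the power \<open>s\<close> of its length is at least the length times
  \<open>(L / 2) powr (s - 1)\<close>. The gain \<open>2 powr (1 - s)\<close> outweighs the loss of
  the large digits.\<close>

lemma cyl_powr_sum:
  fixes s :: real
  assumes "0 < x" "0 \<le> y" "y \<le> x" "0 < s" "s < 1" "2 powr (1 - s) * (1 - 2 / (real K + 1)) \<ge> 1"
  shows "(\<Sum>k=1..K. cyl (real k * x + y) x powr s) \<ge> cyl x y powr s"
proof -
  let ?L = "cyl x y"
  have L: "?L > 0" using assms by (auto simp: cyl_def intro!: divide_pos_pos mult_pos_pos)
  have each: "cyl (real k * x + y) x powr s \<ge> cyl (real k * x + y) x * (?L / 2) powr (s - 1)" if "k \<in> {1..K}" for k
  proof -
    let ?a = "real k * x + y"
    have a: "?a \<ge> x + y" using that assms mult_right_mono[of 1 "real k" x] by auto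
    have "?L / 2 = 1 / (x * (2 * (x + y)))" by (simp add: cyl_def)
    also have "\<dots> \<ge> 1 / ((x + y) * (x + y + x))"
    proof (rule divide_left_mono)
      have "y * (y + x) \<ge> 0" using assms by auto
      then show "x * (2 * (x + y)) \<le> (x + y) * (x + y + x)"
        by (simp add: algebra_simps)
      show "0 < (x + y) * (x + y + x) * (x * (2 * (x + y)))"
        using assms by (intro mult_pos_pos) auto
    qed simp
    also have "1 / ((x + y) * (x + y + x)) \<ge> 1 / (?a * (?a + x))"
    proof (rule divide_left_mono)
      have "0 < ?a" "0 < ?a + x" "0 < x + y" "0 < x + y + x" using a assms by linarith+
      then show "0 < ?a * (?a + x) * ((x + y) * (x + y + x))" by (intro mult_pos_pos)
      show "(x + y) * (x + y + x) \<le> ?a * (?a + x)"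
        using a assms by (intro mult_mono) linarith+
    qed simp
    finally have le: "cyl ?a x \<le> ?L / 2" by (simp add: cyl_def)
    have "0 < ?a" "0 < ?a + x" using a assms by linarith+
    then have p: "cyl ?a x > 0" by (simp add: cyl_def)
    have "(?L / 2) powr (s - 1) \<le> cyl ?a x powr (s - 1)"
      by (rule powr_mono2') (use le p assms in auto)
    then have "cyl ?a x * (?L / 2) powr (s - 1) \<le> cyl ?a x powr 1 * cyl ?a x powr (s - 1)"
      using p by (simp add: mult_left_mono)
    also have "\<dots> = cyl ?a x powr s" unfolding powr_add[symmetric] by simp
    finally show ?thesis .
  qed
  have sum: "(\<Sum>k=1..K. cyl (real k * x + y) x) \<ge> ?L * (1 - 2 / (real K + 1))"
  proof -
    have "(x + y) / ((real K + 1) * x + y) \<le> (2 * x) / ((real K + 1) * x)"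
      by (rule frac_le) (use assms mult_pos_pos[of "real K + 1" x] in linarith)+
    also have "\<dots> = 2 / (real K + 1)" using assms by simp
    finally have "1 - 2 / (real K + 1) \<le> 1 - (x + y) / ((real K + 1) * x + y)" by simp
    then have "?L * (1 - 2 / (real K + 1)) \<le> ?L * (1 - (x + y) / ((real K + 1) * x + y))"
      using L by (intro mult_left_mono) auto
    also have "\<dots> = (1 / (x + y) - 1 / (real (Suc K) * x + y)) / x"
    proof -
      have "(real K + 1) * x + y > 0" using assms mult_pos_pos[of "real K + 1" x] by linarith
      moreover have "real (Suc K) * x = (real K + 1) * x" by (simp add: algebra_simps)
      ultimately show ?thesis using assms unfolding cyl_def
        by (simp add: diff_divide_distrib right_diff_distrib ac_simps)
    qed
    finally show ?thesis using cyl_sum[of x y K] assms by simp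
  qed
  have "?L powr s = ?L powr 1 * ?L powr (s - 1)" unfolding powr_add[symmetric] by simp
  also have "\<dots> = ?L * ?L powr (s - 1)" using L by simp
  also have "\<dots> \<le> ?L * ?L powr (s - 1) * (2 powr (1 - s) * (1 - 2 / (real K + 1)))"
    using mult_left_mono[OF assms(6), of "?L * ?L powr (s - 1)"] L by simp
  also have "\<dots> = (?L * (1 - 2 / (real K + 1))) * (?L / 2) powr (s - 1)"
  proof -
    have "(?L / 2) powr (s - 1) = ?L powr (s - 1) / 2 powr (s - 1)"
      using L by (simp add: powr_divide)
    moreover have "2 powr (1 - s) = 1 / 2 powr (s - 1)"
      using powr_minus_divide[of 2 "s - 1"] by simp
    ultimately show ?thesis by simp
  qed
  also have "\<dots> \<le> (\<Sum>k=1..K. cyl (real k * x + y) x) * (?L / 2) powr (s - 1)"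
    using sum by (intro mult_right_mono) auto
  also have "\<dots> \<le> (\<Sum>k=1..K. cyl (real k * x + y) x powr s)"
    unfolding sum_distrib_right by (rule sum_mono) (rule each)
  finally show ?thesis .
qed

text \<open>Words of the digit tree, stopped once \<open>row1\<close> has reached \<open>v\<close>.
  They grow by two digits at a time, whence the even length and the factor \<open>(K + 1)^2\<close>.
  The sum of the powers \<open>s\<close> plays the role of a measure: it bounds from below the
  number of words and the total length of their disjoint cylinders.\<close>

definition stopping_family :: "nat \<Rightarrow> real \<Rightarrow> real \<Rightarrow> real \<Rightarrow> real \<Rightarrow> nat list set \<Rightarrow> bool" where
  "stopping_family K s v x y S \<longleftrightarrow> finite S \<and>
    (\<forall>e\<in>S. digits_le K e \<and> even (length e) \<and> v \<le> row1 e x y \<and> row1 e x y < (real K + 1)^2 * v) \<and>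
    cyl x y powr s \<le> (\<Sum>e\<in>S. cyl (row1 e x y) (row2 e x y) powr s) \<and>
    (\<forall>e\<in>S. \<forall>e'\<in>S. e \<noteq> e' \<longrightarrow> (\<forall>z\<in>{1..real K + 1}. \<forall>z'\<in>{1..real K + 1}. cfv e z \<noteq> cfv e' z'))"

lemma stopping_family_exists:
  fixes x y v s :: real
  assumes s: "0 < s" "s < 1" "2 powr (1 - s) * (1 - 2 / (real K + 1)) \<ge> 1"
    and "1 \<le> x" "0 \<le> y" "y \<le> x" "x < (real K + 1)^2 * v"
  shows "\<exists>S. stopping_family K s v x y S"
proof -
  have Nil: "stopping_family K s v x y {[]}" if "v \<le> x" "x < (real K + 1)^2 * v" for x y
    using that by (simp add: stopping_family_def)
  \<comment> \<open>Two further digits raise \<open>x + y\<close> by at least 1, and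
    \<open>2 * v <= x + y\<close> with \<open>y <= x\<close> gives \<open>v <= x\<close>, where the
    empty word suffices. So \<open>n\<close> bounds the number of rounds.\<close>
  obtain n :: nat where "2 * v - x - y \<le> real n" using real_arch_simple by blast
  then have "2 * v \<le> x + y + real n" by simp
  then show ?thesis using assms(4-)
  proof (induction n arbitrary: x y)
    case 0
    then show ?case using Nil[of x y] by auto
  next
    case (Suc n)
    show ?case
    proof (cases "v \<le> x")
      case True
      then show ?thesis using Suc Nil[of x y] by auto
    next
      case False
      define X where "X k = real k * x + y" for k :: nat
      define Y where "Y k l = real l * X k + x" for k l :: nat
      have X: "x \<le> X k" "X k \<le> (real K + 1) * x" if "k \<in> {1..K}" for k
      proof -
        have "1 * x \<le> real k * x" "real k * x \<le> real K * x"
          using that Suc.prems by (auto intro!: mult_right_mono)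
        moreover have "(real K + 1) * x = real K * x + x" by (simp add: algebra_simps)
        ultimately show "x \<le> X k" "X k \<le> (real K + 1) * x" using Suc.prems
          unfolding X_def by linarith+
      qed
      have Y: "X k + x \<le> Y k l" "Y k l \<le> (real K + 1) * X k" if "k \<in> {1..K}" "l \<in> {1..K}" for k l
      proof -
        have "1 * X k \<le> real l * X k" "real l * X k \<le> real K * X k"
          using that Suc.prems X[of k] by (auto intro!: mult_right_mono)
        moreover have "(real K + 1) * X k = real K * X k + X k" by (simp add: algebra_simps)
        ultimately show "X k + x \<le> Y k l" "Y k l \<le> (real K + 1) * X k" using X[of k] that
          unfolding Y_def by linarith+
      qed
      define T where "T p = (SOME S. stopping_family K s v (Y (fst p) (snd p)) (X (fst p)) S)" for p
      have T0: "stopping_family K s v (Y k l) (X k) (T (k, l))" if k: "k \<in> {1..K}" and l: "l \<in> {1..K}" for k l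
      proof -
        have "Y k l \<le> (real K + 1) * ((real K + 1) * x)"
          using Y[OF k l] X[OF k] by (smt (verit) mult_left_mono of_nat_0_le_iff)
        also have "\<dots> < (real K + 1)^2 * v" using False by (simp add: power2_eq_square)
        finally have "\<exists>S. stopping_family K s v (Y k l) (X k) S"
          using Suc.prems X[OF k] Y[OF k l] by (intro Suc.IH) linarith+
        then show ?thesis unfolding T_def fst_conv snd_conv by (rule someI_ex)
      qed
      have T: "finite (T (k, l))" "cyl (Y k l) (X k) powr s \<le> (\<Sum>e\<in>T (k, l). cyl (row1 e (Y k l) (X k)) (row2 e (Y k l) (X k)) powr s)"
        "\<And>e. e \<in> T (k, l) \<Longrightarrow> digits_le K e \<and> even (length e) \<and> v \<le> row1 e (Y k l) (X k) \<and> row1 e (Y k l) (X k) < (real K + 1)^2 * v"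
        "\<forall>e\<in>T (k, l). \<forall>e'\<in>T (k, l). e \<noteq> e' \<longrightarrow> (\<forall>z\<in>{1..real K + 1}. \<forall>z'\<in>{1..real K + 1}. cfv e z \<noteq> cfv e' z')"
        if "k \<in> {1..K}" "l \<in> {1..K}" for k l
        using T0[OF that] by (simp_all only: stopping_family_def) (elim conjE, assumption)
      define S where "S = (\<Union>p\<in>{1..K} \<times> {1..K}. (\<lambda>e. fst p # snd p # e) ` T p)"
      have mem: "e \<in> S \<longleftrightarrow> (\<exists>k l f. e = k # l # f \<and> k \<in> {1..K} \<and> l \<in> {1..K} \<and> f \<in> T (k, l))" for e
        unfolding S_def by force
      have fin: "finite S" unfolding S_def using T(1) by auto
      have row: "row1 (k # l # f) x y = row1 f (Y k l) (X k)" "row2 (k # l # f) x y = row2 f (Y k l) (X k)" for k l f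
        by (simp_all add: X_def Y_def)
      have "cyl x y powr s \<le> (\<Sum>k=1..K. cyl (X k) x powr s)"
        unfolding X_def by (rule cyl_powr_sum) (use Suc.prems s in auto)
      also have "\<dots> \<le> (\<Sum>k=1..K. \<Sum>l=1..K. cyl (Y k l) (X k) powr s)"
        unfolding Y_def
      proof (intro sum_mono cyl_powr_sum)
        fix k assume "k \<in> {1..K}"
        then show "0 < X k" "0 \<le> x" "x \<le> X k" using X[of k] Suc.prems by auto
      qed (use s in auto)
      also have "\<dots> \<le> (\<Sum>k=1..K. \<Sum>l=1..K. \<Sum>f\<in>T (k, l). cyl (row1 f (Y k l) (X k)) (row2 f (Y k l) (X k)) powr s)"
        by (intro sum_mono T(2))
      also have "\<dots> = (\<Sum>p\<in>{1..K} \<times> {1..K}. \<Sum>f\<in>T p. cyl (row1 (fst p # snd p # f) x y) (row2 (fst p # snd p # f) x y) powr s)"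
        unfolding row sum.cartesian_product by (simp add: case_prod_beta)
      also have "\<dots> = (\<Sum>p\<in>{1..K} \<times> {1..K}. \<Sum>e\<in>(\<lambda>e. fst p # snd p # e) ` T p. cyl (row1 e x y) (row2 e x y) powr s)"
        by (rule sum.cong[OF refl]) (simp add: sum.reindex inj_on_def)
      also have "\<dots> = (\<Sum>e\<in>S. cyl (row1 e x y) (row2 e x y) powr s)"
        unfolding S_def by (rule sum.UNION_disjoint[symmetric]) (use T(1) in \<open>auto simp: prod_eq_iff\<close>)
      finally have sm: "cyl x y powr s \<le> (\<Sum>e\<in>S. cyl (row1 e x y) (row2 e x y) powr s)" .
      have dis: "cfv e z \<noteq> cfv e' z'" if h: "e \<in> S" "e' \<in> S" "e \<noteq> e'" and z: "z \<in> {1..real K + 1}" "z' \<in> {1..real K + 1}" for e e' z z'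
      proof
        assume eq: "cfv e z = cfv e' z'"
        obtain k l f where e: "e = k # l # f" "k \<in> {1..K}" "l \<in> {1..K}" "f \<in> T (k, l)" using h(1) mem by auto
        obtain k' l' f' where e': "e' = k' # l' # f'" "k' \<in> {1..K}" "l' \<in> {1..K}" "f' \<in> T (k', l')" using h(2) mem by auto
        have d: "digits_le K f" "digits_le K f'" using T(3) e e' by auto
        have r: "cfv f z \<in> {1..real K + 1}" "cfv f' z' \<in> {1..real K + 1}"
          using cfv_range d z by auto
        have r2: "cfv (l # f) z \<ge> 1" "cfv (l' # f') z' \<ge> 1"
          using cfv_range[of K "l # f" z] cfv_range[of K "l' # f'" z'] d z e e' by auto
        have 1: "k = k'" "cfv (l # f) z = cfv (l' # f') z'"
          using cfv_Cons_inj[OF _ r2, of k k'] eq e e' by auto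
        have 2: "l = l'" "cfv f z = cfv f' z'"
          using cfv_Cons_inj[of l "cfv f z" l' "cfv f' z'"] 1(2) r by auto
        show False using T(4)[OF e(2,3)] e e' h(3) z 1 2 by auto
      qed
      show ?thesis unfolding stopping_family_def
      proof (intro exI[of _ S] conjI fin sm ballI impI)
        fix e assume "e \<in> S"
        then obtain k l f where e: "e = k # l # f" "k \<in> {1..K}" "l \<in> {1..K}" "f \<in> T (k, l)" using mem by auto
        note f = T(3)[OF e(2-4)]
        show "digits_le K e" "even (length e)" using f e by auto
        show "v \<le> row1 e x y" "row1 e x y < (real K + 1)^2 * v" unfolding e(1) row using f by auto
      qed (rule dis)
    qed
  qed
qed

section \<open>Oscillatory integrals\<close>

lemma norm_integral_cis_le:
  fixes \<phi> :: "real \<Rightarrow> real"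
  assumes "p \<le> r" "continuous_on {p..r} \<phi>"
  shows "norm (integral {p..r} (\<lambda>z. cis (\<phi> z))) \<le> r - p"
  using integral_bound[OF assms(1), of "\<lambda>z. cis (\<phi> z)" 1] assms(2)
  by (simp add: continuous_on_cis)

text \<open>Integration by parts against \<open>1 / \<phi>'\<close>.\<close>

lemma oscillatory_integral_interval:
  fixes \<phi> :: "real \<Rightarrow> real"
  assumes pr: "1 \<le> p" "p \<le> r" "r - p \<le> L" "1 \<le> L"
    and nn: "0 \<le> Q" "0 \<le> Q'" "0 \<le> R" "0 \<le> R'"
    and V: "0 < \<eta>" "\<eta> \<le> V" "1 \<le> C"
    and a: "\<And>z. z \<in> {p..r} \<Longrightarrow> V \<le> Q * z + Q' \<and> Q * z + Q' \<le> C * V"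
    and b: "\<And>z. z \<in> {p..r} \<Longrightarrow> V \<le> R * z + R' \<and> R * z + R' \<le> C * V"
    and ab: "\<And>z. z \<in> {p..r} \<Longrightarrow> \<eta> \<le> \<bar>(R * z + R') - (Q * z + Q')\<bar>"
    and \<kappa>: "\<kappa> \<noteq> 0"
    and \<phi>: "\<And>z. z \<in> {p..r} \<Longrightarrow> (\<phi> has_real_derivative \<kappa> * (1 / (Q * z + Q')^2 - 1 / (R * z + R')^2)) (at z within {p..r})"
  shows "norm (integral {p..r} (\<lambda>z. cis (\<phi> z))) \<le> 4 * L * C^6 * V^4 / (\<eta>^2 * \<bar>\<kappa>\<bar>)"
proof -
  let ?I = "integral {p..r} (\<lambda>z. cis (\<phi> z))"
  define a' where "a' z = Q * z + Q'" for z
  define b' where "b' z = R * z + R'" for z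
  define N where "N z = a' z ^ 2 * b' z ^ 2" for z
  define D where "D z = b' z ^ 2 - a' z ^ 2" for z
  define N' where "N' z = 2 * a' z * Q * b' z ^ 2 + a' z ^ 2 * (2 * b' z * R)" for z
  define D' where "D' z = 2 * b' z * R - 2 * a' z * Q" for z
  define G where "G z = N z / D z" for z
  define G' where "G' z = (N' z * D z - N z * D' z) / (D z)^2" for z
  have pos: "0 < V" "0 < C * V" "V \<le> C * V" using V by auto
  have A: "0 < a' z" "V \<le> a' z" "a' z \<le> C * V" "0 < b' z" "V \<le> b' z" "b' z \<le> C * V"
    "Q \<le> C * V" "R \<le> C * V" "2 * V * \<eta> \<le> \<bar>D z\<bar>" "D z \<noteq> 0"
    if z: "z \<in> {p..r}" for z
  proof -
    show 1: "V \<le> a' z" "a' z \<le> C * V" "V \<le> b' z" "b' z \<le> C * V"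
      using a[OF z] b[OF z] by (auto simp: a'_def b'_def)
    show "0 < a' z" "0 < b' z" using 1 pos by linarith+
    have "Q * 1 \<le> Q * z" "R * 1 \<le> R * z" using nn z pr by (intro mult_left_mono; simp)+
    then show "Q \<le> C * V" "R \<le> C * V" using 1 nn by (auto simp: a'_def b'_def)
    have "\<bar>D z\<bar> = (b' z + a' z) * \<bar>b' z - a' z\<bar>"
    proof -
      have "D z = (b' z + a' z) * (b' z - a' z)" by (simp add: D_def power2_eq_square algebra_simps)
      then show ?thesis using 1 pos by (simp add: abs_mult)
    qed
    moreover have "2 * V * \<eta> \<le> (b' z + a' z) * \<bar>b' z - a' z\<bar>"
      using 1 ab[OF z] V pos by (intro mult_mono) (auto simp: a'_def b'_def)
    ultimately show D: "2 * V * \<eta> \<le> \<bar>D z\<bar>" by simp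
    have "0 < 2 * V * \<eta>" using V pos by (intro mult_pos_pos) auto
    with D show "D z \<noteq> 0" by (metis abs_zero not_le)
  qed
  have Gd: "(G has_real_derivative G' z) (at z within {p..r})" if z: "z \<in> {p..r}" for z
  proof -
    have "(a' has_real_derivative Q) (at z within {p..r})" "(b' has_real_derivative R) (at z within {p..r})"
      unfolding a'_def b'_def by (auto intro!: derivative_eq_intros)
    from DERIV_power[OF this(1), of 2] DERIV_power[OF this(2), of 2]
    have 1: "((\<lambda>z. a' z ^ 2) has_real_derivative 2 * a' z * Q) (at z within {p..r})"
      "((\<lambda>z. b' z ^ 2) has_real_derivative 2 * b' z * R) (at z within {p..r})"
      by (simp_all add: mult_ac)
    have "(N has_real_derivative N' z) (at z within {p..r})"
      using DERIV_mult[OF 1] unfolding N_def N'_def by (simp add: mult_ac add.commute)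
    moreover have "(D has_real_derivative D' z) (at z within {p..r})"
      using DERIV_diff[OF 1(2,1)] unfolding D_def D'_def by simp
    ultimately show ?thesis
      using DERIV_divide[of N "N' z" z "{p..r}" D "D' z"] A(10)[OF z] unfolding G_def G'_def
      by (simp add: power2_eq_square)
  qed
  have Nb: "\<bar>N z\<bar> \<le> (C * V)^4" "\<bar>N' z\<bar> \<le> 4 * (C * V)^4" "\<bar>D' z\<bar> \<le> 2 * (C * V)^2" if z: "z \<in> {p..r}" for z
  proof -
    note A = A[OF z]
    have a2: "a' z ^ 2 \<le> (C * V)^2" "b' z ^ 2 \<le> (C * V)^2" using A by (auto intro!: power_mono)
    have aQ: "a' z * Q \<le> (C * V) * (C * V)" "b' z * R \<le> (C * V) * (C * V)"
      "0 \<le> a' z * Q" "0 \<le> b' z * R"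
      using A nn pos by (auto intro!: mult_mono simp del: mult_le_cancel_left mult_le_cancel_right)
    have "N z \<le> (C * V)^2 * (C * V)^2" unfolding N_def using a2 by (intro mult_mono) auto
    moreover have "N z \<ge> 0" by (simp add: N_def)
    ultimately show "\<bar>N z\<bar> \<le> (C * V)^4" by (simp flip: power_add)
    have "(a' z * Q) * b' z ^ 2 \<le> ((C * V) * (C * V)) * (C * V)^2" using a2 aQ pos by (intro mult_mono[of "a' z * Q"]) auto
    moreover have "a' z ^ 2 * (b' z * R) \<le> (C * V)^2 * ((C * V) * (C * V))" using a2 aQ by (intro mult_mono[of _ _ "b' z * R"]) auto
    moreover have "0 \<le> (a' z * Q) * b' z ^ 2" "0 \<le> a' z ^ 2 * (b' z * R)" using aQ by auto
    moreover have "N' z = 2 * ((a' z * Q) * b' z ^ 2) + 2 * (a' z ^ 2 * (b' z * R))" by (simp add: N'_def)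
    ultimately show "\<bar>N' z\<bar> \<le> 4 * (C * V)^4" by (simp add: power2_eq_square power4_eq_xxxx mult.assoc)
    show "\<bar>D' z\<bar> \<le> 2 * (C * V)^2" unfolding D'_def using aQ by (auto simp: power2_eq_square abs_le_iff)
  qed
  have Gb: "\<bar>G z\<bar> \<le> (C * V)^4 / (2 * V * \<eta>)" if z: "z \<in> {p..r}" for z
    unfolding G_def abs_divide by (rule frac_le) (use Nb[OF z] A[OF z] V pos in auto)
  have G'b: "\<bar>G' z\<bar> \<le> 4 * (C * V)^4 / (2 * V * \<eta>) + (C * V)^4 * (2 * (C * V)^2) / (2 * V * \<eta>)^2" if z: "z \<in> {p..r}" for z
  proof -
    have "G' z = N' z / D z - N z * D' z / (D z)^2"
      unfolding G'_def using A(10)[OF z] by (simp add: field_simps power2_eq_square)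
    then have "\<bar>G' z\<bar> \<le> \<bar>N' z\<bar> / \<bar>D z\<bar> + \<bar>N z\<bar> * \<bar>D' z\<bar> / \<bar>D z\<bar>^2"
      by (metis abs_divide abs_mult abs_triangle_ineq4 power2_abs power_abs)
    also have "\<dots> \<le> 4 * (C * V)^4 / (2 * V * \<eta>) + (C * V)^4 * (2 * (C * V)^2) / (2 * V * \<eta>)^2"
    proof (intro add_mono frac_le mult_mono power_mono)
    qed (use Nb[OF z] A[OF z] V pos in auto)
    finally show ?thesis .
  qed
  have \<phi>c: "continuous_on {p..r} \<phi>"
    by (rule DERIV_continuous_on[OF \<phi>])
  \<comment> \<open>The derivative of the phase is \<open>\<kappa> * D / N = \<kappa> / G\<close>,
    so \<open>E\<close> is \<open>cis \<phi>\<close> divided by i times that derivative.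
    Differentiating \<open>E\<close> gives the integrand plus \<open>e2\<close>, the term in which
    \<open>G\<close> is differentiated.\<close>
  define E where "E z = cis (\<phi> z) * (- \<i> * of_real (G z / \<kappa>))" for z
  define M1 where "M1 = (C * V)^4 / (2 * V * \<eta>)"
  define M2 where "M2 = 4 * (C * V)^4 / (2 * V * \<eta>) + (C * V)^4 * (2 * (C * V)^2) / (2 * V * \<eta>)^2"
  define e2 where "e2 z = cis (\<phi> z) * (- \<i> * of_real (G' z / \<kappa>))" for z
  have Ed: "(E has_vector_derivative (cis (\<phi> z) + e2 z)) (at z within {p..r})" if z: "z \<in> {p..r}" for z
  proof -
    let ?c = "\<kappa> * (1 / (Q * z + Q')^2 - 1 / (R * z + R')^2)"
    have c: "?c * (G z / \<kappa>) = 1"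
    proof -
      have "1 / (Q * z + Q')^2 - 1 / (R * z + R')^2 = D z / N z"
        using A(1,4)[OF z] by (simp add: N_def D_def a'_def b'_def field_simps)
      moreover have "N z \<noteq> 0" using A(1,4)[OF z] by (simp add: N_def)
      ultimately show ?thesis using \<kappa> A(10)[OF z] by (simp add: G_def)
    qed
    have 1: "((\<lambda>z. cis (\<phi> z)) has_vector_derivative (of_real ?c * (\<i> * cis (\<phi> z)))) (at z within {p..r})"
    proof -
      have "((\<lambda>z. cos (\<phi> z)) has_real_derivative - sin (\<phi> z) * ?c) (at z within {p..r})"
           "((\<lambda>z. sin (\<phi> z)) has_real_derivative cos (\<phi> z) * ?c) (at z within {p..r})"
        by (auto intro!: derivative_eq_intros \<phi>[OF z])
      from this[THEN has_vector_derivative_of_real, where ?'a = complex]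
      have "((\<lambda>z. of_real (cos (\<phi> z)) + of_real (sin (\<phi> z)) * \<i>) has_vector_derivative
           (of_real (- sin (\<phi> z) * ?c) + of_real (cos (\<phi> z) * ?c) * \<i>)) (at z within {p..r})"
        by (intro has_vector_derivative_add has_vector_derivative_mult_left)
      moreover have "of_real (cos t) + of_real (sin t) * \<i> = cis t" for t by (simp add: complex_eq_iff)
      moreover have "of_real (- sin t * c) + of_real (cos t * c) * \<i> = of_real c * (\<i> * cis t)" for t c
        by (simp add: complex_eq_iff)
      ultimately show ?thesis by (simp only:)
    qed
    have 2: "((\<lambda>z. - \<i> * of_real (G z / \<kappa>)) has_vector_derivative (- \<i> * of_real (G' z / \<kappa>))) (at z within {p..r})"
    proof (rule has_vector_derivative_mult_right, rule has_vector_derivative_of_real)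
      show "((\<lambda>z. G z / \<kappa>) has_real_derivative G' z / \<kappa>) (at z within {p..r})"
        by (rule DERIV_cdivide) (rule Gd[OF z])
    qed
    have "of_real ?c * (\<i> * cis (\<phi> z)) * (- \<i> * of_real (G z / \<kappa>)) = cis (\<phi> z) * of_real (?c * (G z / \<kappa>))"
      by (simp add: complex_eq_iff)
    also have "\<dots> = cis (\<phi> z)" unfolding c by simp
    finally have 3: "of_real ?c * (\<i> * cis (\<phi> z)) * (- \<i> * of_real (G z / \<kappa>)) = cis (\<phi> z)" .
    show ?thesis
      unfolding E_def using has_vector_derivative_mult[OF 1 2] unfolding 3 e2_def by (simp only: add.commute)
  qed
  have "((\<lambda>z. cis (\<phi> z) + e2 z) has_integral (E r - E p)) {p..r}"
    by (rule fundamental_theorem_of_calculus[OF pr(2)]) (rule Ed)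
  moreover have ci: "(\<lambda>z. cis (\<phi> z)) integrable_on {p..r}"
    by (intro integrable_continuous_real continuous_on_cis \<phi>c)
  ultimately have e2i: "(e2 has_integral (E r - E p - ?I)) {p..r}"
    using has_integral_diff[of "\<lambda>z. cis (\<phi> z) + e2 z" "E r - E p" "{p..r}" "\<lambda>z. cis (\<phi> z)"]
    by (simp add: has_integral_integral)
  have M: "0 \<le> M1" "0 \<le> M2" unfolding M1_def M2_def using V pos by auto
  have "norm (integral {p..r} e2) \<le> integral {p..r} (\<lambda>z. M2 / \<bar>\<kappa>\<bar>)"
  proof (rule integral_norm_bound_integral)
    show "e2 integrable_on {p..r}" using e2i by blast
    fix z assume "z \<in> {p..r}"
    then show "norm (e2 z) \<le> M2 / \<bar>\<kappa>\<bar>"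
      using G'b[of z] by (simp add: e2_def norm_mult norm_divide M2_def divide_right_mono)
  qed (rule integrable_const_ivl)
  also have "\<dots> = (r - p) * (M2 / \<bar>\<kappa>\<bar>)" using pr by simp
  also have "\<dots> \<le> L * (M2 / \<bar>\<kappa>\<bar>)" using pr M by (intro mult_right_mono) auto
  finally have I2: "norm (integral {p..r} e2) \<le> L * (M2 / \<bar>\<kappa>\<bar>)" .
  have En: "norm (E z) \<le> M1 / \<bar>\<kappa>\<bar>" if "z \<in> {p..r}" for z
    using divide_right_mono[OF Gb[OF that, folded M1_def], of "\<bar>\<kappa>\<bar>"]
    by (simp add: E_def norm_mult norm_divide)
  have "?I = E r - E p - integral {p..r} e2"
    using e2i by (simp add: integral_unique)
  then have "norm ?I \<le> norm (E r) + norm (E p) + norm (integral {p..r} e2)"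
    by (metis add_mono_thms_linordered_semiring(3) norm_triangle_ineq4 order_trans)
  also have "\<dots> \<le> M1 / \<bar>\<kappa>\<bar> + M1 / \<bar>\<kappa>\<bar> + L * (M2 / \<bar>\<kappa>\<bar>)"
    using En[of r] En[of p] I2 pr by simp
  also have "\<dots> = (2 * M1 + L * M2) / \<bar>\<kappa>\<bar>" by (simp add: add_divide_distrib)
  also have "\<dots> \<le> (4 * L * C^6 * V^4 / \<eta>^2) / \<bar>\<kappa>\<bar>"
  proof (rule divide_right_mono)
    have r: "V / \<eta> \<ge> 1" using V by simp
    have t1: "(C * V)^4 / (2 * V * \<eta>) = C^4 * V^2 * (V / \<eta>) / 2"
      using pos by (simp add: field_simps power_numeral_reduce)
    have t2: "(C * V)^4 * (2 * (C * V)^2) / (2 * V * \<eta>)^2 = C^6 * V^2 * (V / \<eta>)^2 / 2"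
      using pos V by (simp add: field_simps power_numeral_reduce)
    define T where "T = C^6 * V^2 * (V / \<eta>)^2"
    have T1: "C^4 * V^2 * (V / \<eta>) \<le> T" unfolding T_def
      using r V power_increasing[of 4 6 C] power_increasing[of 1 2 "V / \<eta>"] by (intro mult_mono) auto
    have T0: "0 \<le> T" by (simp add: T_def)
    have M1': "2 * M1 \<le> T" using T1 t1 by (simp add: M1_def)
    have "M2 = 4 * M1 + T / 2" unfolding M2_def t2 by (simp add: M1_def T_def)
    with M1' have M2': "M2 \<le> 5/2 * T" by linarith
    have "2 * M1 + L * M2 \<le> T + L * (5/2 * T)"
      using M1' M2' pr(4) by (intro add_mono mult_left_mono) auto
    also have "\<dots> \<le> 4 * L * T" using pr(4) mult_right_mono[OF pr(4) T0] T0 by (simp add: algebra_simps)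
    also have "\<dots> = 4 * L * C^6 * V^4 / \<eta>^2"
      by (simp add: T_def field_simps power_numeral_reduce)
    finally show "2 * M1 + L * M2 \<le> 4 * L * C^6 * V^4 / \<eta>^2" .
  qed simp
  finally show ?thesis unfolding divide_divide_eq_left .
qed

text \<open>The phase is stationary where the two linear forms agree, at \<open>z0\<close>. Within
  \<open>\<rho> = \<eta> / |R - Q|\<close> of \<open>z0\<close> the integrand is bounded trivially,
  at a cost of \<open>2 * \<eta> / d\<close>. Farther away the forms differ by at least
  \<open>\<eta>\<close>, and the two remaining intervals are integrated by parts.\<close>

lemma oscillatory_integral:
  fixes \<phi> :: "real \<Rightarrow> real"
  assumes L: "1 \<le> L"
    and nn: "0 \<le> Q" "0 \<le> Q'" "0 \<le> R" "0 \<le> R'"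
    and V: "0 < \<eta>" "\<eta> \<le> V" "1 \<le> C" and d: "0 < d" "d \<le> \<bar>R - Q\<bar>"
    and a: "\<And>z. z \<in> {1..L} \<Longrightarrow> V \<le> Q * z + Q' \<and> Q * z + Q' \<le> C * V"
    and b: "\<And>z. z \<in> {1..L} \<Longrightarrow> V \<le> R * z + R' \<and> R * z + R' \<le> C * V"
    and \<kappa>: "\<kappa> \<noteq> 0"
    and \<phi>: "\<And>z. z \<in> {1..L} \<Longrightarrow> (\<phi> has_real_derivative \<kappa> * (1 / (Q * z + Q')^2 - 1 / (R * z + R')^2)) (at z within {1..L})"
  shows "norm (integral {1..L} (\<lambda>z. cis (\<phi> z))) \<le> 2 * \<eta> / d + 8 * L * C^6 * V^4 / (\<eta>^2 * \<bar>\<kappa>\<bar>)"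
proof -
  let ?I = "\<lambda>x y. integral {x..y} (\<lambda>z. cis (\<phi> z))"
  define z0 where "z0 = - (R' - Q') / (R - Q)"
  define \<rho> where "\<rho> = \<eta> / \<bar>R - Q\<bar>"
  \<comment> \<open>Both cuts are clamped to \<open>{1..L}\<close>, since \<open>z0\<close> may lie
    outside; a piece may then shrink to a point.\<close>
  define p where "p = min (max 1 (z0 - \<rho>)) L"
  define r where "r = min (max 1 (z0 + \<rho>)) L"
  have \<rho>: "\<rho> > 0" "\<rho> \<le> \<eta> / d" unfolding \<rho>_def using V d by (auto intro!: divide_left_mono mult_pos_pos)
  have o: "1 \<le> p" "p \<le> r" "r \<le> L" unfolding p_def r_def using L \<rho> by auto
  have diff: "\<bar>(R * z + R') - (Q * z + Q')\<bar> = \<bar>R - Q\<bar> * \<bar>z - z0\<bar>" for z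
  proof -
    have "(R * z + R') - (Q * z + Q') = (R - Q) * (z - z0)"
      unfolding z0_def using d by (simp add: field_simps)
    then show ?thesis by (simp add: abs_mult)
  qed
  have far: "\<eta> \<le> \<bar>(R * z + R') - (Q * z + Q')\<bar>" if "\<bar>z - z0\<bar> \<ge> \<rho>" for z
    unfolding diff using that d mult_left_mono[OF that, of "\<bar>R - Q\<bar>"] by (simp add: \<rho>_def)
  have \<phi>c: "continuous_on {1..L} \<phi>"
    by (rule DERIV_continuous_on[OF \<phi>])
  let ?B = "4 * L * C^6 * V^4 / (\<eta>^2 * \<bar>\<kappa>\<bar>)"
  have B0: "0 \<le> ?B" using L V by (intro divide_nonneg_nonneg mult_nonneg_nonneg) auto
  have part: "norm (?I x y) \<le> ?B"
    if "1 \<le> x" "x \<le> y" "y \<le> L" "\<And>z. z \<in> {x..y} \<Longrightarrow> \<bar>z - z0\<bar> \<ge> \<rho>" for x y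
  proof (rule oscillatory_integral_interval)
    fix z assume z: "z \<in> {x..y}"
    then have z1: "z \<in> {1..L}" using that by auto
    show "V \<le> Q * z + Q' \<and> Q * z + Q' \<le> C * V" "V \<le> R * z + R' \<and> R * z + R' \<le> C * V"
      using a[OF z1] b[OF z1] by auto
    show "\<eta> \<le> \<bar>(R * z + R') - (Q * z + Q')\<bar>" using far that(4)[OF z] by auto
    show "(\<phi> has_real_derivative \<kappa> * (1 / (Q * z + Q')^2 - 1 / (R * z + R')^2)) (at z within {x..y})"
      by (rule has_field_derivative_subset[OF \<phi>[OF z1]]) (use that in auto)
  qed (use that L nn V \<kappa> in auto)
  have p1: "norm (?I 1 p) \<le> ?B"
  proof (cases "p = 1")
    case True then show ?thesis using B0 by simp
  next
    case False
    then have "p \<le> z0 - \<rho>" unfolding p_def using L by (auto simp: min_def max_def split: if_splits)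
    then show ?thesis using o by (intro part) auto
  qed
  have p3: "norm (?I r L) \<le> ?B"
  proof (cases "r = L")
    case True then show ?thesis using B0 by simp
  next
    case False
    then have "z0 + \<rho> \<le> r" unfolding r_def using L by (auto simp: min_def max_def split: if_splits)
    then show ?thesis using o by (intro part) auto
  qed
  have "norm (?I p r) \<le> r - p"
    by (rule norm_integral_cis_le[OF o(2)]) (use \<phi>c o in \<open>auto elim: continuous_on_subset\<close>)
  also have "\<dots> \<le> 2 * \<rho>" unfolding p_def r_def using \<rho>(1) L by (auto simp: min_def max_def)
  also have "\<dots> \<le> 2 * \<eta> / d" using \<rho>(2) by simp
  finally have p2: "norm (?I p r) \<le> 2 * \<eta> / d" .
  have int: "(\<lambda>z. cis (\<phi> z)) integrable_on {1..L}"
    by (intro integrable_continuous_real continuous_on_cis \<phi>c)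
  have "?I 1 L = ?I 1 p + ?I p r + ?I r L"
    using Henstock_Kurzweil_Integration.integral_combine[of 1 p L "\<lambda>z. cis (\<phi> z)"]
      Henstock_Kurzweil_Integration.integral_combine[of p r L "\<lambda>z. cis (\<phi> z)"] o int
      integrable_on_subinterval[OF int, of p L] by (simp add: add.assoc)
  then have "norm (?I 1 L) \<le> norm (?I 1 p) + norm (?I p r) + norm (?I r L)"
    by (metis add_mono_thms_linordered_semiring(3) norm_triangle_ineq order_trans)
  also have "\<dots> \<le> ?B + 2 * \<eta> / d + ?B"
    by (intro add_mono p1 p2 p3)
  finally have *: "norm (?I 1 L) \<le> ?B + 2 * \<eta> / d + ?B" .
  have "4 * L * x * y / w + t + 4 * L * x * y / w = t + 8 * L * x * y / w" for x y w t :: real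
    by simp
  from * this show ?thesis by (rule ord_le_eq_trans)
qed


section \<open>Weyl sums and points that stay away from the integers\<close>

lemma dist_int_le: "dist_int x \<le> \<bar>x - of_int k\<bar>"
  unfolding dist_int_eq_round by (rule round_diff_minimal)

lemma dist_int_nonneg [simp]: "0 \<le> dist_int x"
  unfolding dist_int_eq_round by simp

lemma dist_int_lipschitz: "dist_int x \<le> dist_int y + \<bar>x - y\<bar>"
  using dist_int_le[of x "round y"] unfolding dist_int_eq_round[of y] by linarith

text \<open>Jordan's inequality: sine is concave between 0 and \<open>pi / 2\<close>, so it lies
  above its chord.\<close>

lemma sin_abs_ge:
  fixes t :: real
  assumes "\<bar>t\<bar> \<le> 1/2"
  shows "2 * \<bar>t\<bar> \<le> \<bar>sin (pi * t)\<bar>"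
proof -
  have *: "2 * t \<le> sin (pi * t)" if "0 \<le> t" "t \<le> 1/2" for t :: real
  proof -
    have "convex_on {0..pi/2} (\<lambda>x. - sin x)"
    proof (rule convex_on_realI[of _ _ "\<lambda>x. - cos x"])
      fix x y :: real assume "x \<in> {0..pi/2}" "y \<in> {0..pi/2}" "x \<le> y"
      then show "- cos x \<le> - cos y" using cos_mono_le_eq[of x y] pi_gt_zero by auto
    qed (auto intro!: derivative_eq_intros)
    from convex_onD[OF this, of "2 * t" 0 "pi / 2"] that show ?thesis
      by (simp add: algebra_simps)
  qed
  show ?thesis
    using *[of t] *[of "-t"] assms by (cases "t \<ge> 0") auto
qed

text \<open>This is a geometric sum with ratio \<open>c\<close>, and
  \<open>norm (1 - c) = 2 * |sin (pi * t)|\<close> is at least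
  \<open>4 * \<epsilon>\<close>.\<close>

lemma norm_exp_sum_le:
  assumes "\<epsilon> > 0" "\<epsilon> \<le> dist_int x"
  shows "norm (\<Sum>k<H. cis (2 * pi * real k * x)) \<le> 1 / (2 * \<epsilon>)"
proof -
  define t where "t = x - of_int (round x)"
  have t: "\<bar>t\<bar> = dist_int x" "\<bar>t\<bar> \<le> 1/2"
    unfolding t_def dist_int_eq_round using of_int_round_abs_le[of x] by (auto simp: abs_minus_commute)
  define c where "c = cis (2 * pi * x)"
  have c: "c = cis (2 * pi * t)"
  proof -
    have "2 * pi * x = 2 * pi * t + 2 * pi * of_int (round x)" by (simp add: t_def algebra_simps)
    then show ?thesis unfolding c_def by (simp add: cis_mult[symmetric] cis_multiple_2pi)
  qed
  have "norm (1 - c) = 2 * \<bar>sin (pi * t)\<bar>"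
  proof -
    have "norm (1 - c)^2 = (1 - cos (2 * pi * t))^2 + sin (2 * pi * t)^2"
      by (simp add: c cmod_power2)
    also have "\<dots> = 2 * (1 - cos (2 * (pi * t)))"
      using sin_cos_squared_add[of "2 * pi * t"] by (simp add: power2_eq_square algebra_simps)
    also have "\<dots> = (2 * \<bar>sin (pi * t)\<bar>)^2"
      unfolding cos_double_sin by (simp add: power_mult_distrib)
    finally show ?thesis by (rule power2_eq_imp_eq) auto
  qed
  then have n: "norm (1 - c) \<ge> 4 * \<epsilon>" using sin_abs_ge[OF t(2)] t(1) assms by linarith
  then have "c \<noteq> 1" using assms by auto
  have "(\<Sum>k<H. cis (2 * pi * real k * x)) = (\<Sum>k<H. c ^ k)"
    unfolding c_def by (intro sum.cong refl) (simp add: Complex.DeMoivre, simp add: mult_ac)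
  also have "\<dots> = (1 - c ^ H) / (1 - c)" using \<open>c \<noteq> 1\<close> by (simp add: sum_gp_strict)
  finally have "norm (\<Sum>k<H. cis (2 * pi * real k * x)) = norm (1 - c ^ H) / norm (1 - c)"
    by (simp add: norm_divide)
  also have "\<dots> \<le> 2 / (4 * \<epsilon>)"
  proof (rule frac_le)
    have "norm (1 - c ^ H) \<le> norm (1::complex) + norm (c ^ H)" by (rule norm_triangle_ineq4)
    then show "norm (1 - c ^ H) \<le> 2" by (simp add: c norm_power)
  qed (use n assms in auto)
  finally show ?thesis by simp
qed

text \<open>If all the points \<open>f u z - \<delta>\<close> stay away from the integers, then some Weyl sum over \<open>u\<close> is
  large at \<open>z\<close>; the mean squares of the Weyl sums limit the measure of such \<open>z\<close>.\<close>

lemma missed_intervals_length: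
  fixes f :: "'i \<Rightarrow> real \<Rightarrow> real" and l r :: "'e \<Rightarrow> real"
  assumes U: "finite U" "U \<noteq> {}" and L: "1 \<le> L"
    and f: "\<And>u. u \<in> U \<Longrightarrow> continuous_on {1..L} (f u)"
    and far: "\<And>u u' h. u \<in> U \<Longrightarrow> u' \<in> U \<Longrightarrow> P u u' \<Longrightarrow> h \<noteq> 0 \<Longrightarrow>
      norm (integral {1..L} (\<lambda>z. cis (2 * pi * of_int h * (f u z - f u' z)))) \<le> B"
    and near: "\<And>u. u \<in> U \<Longrightarrow> real (card {u' \<in> U. \<not> P u u'}) \<le> N" and B: "0 \<le> B"
    and E: "finite E" "\<And>e. e \<in> E \<Longrightarrow> 1 \<le> l e \<and> l e \<le> r e \<and> r e \<le> L"
      "\<And>e e'. e \<in> E \<Longrightarrow> e' \<in> E \<Longrightarrow> e \<noteq> e' \<Longrightarrow> {l e..r e} \<inter> {l e'..r e'} = {}"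
    and miss: "\<And>e z u. e \<in> E \<Longrightarrow> z \<in> {l e..r e} \<Longrightarrow> u \<in> U \<Longrightarrow> \<epsilon> \<le> dist_int (f u z - \<delta>)"
    and H: "0 < \<epsilon>" "1 \<le> 2 * real H * \<epsilon>^2"
  shows "(\<Sum>e\<in>E. r e - l e) \<le> 4 * real H ^ 2 * (L * N / real (card U) + B)"
proof -
  define S where "S h z = (\<Sum>u\<in>U. cis (2 * pi * of_int h * f u z))" for h :: int and z
  \<comment> \<open>The off-diagonal pairs: the squared norm of an exponential sum over
    \<open>k < H\<close> expands into Weyl sums \<open>S (k - j)\<close>, and only
    \<open>k = j\<close> does not oscillate.\<close>
  define I where "I = {(k, j) \<in> {..<int H} \<times> {..<int H}. 0 \<le> k \<and> 0 \<le> j \<and> k \<noteq> j}"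
  define g where "g z = (\<Sum>(k, j)\<in>I. norm (S (k - j) z) ^ 2)" for z
  define W where "W = real (card U)"
  have W: "W > 0" using U by (simp add: W_def card_gt_0_iff)
  have finI: "finite I"
    by (rule finite_subset[of _ "{0..<int H} \<times> {0..<int H}"]) (auto simp: I_def)
  have cardI: "real (card I) \<le> real H ^ 2"
  proof -
    have "card I \<le> card ({0..<int H} \<times> {0..<int H})"
      by (rule card_mono) (auto simp: I_def)
    also have "\<dots> = H ^ 2" by (simp add: card_cartesian_product power2_eq_square)
    finally show ?thesis by (metis of_nat_le_iff of_nat_power)
  qed
  have H0: "real H > 0" using H by (cases "H = 0") auto
  have Hbig: "1 / (2 * \<epsilon>) ^ 2 \<le> real H / 2"
    using H by (simp add: field_simps power2_eq_square)
  \<comment> \<open>Summed over \<open>u\<close>, the squared norms of \<open>T u\<close> are at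
    most \<open>W * H / 2\<close>, while their diagonal terms alone give \<open>W * H\<close>. The
    off-diagonal Weyl sums must make up the difference, and Cauchy-Schwarz over at most
    \<open>H^2\<close> pairs turns this into \<open>W^2 / 4\<close>.\<close>
  have big: "W ^ 2 / 4 \<le> g z" if z: "\<And>u. u \<in> U \<Longrightarrow> \<epsilon> \<le> dist_int (f u z - \<delta>)" for z
  proof -
    define T where "T u = (\<Sum>k<H. cis (2 * pi * real k * (f u z - \<delta>)))" for u
    have "norm (T u) ^ 2 \<le> real H / 2" if u: "u \<in> U" for u
    proof -
      have "norm (T u) \<le> 1 / (2 * \<epsilon>)" unfolding T_def by (rule norm_exp_sum_le[OF H(1) z[OF u]])
      then have "norm (T u) ^ 2 \<le> (1 / (2 * \<epsilon>)) ^ 2" by (intro power_mono) auto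
      then show ?thesis using Hbig by (simp add: power_divide)
    qed
    then have 1: "(\<Sum>u\<in>U. norm (T u) ^ 2) \<le> W * (real H / 2)"
      unfolding W_def by (rule sum_bounded_above)
    let ?F = "\<lambda>(k, j). cis (- (2 * pi * of_int (k - j) * \<delta>)) * S (k - j) z"
    define J where "J = {0..<int H} \<times> {0..<int H}"
    have sq: "of_real (norm (T u) ^ 2) = (\<Sum>(k, j)\<in>J. cis (2 * pi * of_int (k - j) * (f u z - \<delta>)))" for u
    proof -
      have Tu: "T u = (\<Sum>k\<in>{0..<int H}. cis (2 * pi * of_int k * (f u z - \<delta>)))"
        unfolding T_def by (rule sum.reindex_bij_witness[of _ nat int]) auto
      have "of_real (norm (T u) ^ 2) = T u * cnj (T u)"
        by (rule complex_norm_square)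
      also have "\<dots> = (\<Sum>k\<in>{0..<int H}. \<Sum>j\<in>{0..<int H}. cis (2 * pi * of_int k * (f u z - \<delta>)) * cnj (cis (2 * pi * of_int j * (f u z - \<delta>))))"
        unfolding Tu cnj_sum by (rule sum_product)
      also have "\<dots> = (\<Sum>(k, j)\<in>J. cis (2 * pi * of_int (k - j) * (f u z - \<delta>)))"
        unfolding J_def sum.cartesian_product
        by (intro sum.cong refl) (auto simp: cis_cnj cis_mult algebra_simps)
      finally show ?thesis .
    qed
    have "of_real (\<Sum>u\<in>U. norm (T u) ^ 2) = (\<Sum>(k, j)\<in>J. \<Sum>u\<in>U. cis (2 * pi * of_int (k - j) * (f u z - \<delta>)))"
      unfolding of_real_sum sq split_beta by (rule sum.swap)
    also have "\<dots> = (\<Sum>p\<in>J. ?F p)"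
      unfolding S_def sum_distrib_left by (intro sum.cong refl) (auto simp: cis_mult algebra_simps intro!: sum.cong)
    also have "\<dots> = (\<Sum>p\<in>I. ?F p) + (\<Sum>p\<in>J - I. ?F p)"
      by (subst add.commute, rule sum.subset_diff) (auto simp: I_def J_def)
    also have "(\<Sum>p\<in>J - I. ?F p) = (\<Sum>(k, j)\<in>J - I. of_real W)"
      by (intro sum.cong refl) (auto simp: I_def J_def S_def W_def)
    also have "\<dots> = of_real (real H * W)"
    proof -
      have "J - I = (\<lambda>k. (k, k)) ` {0..<int H}" by (auto simp: I_def J_def)
      then have "card (J - I) = H" by (simp add: card_image inj_on_def)
      then show ?thesis by (simp add: split_beta)
    qed
    finally have eq: "complex_of_real (\<Sum>u\<in>U. norm (T u) ^ 2) = (\<Sum>p\<in>I. ?F p) + of_real (real H * W)" .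
    have cancel: "norm (y - (x + y)) = norm x" for x y :: complex by simp
    have "\<bar>real H * W - (\<Sum>u\<in>U. norm (T u) ^ 2)\<bar> = norm (complex_of_real (real H * W - (\<Sum>u\<in>U. norm (T u) ^ 2)))"
      by (rule norm_of_real[symmetric])
    also have "\<dots> = norm (\<Sum>p\<in>I. ?F p)"
      unfolding of_real_diff eq by (rule cancel)
    also have "\<dots> \<le> (\<Sum>(k, j)\<in>I. norm (S (k - j) z))"
      by (rule order_trans[OF norm_sum]) (auto simp: norm_mult split_beta)
    finally have "real H * W / 2 \<le> (\<Sum>(k, j)\<in>I. norm (S (k - j) z))" using 1 by (simp add: algebra_simps)
    then have "(real H * W / 2)^2 \<le> (\<Sum>(k, j)\<in>I. norm (S (k - j) z))^2"
      using H0 W by (intro power_mono) auto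
    also have "\<dots> \<le> real (card I) * g z"
      using sum_squared_le_sum_of_squares[of "\<lambda>(k, j). norm (S (k - j) z)" I] unfolding g_def split_beta by (simp add: mult.commute)
    also have "\<dots> \<le> real H ^ 2 * g z"
      using cardI by (intro mult_right_mono) (auto simp: g_def intro!: sum_nonneg)
    finally have "real H ^ 2 * (W ^ 2 / 4) \<le> real H ^ 2 * g z" by (simp add: power_divide power_mult_distrib)
    then show ?thesis using H0 by (simp add: mult_le_cancel_left)
  qed
  have contS: "continuous_on {1..L} (\<lambda>z. S h z)" for h
    unfolding S_def by (intro continuous_intros f continuous_on_cis)
  have contg: "continuous_on {1..L} g"
    unfolding g_def split_beta by (intro continuous_intros contS)
  \<comment> \<open>For each \<open>u\<close>, every far \<open>u'\<close> contributes at most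
    \<open>B\<close>, and each of the at most \<open>N\<close> near ones at most the trivial
    \<open>L\<close>.\<close>
  have intS: "integral {1..L} (\<lambda>z. norm (S h z) ^ 2) \<le> W * N * L + W ^ 2 * B" if h: "h \<noteq> 0" for h
  proof -
    define c where "c u u' z = cis (2 * pi * of_int h * (f u z - f u' z))" for u u' z
    have cc: "continuous_on {1..L} (c u u')" if "u \<in> U" "u' \<in> U" for u u'
      unfolding c_def by (intro continuous_intros f continuous_on_cis that)
    have ci: "(c u u') integrable_on {1..L}" if "u \<in> U" "u' \<in> U" for u u'
      by (rule integrable_continuous_real[OF cc[OF that]])
    have sq: "of_real (norm (S h z) ^ 2) = (\<Sum>u\<in>U. \<Sum>u'\<in>U. c u u' z)" for z
    proof -
      have "of_real (norm (S h z) ^ 2) = S h z * cnj (S h z)"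
        by (rule complex_norm_square)
      also have "\<dots> = (\<Sum>u\<in>U. \<Sum>u'\<in>U. cis (2 * pi * of_int h * f u z) * cnj (cis (2 * pi * of_int h * f u' z)))"
        unfolding S_def cnj_sum by (rule sum_product)
      also have "\<dots> = (\<Sum>u\<in>U. \<Sum>u'\<in>U. c u u' z)"
        by (intro sum.cong refl) (simp add: c_def cis_cnj cis_mult algebra_simps)
      finally show ?thesis .
    qed
    have rint: "(\<lambda>z. norm (S h z) ^ 2) integrable_on {1..L}"
      by (intro integrable_continuous_real continuous_intros contS)
    have "of_real (integral {1..L} (\<lambda>z. norm (S h z) ^ 2)) = integral {1..L} (\<lambda>z. complex_of_real (norm (S h z) ^ 2))"
      by (rule integral_linear[OF rint bounded_linear_of_real, unfolded o_def, symmetric])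
    also have "\<dots> = integral {1..L} (\<lambda>z. \<Sum>u\<in>U. \<Sum>u'\<in>U. c u u' z)" unfolding sq ..
    also have "\<dots> = (\<Sum>u\<in>U. \<Sum>u'\<in>U. integral {1..L} (c u u'))"
      using U(1) ci by (simp add: integral_sum integrable_sum)
    finally have "\<bar>integral {1..L} (\<lambda>z. norm (S h z) ^ 2)\<bar> = norm (\<Sum>u\<in>U. \<Sum>u'\<in>U. integral {1..L} (c u u'))"
      by (metis norm_of_real)
    also have "\<dots> \<le> (\<Sum>u\<in>U. norm (\<Sum>u'\<in>U. integral {1..L} (c u u')))" by (rule norm_sum)
    also have "\<dots> \<le> (\<Sum>u\<in>U. N * L + W * B)"
    proof (rule sum_mono)
      fix u assume u: "u \<in> U"
      have "norm (\<Sum>u'\<in>U. integral {1..L} (c u u')) \<le> (\<Sum>u'\<in>U. norm (integral {1..L} (c u u')))" by (rule norm_sum)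
      also have "\<dots> \<le> (\<Sum>u'\<in>U. (if P u u' then B else L))"
      proof (rule sum_mono)
        fix u' assume u': "u' \<in> U"
        have "norm (integral {1..L} (c u u')) \<le> L - 1"
          unfolding c_def by (rule norm_integral_cis_le[OF L]) (intro continuous_intros f u u')
        then show "norm (integral {1..L} (c u u')) \<le> (if P u u' then B else L)"
          using far[OF u u' _ h] unfolding c_def by auto
      qed
      also have "\<dots> = real (card {u' \<in> U. P u u'}) * B + real (card {u' \<in> U. \<not> P u u'}) * L"
        using U(1) by (simp add: sum.If_cases Int_def)
      also have "\<dots> \<le> W * B + N * L"
        using near[OF u] B L U(1) unfolding W_def by (intro add_mono mult_right_mono) (auto intro!: card_mono)
      finally show "norm (\<Sum>u'\<in>U. integral {1..L} (c u u')) \<le> N * L + W * B" by simp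
    qed
    also have "\<dots> = W * N * L + W ^ 2 * B" by (simp add: W_def algebra_simps power2_eq_square)
    finally show ?thesis by simp
  qed
  \<comment> \<open>By disjointness this step function takes only the values 0 and
    \<open>W^2 / 4\<close>, so it lies below \<open>g\<close>; integration compares the total length
    with the mean squares.\<close>
  let ?ind = "\<lambda>z. \<Sum>e\<in>E. (W ^ 2 / 4) * indicator {l e..r e} z"
  have "(\<Sum>e\<in>E. r e - l e) * (W ^ 2 / 4) = integral {1..L} ?ind
      \<and> ?ind integrable_on {1..L}"
  proof -
    have 1: "((\<lambda>z. (W ^ 2 / 4) * indicator {l e..r e} z) has_integral (W ^ 2 / 4) * (r e - l e)) {1..L}" if e: "e \<in> E" for e
    proof (rule has_integral_mult_right)
      have "((\<lambda>z. 1 :: real) has_integral (r e - l e)) {l e..r e}"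
        using has_integral_const_real[of "1::real" "l e" "r e"] E(2)[OF e] by simp
      then have "((\<lambda>z. if z \<in> {l e..r e} then 1 else 0 :: real) has_integral (r e - l e)) {1..L}"
        using has_integral_restrict[of "{l e..r e}" "{1..L}" "\<lambda>z. 1 :: real" "r e - l e"] E(2)[OF e] by auto
      moreover have "indicator {l e..r e} = (\<lambda>z. if z \<in> {l e..r e} then 1 else 0 :: real)"
        by (auto simp: indicator_def fun_eq_iff)
      ultimately show "(indicator {l e..r e} has_integral (r e - l e)) {1..L}" by (simp only:)
    qed
    have "(?ind has_integral (\<Sum>e\<in>E. (W ^ 2 / 4) * (r e - l e))) {1..L}"
      by (rule has_integral_sum[OF E(1)]) (rule 1)
    moreover have "(\<Sum>e\<in>E. (W ^ 2 / 4) * (r e - l e)) = (\<Sum>e\<in>E. r e - l e) * (W ^ 2 / 4)"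
      by (simp add: sum_distrib_left mult.commute)
    ultimately show ?thesis by (auto simp: integral_unique)
  qed
  then have "(\<Sum>e\<in>E. r e - l e) * (W ^ 2 / 4) = integral {1..L} ?ind"
    and int1: "?ind integrable_on {1..L}" by auto
  note this(1)
  also have "integral {1..L} ?ind \<le> integral {1..L} g"
  proof (rule integral_le[OF int1])
    show "g integrable_on {1..L}" by (rule integrable_continuous_real[OF contg])
    fix z
    show "(\<Sum>e\<in>E. (W ^ 2 / 4) * indicator {l e..r e} z) \<le> g z"
    proof (cases "\<exists>e\<in>E. z \<in> {l e..r e}")
      case True
      then obtain e where e: "e \<in> E" "z \<in> {l e..r e}" by auto
      have "(\<Sum>e'\<in>E. (W ^ 2 / 4) * indicator {l e'..r e'} z) = (\<Sum>e'\<in>E. if e' = e then W ^ 2 / 4 else 0)"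
        using E(3)[OF e(1)] e(2) by (intro sum.cong refl) (fastforce simp: indicator_def)
      also have "\<dots> = W ^ 2 / 4" using E(1) e(1) by simp
      finally show ?thesis using big[OF miss[OF e]] by simp
    next
      case False
      then have "(\<Sum>e\<in>E. (W ^ 2 / 4) * indicator {l e..r e} z) = 0" by (intro sum.neutral) (auto simp: indicator_def)
      then show ?thesis by (auto simp: g_def intro!: sum_nonneg)
    qed
  qed
  also have "integral {1..L} g = (\<Sum>(k, j)\<in>I. integral {1..L} (\<lambda>z. norm (S (k - j) z) ^ 2))"
    unfolding g_def split_beta
    by (rule integral_sum[OF finI]) (intro integrable_continuous_real continuous_intros contS)
  also have "\<dots> \<le> (\<Sum>(k, j)\<in>I. W * N * L + W ^ 2 * B)"
    by (intro sum_mono) (auto simp: I_def intro!: intS)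
  also have "\<dots> = real (card I) * (W * N * L + W ^ 2 * B)" by (simp add: split_beta)
  also have "\<dots> \<le> real H ^ 2 * (W * N * L + W ^ 2 * B)"
  proof (rule mult_right_mono[OF cardI])
    obtain u where "u \<in> U" using U by auto
    then have "0 \<le> N" using near[of u] by (meson of_nat_0_le_iff order_trans)
    then show "0 \<le> W * N * L + W ^ 2 * B" using W L B by auto
  qed
  finally have "(\<Sum>e\<in>E. r e - l e) * (W ^ 2 / 4) \<le> real H ^ 2 * (W * N * L + W ^ 2 * B)" .
  moreover have "real H ^ 2 * (W * N * L + W ^ 2 * B) = (4 * real H ^ 2 * (L * N / W + B)) * (W ^ 2 / 4)"
    using W by (simp add: field_simps power2_eq_square)
  ultimately have "(\<Sum>e\<in>E. r e - l e) * (W ^ 2 / 4) \<le> (4 * real H ^ 2 * (L * N / W + B)) * (W ^ 2 / 4)"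
    by (simp only:)
  moreover have "0 < W ^ 2 / 4" using W by simp
  ultimately show ?thesis unfolding W_def[symmetric] by (rule mult_right_le_imp_le)
qed

section \<open>Blocks of digits hitting a target\<close>

text \<open>The first inequality is \<open>cfv w 1 >= 1\<close> with the fraction cleared. It lets
  numerators bound denominators.\<close>

lemma row_01_le:
  assumes "digits_le K w" "K \<ge> 1"
  shows "row1 w 0 1 + row2 w 0 1 \<le> (row1 w 1 0 + row2 w 1 0 :: real)" "0 \<le> row1 w (0::real) 1" "0 \<le> row2 w (0::real) 1"
proof -
  have "cfv w 1 \<ge> 1" using cfv_range[OF assms(1), of 1] assms(2) by auto
  then show "row1 w 0 1 + row2 w 0 1 \<le> (row1 w 1 0 + row2 w 1 0 :: real)"
    using row_pos[OF assms(1), of 1] by (simp add: cfv_eq[OF assms(1)] field_simps)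
  have "0 \<le> row1 w (0::real) 1 \<and> 0 \<le> row2 w (0::real) 1"
    using assms(1) row_bounds[of K _ "0::real" 1] by (cases w) (auto intro: order_trans[OF zero_le_one])
  then show "0 \<le> row1 w (0::real) 1" "0 \<le> row2 w (0::real) 1" by auto
qed

lemma cfv_DERIV:
  assumes "digits_le K w" "z > 0"
  shows "(cfv w has_real_derivative (-1) ^ length w / (row1 w 0 1 * z + row2 w 0 1)^2) (at z within A)"
proof -
  let ?a = "row1 w 1 0 :: real" and ?b = "row2 w 1 0 :: real" and ?c = "row1 w 0 1 :: real" and ?d = "row2 w 0 1 :: real"
  have p: "?c * z + ?d > 0" using row_pos assms by auto
  have "((\<lambda>z. (?a * z + ?b) / (?c * z + ?d)) has_real_derivative
     (?a * (?c * z + ?d) - (?a * z + ?b) * ?c) / ((?c * z + ?d) * (?c * z + ?d))) (at z)"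
    using p by (auto intro!: derivative_eq_intros)
  moreover have "?a * (?c * z + ?d) - (?a * z + ?b) * ?c = (-1) ^ length w"
    using row_det[of w, where ?'a = real] by (simp add: algebra_simps)
  ultimately have "((\<lambda>z. (?a * z + ?b) / (?c * z + ?d)) has_real_derivative (-1) ^ length w / (?c * z + ?d)^2) (at z)"
    by (simp add: power2_eq_square)
  then have "(cfv w has_real_derivative (-1) ^ length w / (?c * z + ?d)^2) (at z)"
    by (rule has_field_derivative_transform_within_open[of _ _ _ "{0<..}"])
       (use assms cfv_eq[OF assms(1)] in auto)
  then show ?thesis by (rule has_field_derivative_at_within)
qed

lemma card_nat_window:
  fixes c d :: real
  assumes "0 \<le> d"
  shows "finite {n :: nat. \<bar>real n - c\<bar> < d}" "real (card {n :: nat. \<bar>real n - c\<bar> < d}) \<le> 2 * d + 1"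
proof -
  let ?S = "{n :: nat. \<bar>real n - c\<bar> < d}"
  have sub: "int ` ?S \<subseteq> {\<lceil>c - d\<rceil>..\<lfloor>c + d\<rfloor>}"
    by (auto simp: abs_less_iff ceiling_le_iff le_floor_iff)
  then have "finite (int ` ?S)" by (rule finite_subset) simp
  then show "finite ?S" by (simp add: finite_image_iff)
  have "card ?S = card (int ` ?S)" by (simp add: card_image)
  also have "\<dots> \<le> card {\<lceil>c - d\<rceil>..\<lfloor>c + d\<rfloor>}" using sub by (intro card_mono) auto
  finally have "card ?S \<le> nat (\<lfloor>c + d\<rfloor> - \<lceil>c - d\<rceil> + 1)" by simp
  then have "real (card ?S) \<le> real (nat (\<lfloor>c + d\<rfloor> - \<lceil>c - d\<rceil> + 1))" by simp
  also have "\<dots> \<le> 2 * d + 1"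
    using assms by (cases "\<lfloor>c + d\<rfloor> - \<lceil>c - d\<rceil> + 1 \<ge> 0") (simp_all, linarith)
  finally show "real (card ?S) \<le> 2 * d + 1" .
qed

text \<open>A word of even length is determined by its numerator and denominator, so only few words can
  have nearly equal \<open>row1 u q q'\<close>.\<close>

lemma card_close_words:
  fixes q q' :: real
  assumes "finite S" "K \<ge> 1" "q > 0"
    and S: "\<And>u. u \<in> S \<Longrightarrow> digits_le K u \<and> even (length u) \<and> row1 u 1 0 \<le> real M" and "0 \<le> d"
  shows "real (card {u \<in> S. \<bar>row1 u q q' - c\<bar> < q * d}) \<le> (2 * real M + 1) * (2 * d + 1)"
proof -
  let ?T = "{u \<in> S. \<bar>row1 u q q' - c\<bar> < q * d}"
  define \<psi> where "\<psi> u = (row1 u 0 1 :: nat, row1 u 1 0 :: nat)" for u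
  \<comment> \<open>By linearity \<open>row1 u q q'\<close> is \<open>q * n + q' * t\<close> for the
    numerator \<open>n\<close> and the denominator \<open>t\<close> of \<open>u\<close>. For each
    \<open>t <= 2 * M\<close>, closeness to \<open>c\<close> confines \<open>n\<close> to a window
    of half-width \<open>d\<close>.\<close>
  define X where "X t = {n :: nat. \<bar>real n - (c - q' * real t) / q\<bar> < d}" for t
  have rn: "real (row1 u 1 0) = row1 u 1 0" "real (row1 u 0 1) = row1 u 0 1" for u
    using row_of_nat(1)[of u 1 0, where ?'a = real] row_of_nat(1)[of u 0 1, where ?'a = real] by simp_all
  have "inj_on \<psi> ?T"
    using S by (auto simp: inj_on_def \<psi>_def intro!: row_inj)
  then have "card ?T = card (\<psi> ` ?T)" by (simp add: card_image)
  also have "\<dots> \<le> card (Sigma {0..2 * M} X)"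
  proof (rule card_mono)
    show "finite (Sigma {0..2 * M} X)" unfolding X_def using card_nat_window(1)[OF \<open>0 \<le> d\<close>] by auto
    show "\<psi> ` ?T \<subseteq> Sigma {0..2 * M} X"
    proof
      fix p assume "p \<in> \<psi> ` ?T"
      then obtain u where u: "u \<in> S" "\<bar>row1 u q q' - c\<bar> < q * d" "p = \<psi> u" by auto
      note Su = S[OF u(1)]
      have b: "row1 u 0 1 + row2 u 0 1 \<le> (row1 u 1 0 + row2 u 1 0 :: real)" "0 \<le> row2 u (0::real) 1"
        using row_01_le Su assms(2) by auto
      have "row2 u 1 0 \<le> (row1 u 1 0 :: real)" using row_bounds[of K u "0::real" 1] Su by auto
      then have "real (row1 u 0 1) \<le> real (2 * M)" using b Su unfolding rn by simp
      then have 1: "row1 u 0 1 \<le> 2 * M" by (simp only: of_nat_le_iff)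
      have "row1 u q q' - c = q * (real (row1 u 1 0) - (c - q' * real (row1 u 0 1)) / q)"
        unfolding rn row_linear(1)[of u q q'] using \<open>q > 0\<close> by (simp add: field_simps)
      with u(2) have "q * \<bar>real (row1 u 1 0) - (c - q' * real (row1 u 0 1)) / q\<bar> < q * d"
        using \<open>q > 0\<close> by (simp add: abs_mult)
      then have "row1 u 1 0 \<in> X (row1 u 0 1)" using \<open>q > 0\<close> by (simp add: X_def)
      with 1 show "p \<in> Sigma {0..2 * M} X" by (simp add: u \<psi>_def)
    qed
  qed
  also have "card (Sigma {0..2 * M} X) = (\<Sum>t\<in>{0..2 * M}. card (X t))"
    unfolding X_def using card_nat_window(1)[OF \<open>0 \<le> d\<close>] by (intro card_SigmaI) auto
  finally have "real (card ?T) \<le> real (\<Sum>t\<in>{0..2 * M}. card (X t))"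
    by (simp only: of_nat_le_iff)
  also have "\<dots> = (\<Sum>t\<in>{0..2 * M}. real (card (X t)))" by (rule of_nat_sum)
  also have "\<dots> \<le> (\<Sum>t\<in>{0..2 * M}. 2 * d + 1)"
    unfolding X_def by (intro sum_mono card_nat_window(2)[OF \<open>0 \<le> d\<close>])
  finally show ?thesis by (simp add: algebra_simps)
qed

text \<open>Each cylinder has length at most \<open>1 / v^2\<close>, and
  \<open>2 * s >= 19/10\<close>, so each term is at most \<open>v powr - (19/10)\<close>. A sum of
  at least 1 needs accordingly many terms.\<close>

lemma card_stopping_family:
  fixes v s :: real
  assumes s: "19/20 \<le> s" "s < 1" and v: "1 \<le> v" and fin: "finite S"
    and S: "\<And>e. e \<in> S \<Longrightarrow> digits_le K e \<and> v \<le> row1 e 1 0"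
    and sum: "1 \<le> (\<Sum>e\<in>S. cyl (row1 e 1 0) (row2 e 1 0) powr s)"
  shows "v powr (19/10) \<le> real (card S)"
proof -
  have "1 \<le> (\<Sum>e\<in>S. cyl (row1 e 1 0) (row2 e 1 0) powr s)" by (rule sum)
  also have "\<dots> \<le> (\<Sum>e\<in>S. v powr - (19/10))"
  proof (rule sum_mono)
    fix e assume e: "e \<in> S"
    have r: "v \<le> row1 e 1 0" "0 \<le> row2 e (1::real) 0" using S[OF e] row_bounds[of K e "0::real" 1] by auto
    have "cyl (row1 e 1 0) (row2 e 1 0) \<le> 1 / (v * v)"
      unfolding cyl_def using r v by (intro divide_left_mono mult_mono mult_pos_pos) auto
    moreover have "0 \<le> cyl (row1 e 1 0) (row2 e 1 0)" using r v by (simp add: cyl_def)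
    ultimately have "cyl (row1 e 1 0) (row2 e 1 0) powr s \<le> (1 / (v * v)) powr s"
      using s by (intro powr_mono2) auto
    also have "1 / (v * v) = v powr - 2" using v by (simp add: powr_minus power2_eq_square inverse_eq_divide)
    also have "(v powr - 2) powr s = v powr (- 2 * s)" by (simp add: powr_powr)
    also have "\<dots> \<le> v powr - (19/10)" using s v by (intro powr_mono) auto
    finally show "cyl (row1 e 1 0) (row2 e 1 0) powr s \<le> v powr - (19/10)" .
  qed
  also have "\<dots> = real (card S) / v powr (19/10)" unfolding powr_minus_divide by simp
  finally show ?thesis using v by (simp add: field_simps)
qed

text \<open>The image of \<open>{1..K + 1}\<close> under \<open>cfv e\<close> has length at least an
  eighth of \<open>y = cyl (row1 e 1 0) (row2 e 1 0)\<close>. Write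
  \<open>y = y powr s * y powr (1 - s)\<close>: the first factors sum to at least 1, and the second
  is at least \<open>y powr (1/20)\<close>, which \<open>v\<close> bounds from below.\<close>

lemma stopping_family_length:
  fixes v s :: real
  assumes s: "19/20 \<le> s" "s < 1" and v: "1 \<le> v" and fin: "finite S" and K: "K \<ge> 1" and A: "1 \<le> A"
    and S: "\<And>e. e \<in> S \<Longrightarrow> digits_le K e \<and> even (length e) \<and> v \<le> row1 e 1 0 \<and> row1 e 1 0 \<le> A * v"
    and sum: "1 \<le> (\<Sum>e\<in>S. cyl (row1 e 1 0) (row2 e 1 0) powr s)"
  shows "(2 * A^2 * v^2) powr - (1/20) / 8 \<le> (\<Sum>e\<in>S. cfv e (real K + 1) - cfv e 1)"
proof -
  let ?\<theta> = "(2 * A^2 * v^2) powr - (1/20)"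
  have pos: "1 \<le> 2 * A^2 * v^2"
    using A v mult_mono[of 1 "A^2" 1 "v^2"] one_le_power[of A 2] one_le_power[of v 2] by simp
  have "?\<theta> / 8 \<le> ?\<theta> / 8 * (\<Sum>e\<in>S. cyl (row1 e 1 0) (row2 e 1 0) powr s)"
    using mult_left_mono[OF sum, of "?\<theta> / 8"] by simp
  also have "\<dots> \<le> (\<Sum>e\<in>S. cfv e (real K + 1) - cfv e 1)"
    unfolding sum_distrib_left
  proof (rule sum_mono)
    fix e assume e: "e \<in> S"
    let ?r = "row1 e 1 0 :: real" and ?r' = "row2 e 1 0 :: real" and ?t = "row1 e 0 1 :: real" and ?t' = "row2 e 0 1 :: real"
    have r: "v \<le> ?r" "?r \<le> A * v" "0 \<le> ?r'" "?r' \<le> ?r" "digits_le K e"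
      using S[OF e] row_bounds[of K e "0::real" 1] by auto
    have t: "?t + ?t' \<le> ?r + ?r'" "0 \<le> ?t" "0 \<le> ?t'" "?t + ?t' > 0" "?t * (real K + 1) + ?t' > 0"
      using row_01_le[OF r(5) K] row_pos(2)[OF r(5), of 1] row_pos(2)[OF r(5), of "real K + 1"] by auto
    define y where "y = cyl ?r ?r'"
    have y: "0 < y" "1 / (2 * A^2 * v^2) \<le> y" "y \<le> 1 / (?r * ?r)"
    proof -
      have "?r * (?r + ?r') \<le> (A * v) * (2 * (A * v))" using r v A by (intro mult_mono) auto
      then show "1 / (2 * A^2 * v^2) \<le> y"
        unfolding y_def cyl_def using r v A by (intro divide_left_mono) (auto simp: power2_eq_square mult_ac intro!: mult_pos_pos add_pos_nonneg)
      show "0 < y" unfolding y_def cyl_def using r v by (intro divide_pos_pos mult_pos_pos) auto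
      show "y \<le> 1 / (?r * ?r)" unfolding y_def cyl_def using r v by (intro divide_left_mono mult_mono mult_pos_pos) auto
    qed
    have y1: "y \<le> 1"
    proof -
      have "1 * 1 \<le> ?r * ?r" using r v by (intro mult_mono) auto
      then have "1 / (?r * ?r) \<le> 1" by simp
      then show ?thesis using y by linarith
    qed
    have "?\<theta> = (1 / (2 * A^2 * v^2)) powr (1/20)" using pos by (simp add: powr_minus_divide powr_divide)
    also have "\<dots> \<le> y powr (1/20)" using y pos by (intro powr_mono2) auto
    also have "\<dots> \<le> y powr (1 - s)" using y y1 s by (intro powr_mono') auto
    finally have "?\<theta> / 8 * y powr s \<le> y powr (1 - s) / 8 * y powr s" by (intro mult_right_mono) auto
    also have "\<dots> = y / 8" using y by (simp flip: powr_add)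
    also have "\<dots> \<le> 1 / (8 * (?r * ?r))" using y(3) by simp
    also have "\<dots> \<le> cfv e (real K + 1) - cfv e 1"
    proof -
      have "(?t * (real K + 1) + ?t') * (?t * 1 + ?t') \<le> (real K + 1) * (2 * ?r) * (2 * ?r)"
      proof (intro mult_mono)
        have "?t * (real K + 1) + ?t' * 1 \<le> ?t * (real K + 1) + ?t' * (real K + 1)"
          using t by (intro add_mono mult_left_mono) auto
        also have "\<dots> = (real K + 1) * (?t + ?t')" by (simp add: algebra_simps)
        also have "\<dots> \<le> (real K + 1) * (2 * ?r)" using t r by (intro mult_left_mono) auto
        finally show "?t * (real K + 1) + ?t' \<le> (real K + 1) * (2 * ?r)" by simp
      qed (use t r v in auto)
      also have "\<dots> \<le> real K * (8 * (?r * ?r))"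
      proof -
        have "(real K + 1) * (4 * (?r * ?r)) \<le> (2 * real K) * (4 * (?r * ?r))" using K by (intro mult_right_mono) auto
        then show ?thesis by (simp add: algebra_simps)
      qed
      finally have le: "(?t * (real K + 1) + ?t') * (?t * 1 + ?t') \<le> real K * (8 * (?r * ?r))" .
      have "1 / (8 * (?r * ?r)) = real K / (real K * (8 * (?r * ?r)))" using K by simp
      also have "\<dots> \<le> real K / ((?t * (real K + 1) + ?t') * (?t * 1 + ?t'))"
        using le t r v K by (intro divide_left_mono mult_pos_pos) auto
      also have "\<dots> = cfv e (real K + 1) - cfv e 1"
        using cfv_diff[OF r(5), of "real K + 1" 1] S[OF e] by simp
      finally show ?thesis .
    qed
    finally show "?\<theta> / 8 * cyl ?r ?r' powr s \<le> cfv e (real K + 1) - cfv e 1" unfolding y_def .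
  qed
  finally show ?thesis .
qed


text \<open>The words \<open>u\<close> have numerators of size about \<open>H ^ 10\<close> and the words \<open>e\<close> of size about \<open>H ^ 16\<close>. Then the
  value modulo \<open>1\<close> changes by at most \<open>\<epsilon> / 2\<close> over a cylinder of \<open>e\<close>, and the total length of these cylinders,
  at least about \<open>H powr - (8/5)\<close>, exceeds the bound \<open>O(H powr - 2)\<close> from \<open>missed_intervals_length\<close>.\<close>

lemma hitting_word_aux:
  fixes K :: nat and s q q' m \<delta> \<epsilon> :: real and H :: nat
  defines "A \<equiv> (real K + 1)^2"
  assumes s: "19/20 \<le> s" "s < 1" "2 powr (1 - s) * (1 - 2 / (real K + 1)) \<ge> 1"
    and K: "K \<ge> 1"
    and H: "H \<ge> 2" "real H \<ge> 2 * A^3" "real H ^ 4 \<ge> 9 * A^2"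
      "4 * real H ^ 2 * ((real K + 1) * (9 * A * real H ^ 15) / real H ^ 19
        + (2 / real H ^ 5 + 2 * (real K + 1) * (3 * A * (real K + 2))^6 / real H ^ 10))
       < (2 * A^2 * (real H ^ 16)^2) powr - (1/20) / 8"
    and w: "digits_le K w" "row1 w 0 1 = q" "row2 w 0 1 = q'" "0 \<le> q'" "q' \<le> q" "0 < q"
    and m: "real H ^ 50 \<le> m / q^2" "m / q^2 \<le> A * real H ^ 50"
    and \<epsilon>: "0 < \<epsilon>" "\<epsilon> \<le> 1" "2 \<le> real H * \<epsilon>^2"
  shows "\<exists>g. g \<noteq> [] \<and> digits_le K g \<and> row1 g q q' \<le> q * real H ^ 30 \<and>
    (\<forall>\<zeta>\<in>{1..real K + 1}. dist_int (m * cfv (w @ g) \<zeta> - \<delta>) \<le> \<epsilon>)"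
proof -
  define v where "v = real H ^ 10"
  define v2 where "v2 = real H ^ 16"
  define L where "L = real K + 1"
  define d where "d = real H ^ 5"
  define C where "C = 3 * A * (real K + 2)"
  have H1: "real H \<ge> 2" using H(1) by simp
  have A: "1 \<le> A" "4 \<le> A" unfolding A_def using K power_mono[of 2 "real K + 1" 2] by auto
  have v: "1 \<le> v" "2 \<le> v" "1 \<le> v2" "1 \<le> d"
    unfolding v_def v2_def d_def using H1 by (auto intro: order_trans[OF H1 self_le_power])
  have L: "1 \<le> L" using K by (simp add: L_def)
  have qm: "0 < m"
  proof -
    have "0 < m / q^2" using m(1) H1 by (smt (verit) zero_less_power)
    then show ?thesis using w(6) by (simp add: zero_less_divide_iff)
  qed
  have stop: "\<exists>S. stopping_family K s x 1 0 S" if "1 \<le> x" for x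
  proof (rule stopping_family_exists)
    have "1 < 4 * x" using that by simp
    also have "\<dots> \<le> A * x" using A that by (intro mult_right_mono) auto
    finally show "1 < (real K + 1)^2 * x" by (simp add: A_def)
  qed (use s in auto)
  have stD: "finite S" "1 \<le> (\<Sum>e\<in>S. cyl (row1 e 1 0) (row2 e 1 0) powr s)"
    "\<forall>e\<in>S. digits_le K e \<and> even (length e) \<and> x \<le> row1 e 1 0 \<and> row1 e 1 0 < A * x"
    "\<forall>e\<in>S. \<forall>e'\<in>S. e \<noteq> e' \<longrightarrow> (\<forall>z\<in>{1..L}. \<forall>z'\<in>{1..L}. cfv e z \<noteq> cfv e' z')"
    if "stopping_family K s x 1 0 S" for x S
    using that by (simp_all add: stopping_family_def cyl_def L_def A_def)
  obtain S1 S2 where st: "stopping_family K s v 1 0 S1" "stopping_family K s v2 1 0 S2" using stop v by blast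
  note S1 = stD(1)[OF st(1)] stD(3)[OF st(1), rule_format] stD(2)[OF st(1)]
  note S2 = stD(1)[OF st(2)] stD(3)[OF st(2), rule_format] stD(2)[OF st(2)] stD(4)[OF st(2), rule_format]
  define Q where "Q u = row1 u q q'" for u
  define Q' where "Q' u = row2 u q q'" for u
  have den: "row1 (w @ u) 0 1 = Q u" "row2 (w @ u) 0 1 = Q' u" for u
    by (simp_all add: row_append w Q_def Q'_def)
  have rt: "0 \<le> row1 u (0::real) 1" "row1 u 0 1 \<le> 2 * (row1 u 1 0 :: real)" "row2 u 1 0 \<le> (row1 u 1 0 :: real)" "0 \<le> row2 u (1::real) 0"
    if "digits_le K u" for u
    using row_01_le[OF that K] row_bounds[OF that, of "0::real" 1] by auto
  \<comment> \<open>Appending \<open>u\<close> multiplies the denominator \<open>q\<close> by the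
    numerator of \<open>u\<close>, up to a factor 3. This is why the stopping families start from
    the row \<open>(1, 0)\<close> and measure numerators.\<close>
  have Qle: "Q u \<le> q * (3 * row1 u 1 0)" "q * row1 u 1 0 \<le> Q u" if "digits_le K u" for u
  proof -
    have "Q u = q * row1 u 1 0 + q' * row1 u 0 1" unfolding Q_def by (rule row_linear)
    moreover have "q' * row1 u 0 1 \<le> q * (2 * row1 u 1 0)"
      using rt[OF that] w by (intro mult_mono) auto
    moreover have "0 \<le> q' * row1 u 0 1" using rt[OF that] w by auto
    moreover have "q * (3 * row1 u 1 0) = q * row1 u 1 0 + q * (2 * row1 u 1 0)" by simp
    ultimately show "Q u \<le> q * (3 * row1 u 1 0)" "q * row1 u 1 0 \<le> Q u" by linarith+
  qed
  have Q1: "digits_le K u" "q * v \<le> Q u" "Q u \<le> q * (3 * (A * v))" "0 \<le> Q' u" "Q' u \<le> Q u" "0 < Q u" if "u \<in> S1" for u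
  proof -
    note u = S1(2)[OF that]
    show 1: "digits_le K u" using u by simp
    show 2: "q * v \<le> Q u" by (rule order_trans[OF _ Qle(2)[OF 1]]) (use u w in auto)
    show "Q u \<le> q * (3 * (A * v))" by (rule order_trans[OF Qle(1)[OF 1]]) (use u w in auto)
    show "0 \<le> Q' u" "Q' u \<le> Q u" unfolding Q_def Q'_def using row_bounds[OF 1 w(4,5)] by auto
    have "0 < q * v" using w v by (intro mult_pos_pos) auto
    then show "0 < Q u" using 2 by linarith
  qed
  have AB: "q * v \<le> Q u * z + Q' u" "Q u * z + Q' u \<le> C * (q * v)" if "u \<in> S1" "z \<in> {1..L}" for u z
  proof -
    note u = Q1[OF that(1)]
    have z: "1 \<le> z" "z \<le> real K + 1" using that by (auto simp: L_def)
    have "Q u * 1 \<le> Q u * z" using u z by (intro mult_left_mono) auto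
    then show "q * v \<le> Q u * z + Q' u" using u by linarith
    have "Q u * z + Q' u \<le> Q u * (real K + 1) + Q u" using u z by (intro add_mono mult_left_mono) auto
    also have "\<dots> = (real K + 2) * Q u" by (simp add: algebra_simps)
    also have "\<dots> \<le> (real K + 2) * (q * (3 * (A * v)))" using u by (intro mult_left_mono) auto
    finally show "Q u * z + Q' u \<le> C * (q * v)" by (simp add: C_def mult_ac)
  qed
  \<comment> \<open>The exponent is 10 + 16 + 4: the sizes of \<open>u\<close> and \<open>e\<close>,
    and a power that absorbs the constant \<open>9 * A^2\<close>.\<close>
  have H30: "row1 (u @ e) q q' \<le> q * real H ^ 30" if "u \<in> S1" "e \<in> S2" for u e
  proof -
    note u = Q1[OF that(1)]
    have e: "digits_le K e" "row1 e 1 0 < A * v2" using S2(2)[OF that(2)] by auto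
    have "row1 (u @ e) q q' = Q u * row1 e 1 0 + Q' u * row1 e 0 1"
      unfolding row_append Q_def Q'_def by (rule row_linear)
    also have "\<dots> \<le> Q u * row1 e 1 0 + Q u * (2 * row1 e 1 0)"
      using rt[OF e(1)] u by (intro add_mono mult_mono) auto
    also have "\<dots> = Q u * (3 * row1 e 1 0)" by simp
    also have "\<dots> \<le> (q * (3 * (A * v))) * (3 * (A * v2))"
      using u e rt[OF e(1)] w v A by (intro mult_mono) auto
    also have "\<dots> = q * (9 * A^2 * real H ^ 26)"
      by (simp add: v_def v2_def power2_eq_square flip: power_add)
    also have "\<dots> \<le> q * (real H ^ 4 * real H ^ 26)" using H(3) w by (intro mult_left_mono mult_right_mono) auto
    also have "\<dots> = q * real H ^ 30" by (simp flip: power_add)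
    finally show ?thesis .
  qed
  show ?thesis
  proof (rule ccontr)
    assume neg: "\<not> ?thesis"
    have miss0: "\<exists>\<zeta>\<in>{1..L}. dist_int (m * cfv (w @ u) (cfv e \<zeta>) - \<delta>) > \<epsilon>" if "u \<in> S1" "e \<in> S2" for u e
    proof (rule ccontr)
      assume c: "\<not> ?thesis"
      have "u \<noteq> []" using S1(2)[OF that(1)] v by auto
      moreover have "digits_le K (u @ e)" using S1(2)[OF that(1)] S2(2)[OF that(2)] by auto
      moreover have "\<forall>\<zeta>\<in>{1..real K + 1}. dist_int (m * cfv (w @ u @ e) \<zeta> - \<delta>) \<le> \<epsilon>"
        using c by (simp add: L_def cfv_append not_less)
      ultimately show False using neg H30[OF that] by blast
    qed
    \<comment> \<open>As \<open>e\<close> has even length, \<open>cfv e\<close> increases and maps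
      \<open>{1..L}\<close> onto \<open>{l e..r e}\<close>.\<close>
    define l where "l e = cfv e 1" for e
    define r where "r e = cfv e L" for e
    have mono: "cfv e z \<le> cfv e z'" if "e \<in> S2" "1 \<le> z" "z \<le> z'" for e z z'
    proof -
      have e: "digits_le K e" "even (length e)" using S2(2)[OF that(1)] by auto
      have "row1 e 0 1 * z + row2 e 0 1 > (0::real)" "row1 e 0 1 * z' + row2 e 0 1 > (0::real)"
        using row_pos(2)[OF e(1)] that by auto
      then have "0 \<le> cfv e z' - cfv e z"
        using cfv_diff[OF e(1), of z' z] e that by auto
      then show ?thesis by simp
    qed
    have lr: "1 \<le> l e" "l e \<le> r e" "r e \<le> L" if "e \<in> S2" for e
      using cfv_range[of K e 1] cfv_range[of K e L] mono[OF that, of 1 L] S2(2)[OF that] L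
      unfolding l_def r_def L_def by auto
    have surj: "\<exists>\<zeta>\<in>{1..L}. z = cfv e \<zeta>" if "e \<in> S2" "z \<in> {l e..r e}" for e z
    proof -
      have e: "digits_le K e" using S2(2)[OF that(1)] by auto
      have "continuous_on {1..L} (cfv e)"
        by (rule DERIV_continuous_on[OF cfv_DERIV[OF e]]) auto
      then have "\<exists>\<zeta>\<ge>1. \<zeta> \<le> L \<and> cfv e \<zeta> = z"
        using that(2) L by (intro IVT') (auto simp: l_def r_def)
      then show ?thesis by auto
    qed
    have close: "\<bar>cfv e z - cfv e z'\<bar> \<le> real K * A / v2^2" if "e \<in> S2" "z \<in> {1..L}" "z' \<in> {1..L}" for e z z'
    proof -
      have e: "digits_le K e" "even (length e)" "v2 \<le> row1 e 1 0" using S2(2)[OF that(1)] by auto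
      \<comment> \<open>The value \<open>cfv e x\<close> is at most \<open>K + 1\<close>, so the
        denominator is smaller than the numerator by at most this factor, and the numerator is at
        least \<open>v2\<close>.\<close>
      have low: "v2 / (real K + 1) \<le> row1 e 0 1 * x + row2 e 0 1" if x: "x \<in> {1..L}" for x
      proof -
        have p: "row1 e 1 0 * x + row2 e 1 0 > (0::real)" "row1 e 0 1 * x + row2 e 0 1 > (0::real)"
          using row_pos[OF e(1)] x by auto
        have "cfv e x \<le> real K + 1" using cfv_range[OF e(1)] x by (auto simp: L_def)
        then have "row1 e 1 0 * x + row2 e 1 0 \<le> (real K + 1) * (row1 e 0 1 * x + row2 e 0 1 :: real)"
          using cfv_eq[OF e(1), of x] x p by (simp add: field_simps)
        moreover have "row1 e 1 0 * 1 \<le> row1 e 1 0 * (x :: real)" using x e v by (intro mult_left_mono) auto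
        ultimately have "v2 \<le> (real K + 1) * (row1 e 0 1 * x + row2 e 0 1 :: real)" using e rt[OF e(1)] by linarith
        then show ?thesis by (simp add: field_simps)
      qed
      have p0: "0 < v2 / (real K + 1)" using v by auto
      have "\<bar>cfv e z - cfv e z'\<bar> = \<bar>z - z'\<bar> / ((row1 e 0 1 * z + row2 e 0 1) * (row1 e 0 1 * z' + row2 e 0 1))"
        using low[OF that(2)] low[OF that(3)] p0 cfv_diff[OF e(1), of z z'] e that(2,3)
        by (simp add: abs_mult abs_divide)
      also have "\<dots> \<le> real K / ((v2 / (real K + 1)) * (v2 / (real K + 1)))"
        using low[OF that(2)] low[OF that(3)] that(2,3) less_imp_le[OF p0] mult_pos_pos[OF p0 p0]
        by (intro frac_le mult_mono) (auto simp: L_def)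
      also have "\<dots> = real K * A / v2^2" by (simp add: A_def power2_eq_square)
      finally show ?thesis .
    qed
    define f where "f u z = m * cfv (w @ u) z" for u z
    have dw: "digits_le K (w @ u)" if "u \<in> S1" for u using Q1(1)[OF that] w by simp
    \<comment> \<open>The even length of \<open>u\<close> leaves only the sign of \<open>w\<close>,
      so the derivatives for different \<open>u\<close> differ only through their denominators, as
      \<open>oscillatory_integral\<close> requires.\<close>
    have fd: "(f u has_real_derivative (m * (-1) ^ length w) / (Q u * z + Q' u)^2) (at z within X)" if "u \<in> S1" "z \<in> {1..L}" for u z X
    proof -
      have "(f u has_real_derivative m * ((-1) ^ length (w @ u) / (row1 (w @ u) 0 1 * z + row2 (w @ u) 0 1)^2)) (at z within X)"
        unfolding f_def by (rule DERIV_cmult[OF cfv_DERIV[OF dw[OF that(1)]]]) (use that in auto)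
      then show ?thesis using S1(2)[OF that(1)] by (simp add: den power_add)
    qed
    \<comment> \<open>So far \<open>u @ e\<close> is known to be off target at just one point of the
      cylinder of \<open>e\<close>. Across this cylinder the value moves by at most
      \<open>A^3 / H^2\<close>, because 50 - 2 * 10 - 2 * 16 = -2, and this is at most
      \<open>\<epsilon> / 2\<close>.\<close>
    have miss: "\<epsilon> / 2 \<le> dist_int (f u z - \<delta>)" if e: "e \<in> S2" and z: "z \<in> {l e..r e}" and u: "u \<in> S1" for e z u
    proof -
      obtain \<zeta> where \<zeta>: "\<zeta> \<in> {1..L}" "dist_int (m * cfv (w @ u) (cfv e \<zeta>) - \<delta>) > \<epsilon>" using miss0[OF u e] by auto
      obtain \<xi> where \<xi>: "\<xi> \<in> {1..L}" "z = cfv e \<xi>" using surj[OF e z] by auto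
      have de: "digits_le K e" using S2(2)[OF e] by auto
      have r1: "cfv e \<zeta> \<in> {1..L}" "cfv e \<xi> \<in> {1..L}" using cfv_range[OF de] \<zeta> \<xi> by (auto simp: L_def)
      have qv: "0 < q * v" using w v by auto
      note ab = AB(1)[OF u r1(1)] AB(1)[OF u r1(2)]
      let ?D = "\<bar>cfv (w @ u) (cfv e \<zeta>) - cfv (w @ u) (cfv e \<xi>)\<bar>"
      have "?D = \<bar>cfv e \<zeta> - cfv e \<xi>\<bar> / ((Q u * cfv e \<zeta> + Q' u) * (Q u * cfv e \<xi> + Q' u))"
        using ab qv cfv_diff[OF dw[OF u], of "cfv e \<zeta>" "cfv e \<xi>"] r1
        by (simp add: den abs_mult abs_divide power_abs)
      also have "\<dots> \<le> (real K * A / v2^2) / ((q * v) * (q * v))"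
        using ab qv close[OF e \<zeta>(1) \<xi>(1)] A v by (intro frac_le mult_mono) auto
      finally have "m * ?D \<le> m * ((real K * A / v2^2) / ((q * v) * (q * v)))"
        using qm by (intro mult_left_mono) auto
      also have "\<dots> = (m / q^2) * (real K * A / (v2^2 * v^2))" by (simp add: power2_eq_square)
      also have "\<dots> \<le> (A * real H ^ 50) * (A * A / (v2^2 * v^2))"
      proof (rule mult_mono[OF m(2)])
        have "real K \<le> (real K + 1) * 1" by simp
        also have "\<dots> \<le> A" unfolding A_def power2_eq_square by (intro mult_left_mono) auto
        finally show "real K * A / (v2^2 * v^2) \<le> A * A / (v2^2 * v^2)"
          using A by (intro divide_right_mono mult_right_mono) auto
      qed (use A in auto)
      also have "\<dots> = A^3 / real H ^ 2"
        using H1 by (simp add: v_def v2_def power3_eq_cube field_simps flip: power_add power_mult)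
      also have "\<dots> \<le> (real H / 2) / real H ^ 2" using H(2) by (intro divide_right_mono) auto
      also have "\<dots> = (1 / real H) / 2" using H1 by (simp add: power2_eq_square)
      also have "\<dots> \<le> \<epsilon> / 2"
      proof -
        have "real H * \<epsilon>^2 \<le> real H * \<epsilon>" using \<epsilon> H1 by (intro mult_left_mono) (auto simp: power2_eq_square mult_le_cancel_left1)
        then have "1 \<le> real H * \<epsilon>" using \<epsilon> by linarith
        then show ?thesis using H1 by (simp add: field_simps)
      qed
      finally have *: "m * ?D \<le> \<epsilon> / 2" .
      have "\<bar>(m * cfv (w @ u) (cfv e \<zeta>) - \<delta>) - (f u z - \<delta>)\<bar> = m * ?D"
        using qm unfolding f_def \<xi>(2) by (simp add: abs_mult flip: right_diff_distrib)
      then show ?thesis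
        using * \<zeta>(2) dist_int_lipschitz[of "m * cfv (w @ u) (cfv e \<zeta>) - \<delta>" "f u z - \<delta>"] by linarith
    qed
    define B where "B = 2 / real H ^ 5 + 2 * L * C^6 / real H ^ 10"
    define N where "N = 9 * A * real H ^ 15"
    have W: "real H ^ 19 \<le> real (card S1)"
    proof -
      have "v powr (19/10) \<le> real (card S1)"
        by (rule card_stopping_family[OF s(1,2) v(1) S1(1)]) (use S1 in auto)
      moreover have "v powr (19/10) = real H ^ 19"
      proof -
        have "v powr (19/10) = (real H powr 10) powr (19/10)" using H1 by (simp add: v_def)
        also have "\<dots> = real H powr (10 * (19/10))" by (rule powr_powr)
        also have "10 * (19/10) = (19::real)" by simp
        also have "real H powr 19 = real H ^ 19" using H1 by simp
        finally show ?thesis .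
      qed
      ultimately show ?thesis by simp
    qed
    have W0: "0 < real (card S1)" using W H1 by (smt (verit) zero_less_power)
    \<comment> \<open>Two words are far when their denominators differ by at least
      \<open>q * H^5\<close>. Near a given word are at most \<open>9 * A * H^15\<close> of at least
      \<open>H^19\<close> words, a proportion of order \<open>H^-4\<close>. A far pair costs
      \<open>2 / H^5\<close> for the stationary window with \<open>\<eta> = q\<close>, and order
      \<open>H^40 / H^50\<close> outside it. With the factor \<open>4 * H^2\<close> the total has
      order \<open>H^-2\<close>.\<close>
    have "(\<Sum>e\<in>S2. r e - l e) \<le> 4 * real H ^ 2 * (L * N / real (card S1) + B)"
    proof (rule missed_intervals_length[where f = f and \<delta> = \<delta> and \<epsilon> = "\<epsilon> / 2" and P = "\<lambda>u u'. q * d \<le> \<bar>Q u' - Q u\<bar>"])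
      show "S1 \<noteq> {}" using W0 by auto
      show "continuous_on {1..L} (f u)" if "u \<in> S1" for u
        by (rule DERIV_continuous_on[OF fd[OF that]])
      show "norm (integral {1..L} (\<lambda>z. cis (2 * pi * real_of_int h * (f u z - f u' z)))) \<le> B"
        if u: "u \<in> S1" "u' \<in> S1" and far: "q * d \<le> \<bar>Q u' - Q u\<bar>" and h: "h \<noteq> 0" for u u' h
      proof -
        let ?\<phi> = "\<lambda>z. 2 * pi * real_of_int h * (f u z - f u' z)"
        define \<kappa> where "\<kappa> = 2 * pi * real_of_int h * (m * (-1) ^ length w)"
        have "norm (integral {1..L} (\<lambda>z. cis (2 * pi * real_of_int h * (f u z - f u' z)))) \<le>
           2 * q / (q * d) + 8 * L * C^6 * (q * v)^4 / (q^2 * \<bar>\<kappa>\<bar>)"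
        proof (rule oscillatory_integral[OF L])
          show "0 \<le> Q u" "0 \<le> Q' u" "0 \<le> Q u'" "0 \<le> Q' u'" using Q1[OF u(1)] Q1[OF u(2)] by auto
          show "q \<le> q * v" using w v by simp
          have "1 * 1 \<le> A * (real K + 2)" using A by (intro mult_mono) auto
          then show "1 \<le> C" by (simp add: C_def)
          show "0 < q * d" using w v by (intro mult_pos_pos) auto
          show "\<kappa> \<noteq> 0" using h qm by (simp add: \<kappa>_def)
          fix z assume z: "z \<in> {1..L}"
          show "q * v \<le> Q u * z + Q' u \<and> Q u * z + Q' u \<le> C * (q * v)" using AB[OF u(1) z] by simp
          show "q * v \<le> Q u' * z + Q' u' \<and> Q u' * z + Q' u' \<le> C * (q * v)" using AB[OF u(2) z] by simp
          have "(?\<phi> has_real_derivative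
             2 * pi * real_of_int h * ((m * (-1) ^ length w) / (Q u * z + Q' u)^2 - (m * (-1) ^ length w) / (Q u' * z + Q' u')^2)) (at z within {1..L})"
            by (rule DERIV_cmult[OF DERIV_diff[OF fd[OF u(1) z] fd[OF u(2) z]]])
          then show "(?\<phi> has_real_derivative
             \<kappa> * (1 / (Q u * z + Q' u)^2 - 1 / (Q u' * z + Q' u')^2)) (at z within {1..L})"
            by (simp add: \<kappa>_def right_diff_distrib mult.assoc)
        qed (use w far in auto)
        also have "2 * q / (q * d) = 2 / real H ^ 5" using w by (simp add: d_def)
        also have "8 * L * C^6 * (q * v)^4 / (q^2 * \<bar>\<kappa>\<bar>) \<le> 2 * L * C^6 / real H ^ 10"
        proof -
          have "real H ^ 50 * q^2 \<le> m" using m(1) w(6) by (simp add: field_simps)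
          also have "1 * m \<le> \<bar>real_of_int h\<bar> * m" using h qm by (intro mult_right_mono) auto
          finally have hm: "real H ^ 50 * q^2 \<le> \<bar>real_of_int h\<bar> * m" by simp
          have "4 * (\<bar>real_of_int h\<bar> * m) \<le> (2 * pi) * (\<bar>real_of_int h\<bar> * m)"
            using pi_ge_two qm by (intro mult_right_mono) auto
          also have "\<dots> = \<bar>\<kappa>\<bar>" using qm by (simp add: \<kappa>_def abs_mult power_abs)
          finally have "4 * (real H ^ 50 * q^2) \<le> \<bar>\<kappa>\<bar>" using hm by linarith
          moreover have p: "0 < real H ^ 50 * q^2" using w H1 by (intro mult_pos_pos) auto
          moreover have "0 < q^2" using w by simp
          ultimately have "8 * L * C^6 * (q * v)^4 / (q^2 * \<bar>\<kappa>\<bar>) \<le> 8 * L * C^6 * (q * v)^4 / (q^2 * (4 * (real H ^ 50 * q^2)))"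
          proof (intro divide_left_mono mult_left_mono)
            show "0 \<le> 8 * L * C^6 * (q * v)^4" using L by (intro mult_nonneg_nonneg) auto
            have "0 < \<bar>\<kappa>\<bar>" "0 < 4 * (real H ^ 50 * q^2)" using \<open>4 * (real H ^ 50 * q^2) \<le> \<bar>\<kappa>\<bar>\<close> p by linarith+
            then show "0 < q^2 * \<bar>\<kappa>\<bar> * (q^2 * (4 * (real H ^ 50 * q^2)))"
              using w by (intro mult_pos_pos[of "_ * _"] mult_pos_pos[of "q^2"]) auto
          qed auto
          also have "\<dots> = 2 * L * C^6 / real H ^ 10"
          proof -
            have alg: "8 * L * c * (p * p * x) / (p * (4 * (x * y * p))) = 2 * L * c / y"
              if "p \<noteq> 0" "x \<noteq> 0" "y \<noteq> 0" for c p x y :: real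
              using that by (simp add: field_simps)
            have "(q * v)^4 = q^2 * q^2 * real H ^ 40"
              unfolding v_def power_mult_distrib by (simp flip: power_add power_mult)
            moreover have "real H ^ 50 = real H ^ 40 * real H ^ 10" by (simp flip: power_add)
            ultimately show ?thesis using alg[of "q^2" "real H ^ 40" "real H ^ 10" "C^6"] w H1 by (simp only:) simp
          qed
          finally show ?thesis .
        qed
        finally show ?thesis by (simp add: B_def)
      qed
      show "real (card {u' \<in> S1. \<not> q * d \<le> \<bar>Q u' - Q u\<bar>}) \<le> N" if "u \<in> S1" for u
      proof -
        define M where "M = nat \<lceil>A * v\<rceil>"
        have "0 \<le> A * v" using A v by simp
        then have "0 \<le> \<lceil>A * v\<rceil>" by simp
        then have "real M = of_int \<lceil>A * v\<rceil>" unfolding M_def by simp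
        then have M: "A * v \<le> real M" "real M \<le> A * v + 1" by linarith+
        have "real (card {u' \<in> S1. \<bar>row1 u' q q' - Q u\<bar> < q * d}) \<le> (2 * real M + 1) * (2 * d + 1)"
          by (rule card_close_words[OF S1(1) K w(6)]) (use S1(2) M v in \<open>auto intro: less_imp_le less_le_trans\<close>)
        also have "\<dots> \<le> (3 * (A * v)) * (3 * d)"
        proof (intro mult_mono)
          have "4 * 2 \<le> A * v" using A v by (intro mult_mono) auto
          then show "2 * real M + 1 \<le> 3 * (A * v)" using M by linarith
        qed (use v A in auto)
        also have "\<dots> = N" by (simp add: N_def v_def d_def flip: power_add)
        finally show ?thesis by (simp add: Q_def not_le)
      qed
      show "0 \<le> B" unfolding B_def using L by auto
      show "1 \<le> l e \<and> l e \<le> r e \<and> r e \<le> L" if "e \<in> S2" for e using lr[OF that] by simp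
      show "{l e..r e} \<inter> {l e'..r e'} = {}" if "e \<in> S2" "e' \<in> S2" "e \<noteq> e'" for e e'
        using surj[OF that(1)] surj[OF that(2)] S2(4)[OF that] by (metis disjoint_iff)
      have "2 * real H * (\<epsilon> / 2)^2 = real H * \<epsilon>^2 / 2" by (simp add: power2_eq_square)
      then show "1 \<le> 2 * real H * (\<epsilon> / 2)^2" using \<epsilon>(3) by linarith
    qed (use S1(1) S2(1) miss \<epsilon> L in auto)
    also have "\<dots> \<le> 4 * real H ^ 2 * (L * N / real H ^ 19 + B)"
    proof (intro mult_left_mono add_mono divide_left_mono W)
      show "0 \<le> L * N" using L A by (simp add: N_def)
      show "0 < real (card S1) * real H ^ 19" using W0 H1 by auto
    qed auto
    also have "\<dots> < (2 * A^2 * v2^2) powr - (1/20) / 8"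
      using H(4) unfolding L_def N_def B_def C_def v2_def .
    also have "\<dots> \<le> (\<Sum>e\<in>S2. r e - l e)"
      unfolding r_def l_def L_def by (rule stopping_family_length[OF s(1,2) v(3) S2(1) K A(1)]) (use S2(2,3) in \<open>auto intro: less_imp_le\<close>)
    finally show False by simp
  qed
qed


text \<open>The numerical conditions on \<open>H\<close> are collected in one threshold that depends
  only on \<open>K\<close> and \<open>s\<close>, so it serves all nodes and all targets of a
  tree.\<close>

lemma hitting_word:
  fixes K :: nat and s :: real
  assumes s: "19/20 \<le> s" "s < 1" "2 powr (1 - s) * (1 - 2 / (real K + 1)) \<ge> 1" and K: "K \<ge> 1"
  obtains H0 :: nat where "H0 \<ge> 2"
    "\<And>H w m \<delta> \<epsilon>. H0 \<le> H \<Longrightarrow> digits_le K w \<Longrightarrow> w \<noteq> [] \<Longrightarrow>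
      real H ^ 50 \<le> m / (row1 w 0 1)^2 \<Longrightarrow> m / (row1 w 0 1)^2 \<le> (real K + 1)^2 * real H ^ 50 \<Longrightarrow>
      0 < \<epsilon> \<Longrightarrow> \<epsilon> \<le> 1 \<Longrightarrow> 2 \<le> real H * \<epsilon>^2 \<Longrightarrow>
      \<exists>g. g \<noteq> [] \<and> digits_le K g \<and> row1 (w @ g) 0 1 \<le> row1 w 0 1 * real H ^ 30 \<and>
        (\<forall>\<zeta>\<in>{1..real K + 1}. dist_int (m * cfv (w @ g) \<zeta> - \<delta>) \<le> \<epsilon>)"
proof -
  define A where "A = (real K + 1)^2"
  define L where "L = real K + 1"
  define C where "C = 3 * A * (real K + 2)"
  define E where "E = 4 * (9 * A * L + 2 + 2 * L * C^6)"
  define D where "D = (2 * A^2) powr - (1/20) / 8"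
  have A: "A \<ge> 1" by (simp add: A_def)
  have L: "L \<ge> 1" by (simp add: L_def)
  have C: "C \<ge> 0" using A by (simp add: C_def)
  have D: "D > 0" using A by (simp add: D_def)
  \<comment> \<open>The exponent 2/5 is the gap between \<open>H powr -2\<close>, the order of the
    missed length, and \<open>H powr - (8/5)\<close>, the order of the covered length, where 8/5 =
    32/20.\<close>
  have "eventually (\<lambda>H :: nat. H \<ge> 2 \<and> real H \<ge> max (2 * A^3) (9 * A^2) \<and> real H powr (2/5) > E / D) sequentially"
  proof (intro eventually_conj)
    show "eventually (\<lambda>H :: nat. H \<ge> 2) sequentially" by (rule eventually_ge_at_top)
    show "eventually (\<lambda>H. real H \<ge> max (2 * A^3) (9 * A^2)) sequentially"
      using filterlim_real_sequentially unfolding filterlim_at_top by blast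
    have "filterlim (\<lambda>H. real H powr (2/5)) at_top sequentially" by real_asymp
    then show "eventually (\<lambda>H. real H powr (2/5) > E / D) sequentially"
      unfolding filterlim_at_top_dense by blast
  qed
  then obtain H0 :: nat where H0: "\<And>H. H \<ge> H0 \<Longrightarrow> H \<ge> 2 \<and> real H \<ge> max (2 * A^3) (9 * A^2) \<and> real H powr (2/5) > E / D"
    unfolding eventually_sequentially by blast
  show ?thesis
  proof (rule that[of H0])
    show "H0 \<ge> 2" using H0[of H0] by simp
    fix H :: nat and w m \<delta> \<epsilon>
    assume H: "H0 \<le> H" and w: "digits_le K w" "w \<noteq> []"
      and m: "real H ^ 50 \<le> m / (row1 w 0 1)^2" "m / (row1 w 0 1)^2 \<le> (real K + 1)^2 * real H ^ 50"
      and \<epsilon>: "0 < \<epsilon>" "\<epsilon> \<le> 1" "2 \<le> real H * \<epsilon>^2"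
    define x where "x = real H"
    have x: "x \<ge> 2" "x \<ge> 2 * A^3" "x \<ge> 9 * A^2" "x powr (2/5) > E / D" using H0[OF H] by (auto simp: x_def)
    obtain a w' where a: "w = a # w'" using w by (cases w) auto
    have b: "0 \<le> row2 w (0::real) 1" "row2 w (0::real) 1 \<le> row1 w 0 1" "1 \<le> row1 w (0::real) 1"
      using row_bounds[of K w' "0::real" 1] w a by auto
    have h3: "x ^ 4 \<ge> 9 * A^2"
    proof -
      have "x \<le> x ^ 4" using x(1) by (intro self_le_power) auto
      then show ?thesis using x by linarith
    qed
    have h4: "4 * x ^ 2 * (L * (9 * A * x ^ 15) / x ^ 19 + (2 / x ^ 5 + 2 * L * C^6 / x ^ 10)) < (2 * A^2 * (x ^ 16)^2) powr - (1/20) / 8"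
    proof -
      have "L * (9 * A * x ^ 15) / x ^ 19 + (2 / x ^ 5 + 2 * L * C^6 / x ^ 10) \<le> 9 * A * L / x^4 + (2 / x^4 + 2 * L * C^6 / x^4)"
      proof (intro add_mono)
        have 19: "x ^ 19 = x ^ 15 * x ^ 4" by (simp flip: power_add)
        have "L * (9 * A * t) / (t * y) = 9 * A * L / y" if "t \<noteq> 0" for t y using that by simp
        from this[of "x ^ 15" "x ^ 4"] show "L * (9 * A * x ^ 15) / x ^ 19 \<le> 9 * A * L / x^4"
          unfolding 19 using x by (intro eq_refl) auto
        show "2 / x ^ 5 \<le> 2 / x ^ 4" using x by (intro divide_left_mono power_increasing) auto
        show "2 * L * C^6 / x ^ 10 \<le> 2 * L * C^6 / x ^ 4" using x L by (intro divide_left_mono power_increasing mult_nonneg_nonneg) auto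
      qed
      then have "4 * x ^ 2 * (L * (9 * A * x ^ 15) / x ^ 19 + (2 / x ^ 5 + 2 * L * C^6 / x ^ 10)) \<le> 4 * x ^ 2 * (9 * A * L / x^4 + (2 / x^4 + 2 * L * C^6 / x^4))"
        by (intro mult_left_mono) auto
      also have "\<dots> = E * (x ^ 2 / x ^ 4)" by (simp add: E_def add_divide_distrib algebra_simps)
      also have "x ^ 2 / x ^ 4 = x powr - 2" using x by (simp add: powr_minus field_simps power2_eq_square power4_eq_xxxx)
      also have "E * x powr - 2 < D * x powr (2/5) * x powr - 2"
        using x(1,4) D by (intro mult_strict_right_mono) (auto simp: field_simps)
      also have "D * x powr (2/5) * x powr - 2 = D * x powr (- (8/5))" by (simp add: mult.assoc flip: powr_add)
      also have "\<dots> = (2 * A^2 * (x ^ 16)^2) powr - (1/20) / 8"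
      proof -
        have "(x ^ 16)^2 = x powr 32" using x by (simp flip: power_mult)
        then have "(2 * A^2 * (x ^ 16)^2) powr - (1/20) = (2 * A^2) powr - (1/20) * (x powr 32) powr - (1/20)"
          using A x by (simp only: powr_mult)
        also have "(x powr 32) powr - (1/20) = x powr (32 * - (1/20))" by (rule powr_powr)
        finally show ?thesis by (simp add: D_def)
      qed
      finally show ?thesis .
    qed
    have "\<exists>g. g \<noteq> [] \<and> digits_le K g \<and> row1 g (row1 w 0 1) (row2 w 0 1) \<le> row1 w 0 1 * real H ^ 30 \<and>
      (\<forall>\<zeta>\<in>{1..real K + 1}. dist_int (m * cfv (w @ g) \<zeta> - \<delta>) \<le> \<epsilon>)"
    proof (rule hitting_word_aux[OF s K])
      show "2 \<le> H" "real H \<ge> 2 * ((real K + 1)^2)^3" "real H ^ 4 \<ge> 9 * ((real K + 1)^2)^2"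
        using x h3 H0[OF H] unfolding x_def A_def by auto
      show "4 * real H ^ 2 * ((real K + 1) * (9 * (real K + 1)^2 * real H ^ 15) / real H ^ 19
        + (2 / real H ^ 5 + 2 * (real K + 1) * (3 * (real K + 1)^2 * (real K + 2))^6 / real H ^ 10))
       < (2 * ((real K + 1)^2)^2 * (real H ^ 16)^2) powr - (1/20) / 8"
        using h4 unfolding x_def A_def L_def C_def .
    qed (use w b m \<epsilon> in auto)
    then show "\<exists>g. g \<noteq> [] \<and> digits_le K g \<and> row1 (w @ g) 0 1 \<le> row1 w 0 1 * real H ^ 30 \<and>
        (\<forall>\<zeta>\<in>{1..real K + 1}. dist_int (m * cfv (w @ g) \<zeta> - \<delta>) \<le> \<epsilon>)"
      by (simp add: row_append)
  qed
qed

section \<open>Hausdorff dimension of trees\<close>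

lemma diam_power_pos: "t > 0 \<Longrightarrow> diam_power t U = ennreal (diameter U powr t)"
  by (simp add: diam_power_def)

lemma hausdorff_outer_measure_0D:
  assumes "hausdorff_outer_measure s A = 0" "\<rho> > 0" "\<eta> > 0"
  obtains U :: "nat \<Rightarrow> 'a::metric_space set" where "A \<subseteq> (\<Union>i. U i)"
    "\<And>i. bounded (U i)" "\<And>i. diameter (U i) \<le> \<rho>" "(\<Sum>i. diam_power s (U i)) < \<eta>"
proof -
  have "hausdorff_premeasure s \<rho> A \<le> hausdorff_outer_measure s A"
    unfolding hausdorff_outer_measure_def using assms(2) by (intro SUP_upper) auto
  then have "hausdorff_premeasure s \<rho> A < \<eta>" using assms by simp
  then show ?thesis
    unfolding hausdorff_premeasure_def INF_less_iff using that by auto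
qed

text \<open>Mass distribution without measures: a cover of small total cost cannot meet all branches of
  the tree, since one can descend while keeping the cost of the sets met below \<open>V\<close>.\<close>

lemma hausdorff_outer_measure_tree_nonzero:
  fixes Ch :: "'a list \<Rightarrow> 'a list set" and V sz :: "'a list \<Rightarrow> real" and G :: "'b::metric_space set"
    and I :: "'a list \<Rightarrow> 'b set"
  assumes fin: "\<And>u. P u \<Longrightarrow> finite (Ch u)"
    and r0: "P r0" and step: "\<And>u v. P u \<Longrightarrow> v \<in> Ch u \<Longrightarrow> P v"
    and pre: "\<And>u v. P u \<Longrightarrow> v \<in> Ch u \<Longrightarrow> prefix u v"
    and inc: "\<And>u v v'. P u \<Longrightarrow> v \<in> Ch u \<Longrightarrow> v' \<in> Ch u \<Longrightarrow> v \<noteq> v' \<Longrightarrow> \<not> prefix v v'"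
    and V: "\<And>u. P u \<Longrightarrow> V u \<le> (\<Sum>v\<in>Ch u. V v)" "V r0 > 0"
    and bd: "\<And>u. P u \<Longrightarrow> V u \<le> C * sz u powr t" "\<And>u. P u \<Longrightarrow> sz u > 0" "t > 0" "C > 0"
    and sep: "\<And>u v v' \<beta> \<beta>'. P u \<Longrightarrow> v \<in> Ch u \<Longrightarrow> v' \<in> Ch u \<Longrightarrow> v \<noteq> v' \<Longrightarrow> \<beta> \<in> I v \<Longrightarrow> \<beta>' \<in> I v' \<Longrightarrow> c * sz u \<le> dist \<beta> \<beta>'" "c > 0"
    and path: "\<And>x. x 0 = r0 \<Longrightarrow> (\<And>n. P (x n)) \<Longrightarrow> (\<And>n. x (Suc n) \<in> Ch (x n)) \<Longrightarrow> (\<exists>\<beta>\<in>G. \<forall>n. \<beta> \<in> I (x n)) \<and> (\<lambda>n. sz (x n)) \<longlonglongrightarrow> 0"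
  shows "hausdorff_outer_measure t G \<noteq> 0"
proof
  assume z: "hausdorff_outer_measure t G = 0"
  define V0 where "V0 = V r0"
  have V0: "V0 > 0" using V by (simp add: V0_def)
  define K where "K = C / c powr t"
  have K: "K > 0" using bd sep by (simp add: K_def)
  obtain U :: "nat \<Rightarrow> 'b set" where U: "G \<subseteq> (\<Union>i. U i)" "\<And>i. bounded (U i)"
    "(\<Sum>i. diam_power t (U i)) < ennreal (V0 / (2 * K))"
    by (rule hausdorff_outer_measure_0D[OF z zero_less_one, of "ennreal (V0 / (2 * K))"]) (use V0 K in auto)
  define d where "d i = diameter (U i) powr t" for i
  have d0: "0 \<le> d i" for i by (simp add: d_def)
  have sd: "(\<Sum>i. ennreal (d i)) < ennreal (V0 / (2 * K))"
    using U(3) by (simp add: diam_power_pos[OF bd(3)] d_def)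
  have sumd: "summable d"
  proof (rule summable_suminf_not_top)
    show "(\<Sum>i. ennreal (d i)) \<noteq> top" using sd by (metis ennreal_less_top not_less_iff_gr_or_eq order.strict_trans)
  qed (rule d0)
  have "(\<Sum>i. ennreal (d i)) = ennreal (suminf d)"
    by (rule suminf_ennreal_eq[OF d0 summable_sums[OF sumd]])
  then have "ennreal (suminf d) < ennreal (V0 / (2 * K))"
    using sd by (simp only:)
  then have sd: "suminf d < V0 / (2 * K)"
    using suminf_nonneg[OF sumd d0] by (simp add: ennreal_less_iff)
  \<comment> \<open>The summand \<open>V0 / 4 * (1/2) ^ i\<close> pays for a set met by a single
    path, whose diameter may be 0. These summands add up to \<open>V0 / 2\<close>, and the terms
    \<open>K * d i\<close> to less than \<open>V0 / 2\<close>.\<close>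
  define cost where "cost i = K * d i + V0 / 4 * (1/2) ^ i" for i
  have cost0: "0 \<le> cost i" for i using K d0 V0 by (simp add: cost_def)
  have "(\<lambda>i. V0 / 4 * (1/2) ^ i) sums (V0 / 4 * 2)"
    using sums_mult[OF geometric_sums[of "1/2::real"], of "V0 / 4"] by simp
  then have sums: "cost sums (K * suminf d + V0 / 4 * 2)"
    unfolding cost_def by (rule sums_add[OF sums_mult[OF summable_sums[OF sumd]]])
  then have sc: "summable cost" by (rule sums_summable)
  have "suminf cost = K * suminf d + V0 / 4 * 2" using sums by (rule sums_unique[symmetric])
  also have "K * suminf d + V0 / 4 * 2 < V0" using sd K by (simp add: field_simps)
  finally have cost_lt: "suminf cost < V0" .
  define Pth where "Pth x \<longleftrightarrow> x 0 = r0 \<and> (\<forall>n. P (x n)) \<and> (\<forall>n. x (Suc n) \<in> Ch (x n))" for x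
  have "\<exists>\<beta>. \<beta> \<in> G \<and> (\<forall>n. \<beta> \<in> I (x n))" if "Pth x" for x using path[of x] that by (auto simp: Pth_def)
  then obtain pt where pt: "\<And>x. Pth x \<Longrightarrow> pt x \<in> G" "\<And>x n. Pth x \<Longrightarrow> pt x \<in> I (x n)" by metis
  define D where "D i = {x. Pth x \<and> pt x \<in> U i}" for i
  \<comment> \<open>The node \<open>w\<close> is common to all paths in \<open>D i\<close>. If the
    paths split, it is the last node before the first split, and \<open>sep\<close> bounds its size
    by the diameter of \<open>U i\<close>. If there is only one path, a sufficiently deep node will
    do.\<close>
  have "\<exists>n w. (\<forall>x\<in>D i. x n = w) \<and> V w \<le> cost i" if ne: "D i \<noteq> {}" for i
  proof (cases "\<exists>n. \<exists>x\<in>D i. \<exists>x'\<in>D i. x n \<noteq> x' n")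
    case True
    define n where "n = (LEAST n. \<exists>x\<in>D i. \<exists>x'\<in>D i. x n \<noteq> x' n)"
    obtain x x' where x: "x \<in> D i" "x' \<in> D i" "x n \<noteq> x' n" using LeastI_ex[OF True] unfolding n_def by auto
    have "n \<noteq> 0"
    proof
      assume "n = 0" then show False using x by (simp add: D_def Pth_def)
    qed
    then obtain k where k: "n = Suc k" using not0_implies_Suc by auto
    have agree: "y k = x k" if "y \<in> D i" for y
    proof -
      have "k < n" using k by simp
      from not_less_Least[OF this[unfolded n_def]] show ?thesis using that x(1) by blast
    qed
    have Pk: "P (x k)" "x n \<in> Ch (x k)" "x' n \<in> Ch (x k)"
      using x(1,2) agree[OF x(2)] k by (auto simp: D_def Pth_def) metis
    have "c * sz (x k) \<le> dist (pt x) (pt x')"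
      by (rule sep(1)[OF Pk x(3)]) (use pt x D_def in auto)
    also have "\<dots> \<le> diameter (U i)"
      by (rule diameter_bounded_bound[OF U(2)]) (use x in \<open>auto simp: D_def\<close>)
    finally have "sz (x k) \<le> diameter (U i) / c" using sep(2) by (simp add: field_simps)
    then have "sz (x k) powr t \<le> (diameter (U i) / c) powr t"
      using bd(2)[OF Pk(1)] bd(3) by (intro powr_mono2) auto
    also have "\<dots> = d i / c powr t"
      using sep(2) diameter_ge_0[OF U(2)] by (simp add: powr_divide d_def)
    finally have "C * sz (x k) powr t \<le> C * (d i / c powr t)" using bd(4) by (intro mult_left_mono) auto
    then have "C * sz (x k) powr t \<le> K * d i" by (simp add: K_def)
    then have "V (x k) \<le> K * d i" using bd(1)[OF Pk(1)] by linarith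
    also have "\<dots> \<le> cost i" using V0 by (simp add: cost_def)
    finally show ?thesis using agree by blast
  next
    case False
    obtain x where x: "x \<in> D i" using ne by auto
    then have Px: "Pth x" by (simp add: D_def)
    have "(\<lambda>n. C * sz (x n) powr t) \<longlonglongrightarrow> C * 0 powr t"
    proof (intro tendsto_mult tendsto_const tendsto_powr2)
      show "(\<lambda>n. sz (x n)) \<longlonglongrightarrow> 0" using path[of x] Px by (auto simp: Pth_def)
    qed (use bd Px in \<open>auto simp: Pth_def intro!: always_eventually less_imp_le\<close>)
    then have "(\<lambda>n. C * sz (x n) powr t) \<longlonglongrightarrow> 0" by simp
    moreover have "0 < V0 / 4 * (1/2) ^ i" using V0 by simp
    ultimately have "eventually (\<lambda>n. C * sz (x n) powr t < V0 / 4 * (1/2) ^ i) sequentially"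
      by (rule order_tendstoD(2))
    then obtain n where n: "C * sz (x n) powr t < V0 / 4 * (1/2) ^ i" by (auto simp: eventually_sequentially)
    have "V (x n) \<le> C * sz (x n) powr t" using bd(1) Px by (auto simp: Pth_def)
    also have "\<dots> \<le> cost i"
    proof -
      have "0 \<le> K * d i" using K d0 by simp
      then show ?thesis unfolding cost_def using n by linarith
    qed
    finally show ?thesis using False x by metis
  qed
  then obtain nn w where w: "\<And>i x. x \<in> D i \<Longrightarrow> x (nn i) = w i" "\<And>i. D i \<noteq> {} \<Longrightarrow> V (w i) \<le> cost i"
    by (metis (no_types, lifting) empty_iff)
  \<comment> \<open>The cost of \<open>U i\<close> is charged to \<open>w i\<close> and to all its
    prefixes. Children are incomparable, so at most one of them inherits the charge: the charges
    \<open>S\<close> of the children add up to at most that of the parent, whereas their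
    \<open>V\<close> add up to at least that of the parent.\<close>
  define h where "h u i = (if D i \<noteq> {} \<and> prefix u (w i) then cost i else 0)" for u i
  have h0: "0 \<le> h u i" "h u i \<le> cost i" for u i using cost0 by (auto simp: h_def)
  have sh: "summable (h u)" for u
    by (rule summable_comparison_test'[OF sc, of 0]) (use h0 in auto)
  define S where "S u = suminf (h u)" for u
  have S_step: "(\<Sum>v\<in>Ch u. S v) \<le> S u" if u: "P u" for u
  proof -
    have "(\<Sum>v\<in>Ch u. S v) = (\<Sum>i. \<Sum>v\<in>Ch u. h v i)"
      unfolding S_def by (rule suminf_sum[symmetric]) (rule sh)
    also have "\<dots> \<le> S u" unfolding S_def
    proof (rule suminf_le)
      fix i
      show "(\<Sum>v\<in>Ch u. h v i) \<le> h u i"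
      proof (cases "\<exists>v\<in>Ch u. D i \<noteq> {} \<and> prefix v (w i)")
        case True
        then obtain v where v: "v \<in> Ch u" "D i \<noteq> {}" "prefix v (w i)" by auto
        have "h v' i = 0" if "v' \<in> Ch u - {v}" for v'
        proof -
          have "\<not> prefix v' (w i)"
            using prefix_same_cases[OF v(3), of v'] inc[OF u v(1), of v'] inc[OF u _ v(1), of v'] that by auto
          then show ?thesis by (simp add: h_def)
        qed
        then have "(\<Sum>v\<in>Ch u. h v i) = h v i"
          using fin[OF u] v(1) by (simp add: sum.remove)
        also have "\<dots> \<le> h u i" using v pre[OF u v(1)] cost0 by (auto simp: h_def dest: prefix_order.trans)
        finally show ?thesis .
      next
        case False
        then have "(\<Sum>v\<in>Ch u. h v i) = 0" by (intro sum.neutral) (auto simp: h_def)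
        then show ?thesis using h0 by simp
      qed
    qed (auto intro!: summable_sum sh)
    finally show ?thesis .
  qed
  have "\<exists>x. \<forall>n. (P (x n) \<and> S (x n) < V (x n) \<and> (n = 0 \<longrightarrow> x n = r0)) \<and> x (Suc n) \<in> Ch (x n)"
  proof (rule dependent_nat_choice)
    have "S r0 \<le> suminf cost" unfolding S_def by (intro suminf_le sh sc h0)
    then show "\<exists>x. P x \<and> S x < V x \<and> (0 = (0::nat) \<longrightarrow> x = r0)"
      using cost_lt r0 unfolding V0_def by (intro exI[of _ r0]) auto
    fix u n assume u: "P u \<and> S u < V u \<and> (n = (0::nat) \<longrightarrow> u = r0)"
    have "\<exists>v\<in>Ch u. S v < V v"
    proof (rule ccontr)
      assume "\<not> ?thesis"
      then have "(\<Sum>v\<in>Ch u. V v) \<le> (\<Sum>v\<in>Ch u. S v)" by (intro sum_mono) (auto simp: not_less)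
      then show False using S_step V(1) u by fastforce
    qed
    then show "\<exists>v. (P v \<and> S v < V v \<and> (Suc n = 0 \<longrightarrow> v = r0)) \<and> v \<in> Ch u" using step u by blast
  qed
  then obtain x where x: "\<And>n. P (x n)" "\<And>n. S (x n) < V (x n)" "x 0 = r0" "\<And>n. x (Suc n) \<in> Ch (x n)" by blast
  then have Px: "Pth x" by (simp add: Pth_def)
  then obtain i where i: "pt x \<in> U i" using pt(1) U(1) by blast
  then have xD: "x \<in> D i" using Px by (simp add: D_def)
  \<comment> \<open>The path built here has \<open>S < V\<close> at every node, yet it passes
    through \<open>w i\<close>, where \<open>S\<close> already contains
    \<open>cost i\<close>.\<close>
  have "V (w i) \<le> cost i" using w(2) xD by blast
  also have "\<dots> = h (w i) i" using xD by (auto simp: h_def)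
  also have "\<dots> \<le> S (w i)" unfolding S_def
    using sum_le_suminf[OF sh, of "{i}" "w i"] h0 by simp
  finally show False using x(2)[of "nn i"] w(1)[OF xD] by simp
qed

lemma hausdorff_dim_ge_1:
  fixes G :: "'a::metric_space set"
  assumes "\<And>t. 0 < t \<Longrightarrow> t < 1 \<Longrightarrow> hausdorff_outer_measure t G \<noteq> 0"
  shows "1 \<le> hausdorff_dim G"
  unfolding hausdorff_dim_def
proof (rule Inf_greatest)
  fix x assume "x \<in> ennreal ` {s. 0 \<le> s \<and> hausdorff_outer_measure s G = 0}"
  then obtain s where s: "x = ennreal s" "0 \<le> s" "hausdorff_outer_measure s G = 0" by auto
  have "s \<ge> 1"
  proof (rule ccontr)
    assume "\<not> s \<ge> 1"
    \<comment> \<open>Exponent 0 needs its own argument: a nonempty set costs 1 there, so a cover of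
      cost below 1 consists of empty sets, and an empty \<open>G\<close> contradicts the hypothesis
      at \<open>1/2\<close>.\<close>
    with s assms[of s] have "s = 0" by (cases "s = 0") auto
    obtain U :: "nat \<Rightarrow> 'a set" where U: "G \<subseteq> (\<Union>i. U i)" "(\<Sum>i. diam_power s (U i)) < 1"
      by (rule hausdorff_outer_measure_0D[OF s(3) zero_less_one zero_less_one]) auto
    have "U i = {}" for i
    proof (rule ccontr)
      assume "U i \<noteq> {}"
      then have "1 = diam_power s (U i)" using \<open>s = 0\<close> by (simp add: diam_power_def)
      also have "\<dots> \<le> (\<Sum>i. diam_power s (U i))"
        using sum_le_suminf[of "\<lambda>i. diam_power s (U i)" "{i}"] by simp
      finally show False using U(2) by simp
    qed
    then have "G = {}" using U(1) by auto
    have "hausdorff_premeasure (1/2) \<rho> G = 0" if "\<rho> > 0" for \<rho>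
    proof -
      have "hausdorff_premeasure (1/2) \<rho> G \<le> (\<Sum>i::nat. diam_power (1/2) ({} :: 'a set))"
        unfolding hausdorff_premeasure_def using that \<open>G = {}\<close> by (intro INF_lower) auto
      then show ?thesis by (simp add: diam_power_def)
    qed
    then have "hausdorff_outer_measure (1/2) G = 0"
      unfolding hausdorff_outer_measure_def by simp
    then show False using assms[of "1/2"] by simp
  qed
  then show "1 \<le> x" using s by (simp add: one_ennreal_def[symmetric] ennreal_leI flip: ennreal_1)
qed

text \<open>Covering by \<open>N\<close> intervals of length \<open>2 / N\<close> costs
  \<open>N * (2 / N) powr s\<close>, which tends to 0 for \<open>s > 1\<close>.\<close>

lemma hausdorff_dim_le_1:
  assumes "G \<subseteq> {1..3::real}"
  shows "hausdorff_dim G \<le> 1"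
proof -
  have z: "hausdorff_outer_measure s G = 0" if s: "1 < s" for s
  proof -
    have "hausdorff_premeasure s \<rho> G \<le> ennreal \<eta>" if \<rho>: "\<rho> > 0" and \<eta>: "\<eta> > 0" for \<rho> \<eta>
    proof -
      have "((\<lambda>N. 2 powr s * real N powr (1 - s)) \<longlongrightarrow> 2 powr s * 0) sequentially"
        by (intro tendsto_mult tendsto_const tendsto_neg_powr filterlim_real_sequentially) (use s in auto)
      then have "eventually (\<lambda>N. 2 powr s * real N powr (1 - s) < \<eta>) sequentially"
        using \<eta> by (intro order_tendstoD) auto
      moreover have "eventually (\<lambda>N. real N \<ge> max 1 (2 / \<rho>)) sequentially"
        using filterlim_real_sequentially unfolding filterlim_at_top by blast
      ultimately have "eventually (\<lambda>N. 2 powr s * real N powr (1 - s) < \<eta> \<and> real N \<ge> max 1 (2 / \<rho>)) sequentially"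
        by eventually_elim auto
      then obtain N where N: "2 powr s * real N powr (1 - s) < \<eta>" "real N \<ge> 1" "real N \<ge> 2 / \<rho>"
        by (auto simp: eventually_sequentially)
      define U where "U i = (if i < N then {1 + 2 * real i / real N .. 1 + 2 * (real i + 1) / real N} else {})" for i
      have diam: "diameter (U i) = (if i < N then 2 / real N else 0)" for i
        using N by (auto simp: U_def diameter_closed_interval field_simps)
      have "hausdorff_premeasure s \<rho> G \<le> (\<Sum>i. diam_power s (U i))"
        unfolding hausdorff_premeasure_def
      proof (rule INF_lower, safe)
        fix \<beta> assume "\<beta> \<in> G"
        then have b: "1 \<le> \<beta>" "\<beta> \<le> 3" using assms by auto
        show "\<beta> \<in> (\<Union>i. U i)"
        proof (cases "\<beta> = 3")
          case True
          have "\<beta> \<in> U (N - 1)" using N True by (auto simp: U_def field_simps)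
          then show ?thesis by auto
        next
          case False
          define i where "i = nat \<lfloor>(\<beta> - 1) * real N / 2\<rfloor>"
          have nn: "0 \<le> (\<beta> - 1) * real N / 2" using b by simp
          have i: "real i \<le> (\<beta> - 1) * real N / 2" "(\<beta> - 1) * real N / 2 < real i + 1"
            unfolding i_def using nn by linarith+
          have "(\<beta> - 1) * real N / 2 < 2 * real N / 2" using b False N by (intro divide_strict_right_mono mult_strict_right_mono) auto
          then have "i < N" using i by linarith
          then have "\<beta> \<in> U i" using i N by (auto simp: U_def field_simps)
          then show ?thesis by auto
        qed
      next
        fix i show "bounded (U i)" by (auto simp: U_def)
        show "diameter (U i) \<le> \<rho>" using N \<rho> unfolding diam by (auto simp: field_simps)
      qed
      also have "\<dots> = (\<Sum>i. if i < N then ennreal ((2 / real N) powr s) else 0)"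
        using s by (intro suminf_cong) (auto simp: diam_power_pos diam)
      also have "\<dots> = (\<Sum>i<N. ennreal ((2 / real N) powr s))"
        by (subst suminf_finite[of "{..<N}"]) auto
      also have "\<dots> = ennreal (real N * (2 / real N) powr s)"
        by (simp add: ennreal_mult ennreal_of_nat_eq_real_of_nat)
      also have "real N * (2 / real N) powr s = 2 powr s * real N powr (1 - s)"
        using N by (simp add: powr_divide powr_diff)
      also have "ennreal \<dots> \<le> ennreal \<eta>" using N by (intro ennreal_leI) auto
      finally show ?thesis .
    qed
    then have "hausdorff_premeasure s \<rho> G = 0" if "\<rho> > 0" for \<rho>
      using that ennreal_le_epsilon[of 0 "hausdorff_premeasure s \<rho> G"] by (metis add_0 le_zero_eq)
    then show ?thesis unfolding hausdorff_outer_measure_def by simp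
  qed
  show ?thesis
  proof (rule dense_ge)
    fix x :: ennreal assume "1 < x"
    then obtain y where y: "1 < y" "y < x" using dense by blast
    obtain s where s: "y = ennreal s" "0 \<le> s" using y by (cases y) auto
    have "1 < s" using y s by (metis ennreal_1 ennreal_less_iff zero_le_one)
    then have "hausdorff_dim G \<le> ennreal s" unfolding hausdorff_dim_def
      using z s by (intro Inf_lower) auto
    then show "hausdorff_dim G \<le> x" using y s by simp
  qed
qed

section \<open>Badly approximable numbers with prescribed hits\<close>

text \<open>The range \<open>{1..K + 1}\<close> contains every tail with digits at most
  \<open>K\<close>, and \<open>cfv\<close> of such words maps it into itself. Its compactness yields
  a point on every infinite path.\<close>

definition cf_interval :: "nat \<Rightarrow> nat list \<Rightarrow> real set" where
  "cf_interval K w = cfv w ` {1..real K + 1}"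

lemma cf_interval_append_subset:
  assumes "digits_le K e"
  shows "cf_interval K (w @ e) \<subseteq> cf_interval K w"
  using cfv_range[OF assms] by (auto simp: cf_interval_def cfv_append)

text \<open>The row \<open>(0, 1)\<close> violates the order \<open>y <= x\<close> that
  \<open>row_bounds\<close> requires; the first digit turns it into \<open>(1, 0)\<close>, and the
  bounds apply to the remaining digits.\<close>

lemma row_01_props:
  assumes "digits_le K w" "w \<noteq> []"
  shows "0 \<le> row2 w (0::real) 1" "row2 w (0::real) 1 \<le> row1 w 0 1" "1 \<le> row1 w (0::real) 1"
    "real (length w) - 1 \<le> row1 w 0 1"
proof -
  obtain a w' where a: "w = a # w'" using assms by (cases w) auto
  show "0 \<le> row2 w (0::real) 1" "row2 w (0::real) 1 \<le> row1 w 0 1" "1 \<le> row1 w (0::real) 1"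
    using row_bounds[of K w' "0::real" 1] assms a by auto
  show "real (length w) - 1 \<le> row1 w 0 1"
    using row_sum_grows[of K w' 1 0] assms a by auto
qed

lemma row_snoc_le:
  assumes "digits_le K (w @ [k])" "w \<noteq> []"
  shows "row1 (w @ [k]) 0 1 \<le> (real K + 1) * row1 w 0 1" "row2 (w @ [k]) 0 1 = (row1 w 0 1 :: real)"
proof -
  note b = row_01_props[of K w] 
  have "real k * row1 w 0 1 + row2 w 0 1 \<le> real K * row1 w 0 1 + 1 * row1 w 0 1"
    using b assms by (intro add_mono mult_right_mono) auto
  then show "row1 (w @ [k]) 0 1 \<le> (real K + 1) * row1 w 0 1"
    by (simp add: row_append algebra_simps)
qed (simp add: row_append)

text \<open>Express the integer vector \<open>(a, n)\<close> in the unimodular basis formed by the columns of the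
  continued fraction matrix of \<open>w\<close>.\<close>

lemma cfv_approx_lower:
  assumes w: "digits_le K w" "w \<noteq> []" and z: "1 \<le> z" and n: "0 < n" "real n < row1 w 0 1"
  shows "1 / (row1 w 0 1 * z + row2 w 0 1) \<le> \<bar>real n * cfv w z - of_int a\<bar>"
proof -
  define P where "P = int (row1 w 1 0)"
  define P' where "P' = int (row2 w 1 0)"
  define Q where "Q = int (row1 w 0 1)"
  define Q' where "Q' = int (row2 w 0 1)"
  have r: "row1 w 1 0 = real_of_int P" "row2 w 1 0 = real_of_int P'" "row1 w 0 1 = real_of_int Q" "row2 w 0 1 = real_of_int Q'"
    using row_of_nat(1)[of w 1 0, where ?'a = real] row_of_nat(1)[of w 0 1, where ?'a = real]
      row_of_nat(2)[of w 1 0] row_of_nat(2)[of w 0 1]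
    by (simp_all add: P_def P'_def Q_def Q'_def)
  define e where "e = P * Q' - P' * Q"
  have "real_of_int e = (-1) ^ length w"
    unfolding e_def using row_det[of w, where ?'a = real] by (simp add: r)
  then have e2: "e * e = 1" "\<bar>real_of_int e\<bar> = 1"
  proof -
    assume h: "real_of_int e = (-1) ^ length w"
    have "real_of_int (e * e) = 1" unfolding of_int_mult h by (simp flip: power_add)
    then show "e * e = 1" by linarith
    show "\<bar>real_of_int e\<bar> = 1" unfolding h by simp
  qed
  define x where "x = e * (a * Q' - int n * P')"
  define y where "y = e * (int n * P - a * Q)"
  have neq: "int n = x * Q + y * Q'"
  proof -
    have "x * Q + y * Q' = int n * (e * e)" by (simp add: x_def y_def e_def algebra_simps)
    then show ?thesis using e2 by simp
  qed
  have nn: "0 \<le> Q'" "int n < Q" using n(2) by (auto simp: Q'_def r)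
  have pos: "0 < real_of_int Q * z + real_of_int Q'"
    using row_pos(2)[OF w(1), of z] z by (simp add: r)
  have "(real n * cfv w z - of_int a) * (real_of_int Q * z + real_of_int Q') = of_int (int n * P - a * Q) * z + of_int (int n * P' - a * Q')"
    using pos unfolding cfv_eq[OF w(1) less_le_trans[OF zero_less_one z]] r by (simp add: field_simps)
  also have "int n * P - a * Q = e * y" using e2 by (simp add: y_def flip: mult.assoc)
  also have "int n * P' - a * Q' = - (e * x)" using e2 by (simp add: x_def flip: mult.assoc)
  also have "of_int (e * y) * z + of_int (- (e * x)) = of_int e * (of_int y * z - of_int x)" by (simp add: algebra_simps)
  finally have eq: "\<bar>real n * cfv w z - of_int a\<bar> * (real_of_int Q * z + real_of_int Q') = \<bar>of_int y * z - of_int x\<bar>"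
    using pos e2 by (metis abs_mult abs_of_pos mult_1)
  \<comment> \<open>Since \<open>0 < n < Q\<close>, the case \<open>x >= 1\<close> forces
    \<open>y <= -1\<close>, and \<open>x <= 0\<close> forces \<open>y >= 1\<close>. So
    \<open>y * z\<close> and \<open>- x\<close> do not cancel.\<close>
  have "1 \<le> \<bar>of_int y * z - real_of_int x\<bar>"
  proof (cases "x \<ge> 1")
    case True
    have "1 * Q \<le> x * Q" using True nn by (intro mult_right_mono) auto
    then have "y * Q' < 0" using neq nn by linarith
    then have "y \<le> -1" using nn mult_nonneg_nonneg[of y Q'] by linarith
    then have "of_int y * z \<le> -1 * z" using z by (intro mult_right_mono) auto
    then show ?thesis using True z by linarith
  next
    case False
    then have "x * Q \<le> 0" using nn n by (intro mult_nonpos_nonneg) auto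
    then have "0 < y * Q'" using neq n by linarith
    then have "y \<ge> 1" using nn mult_nonpos_nonneg[of y Q'] by linarith
    then have "1 * z \<le> of_int y * z" using z by (intro mult_right_mono) auto
    then show ?thesis using False z by linarith
  qed
  then show ?thesis using eq pos by (simp add: r field_simps)
qed

text \<open>For given \<open>n\<close>, take the first convergent whose denominator exceeds
  \<open>n\<close>. Digits at most \<open>K\<close> keep this denominator within
  \<open>(K + 1) * n\<close>, so the bound of \<open>cfv_approx_lower\<close> has order
  \<open>1 / n\<close>.\<close>

lemma cf_interval_Bad:
  assumes "K \<ge> 1" and w: "\<And>l. \<exists>w. digits_le K w \<and> length w \<ge> l \<and> \<beta> \<in> cf_interval K w"
  shows "\<beta> \<in> Bad"
proof -
  define c where "c = 1 / ((real K + 1) * (real K + 2))"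
  have c: "c > 0" by (simp add: c_def)
  have "c \<le> real n * dist_int (real n * \<beta>)" if n: "n \<ge> 1" for n
  proof -
    \<comment> \<open>The denominator of a word is at least its length minus 1, so
      \<open>n + 2\<close> digits carry it past \<open>n\<close>.\<close>
    obtain w where w: "digits_le K w" "length w \<ge> n + 2" "\<beta> \<in> cf_interval K w" using assms by blast
    define N where "N = (LEAST i. i \<le> length w \<and> i \<ge> 1 \<and> row1 (take i w) 0 1 > real n)"
    have ex: "length w \<le> length w \<and> length w \<ge> 1 \<and> row1 (take (length w) w) 0 1 > real n"
    proof -
      have "w \<noteq> []" "real (n + 2) \<le> real (length w)" using w(2) by (auto simp del: of_nat_add)
      then show ?thesis using row_01_props(4)[OF w(1)] w(2) by auto
    qed
    have N: "N \<le> length w" "N \<ge> 1" "row1 (take N w) 0 1 > real n"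
      using LeastI[of "\<lambda>i. i \<le> length w \<and> i \<ge> 1 \<and> row1 (take i w) 0 1 > real n", OF ex] unfolding N_def by auto
    \<comment> \<open>A word of one digit has denominator 1, which does not exceed \<open>n\<close>;
      hence there is a nonempty prefix before the \<open>N\<close>-th.\<close>
    have "N \<noteq> 1"
    proof
      assume "N = 1"
      then have "take N w = [hd w]" using w(2) by (cases w) auto
      then show False using N(3) n by simp
    qed
    then have N2: "N - 1 \<ge> 1" using N by simp
    have "\<not> (N - 1 \<le> length w \<and> N - 1 \<ge> 1 \<and> row1 (take (N - 1) w) 0 1 > real n)"
      using not_less_Least[of "N - 1" "\<lambda>i. i \<le> length w \<and> i \<ge> 1 \<and> row1 (take i w) 0 1 > real n"] N unfolding N_def[symmetric] by auto
    then have small: "row1 (take (N - 1) w) 0 1 \<le> real n" using N N2 by auto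
    define u where "u = take (N - 1) w"
    define k where "k = w ! (N - 1)"
    have tk: "take N w = u @ [k]" unfolding u_def k_def using N take_Suc_conv_app_nth[of "N - 1" w] by simp
    have du: "digits_le K (u @ [k])" using w(1) set_take_subset[of N w] unfolding tk[symmetric] digits_le_def by auto
    have une: "u \<noteq> []" using N2 N unfolding u_def by auto
    have "\<beta> \<in> cf_interval K (take N w)"
      using cf_interval_append_subset[of K "drop N w" "take N w"] w set_drop_subset[of N w] by (auto simp: digits_le_def)
    then obtain z where z: "1 \<le> z" "z \<le> real K + 1" "\<beta> = cfv (u @ [k]) z" unfolding tk by (auto simp: cf_interval_def)
    let ?Q = "row1 (u @ [k]) 0 1 :: real" and ?Q' = "row2 (u @ [k]) 0 1 :: real"
    have Q: "0 \<le> ?Q'" "?Q' \<le> ?Q" "1 \<le> ?Q" using row_01_props[OF du] by auto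
    have "?Q * z + ?Q' \<le> ?Q * (real K + 1) + ?Q" using Q z by (intro add_mono mult_left_mono) auto
    also have "\<dots> = (real K + 2) * ?Q" by (simp add: algebra_simps)
    also have "\<dots> \<le> (real K + 2) * ((real K + 1) * real n)"
      using row_snoc_le(1)[OF du une] small unfolding u_def[symmetric]
      by (intro mult_left_mono) (auto intro: order_trans mult_left_mono)
    finally have Qz: "?Q * z + ?Q' \<le> (real K + 2) * ((real K + 1) * real n)" .
    have "0 < ?Q * z + ?Q'" using row_pos(2)[OF du] z by auto
    then have "1 / ((real K + 2) * ((real K + 1) * real n)) \<le> 1 / (?Q * z + ?Q')"
      using Qz n by (intro divide_left_mono mult_pos_pos) auto
    also have "\<dots> \<le> dist_int (real n * \<beta>)"
      unfolding dist_int_eq_round z(3)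
      using n z(1) N(3) du unfolding tk by (intro cfv_approx_lower[OF du]) auto
    finally have "1 / ((real K + 2) * ((real K + 1) * real n)) \<le> dist_int (real n * \<beta>)" .
    then have "real n * (1 / ((real K + 2) * ((real K + 1) * real n))) \<le> real n * dist_int (real n * \<beta>)"
      by (intro mult_left_mono) auto
    then show ?thesis using n by (simp add: c_def mult_ac)
  qed
  then have "eventually (\<lambda>n. ereal c \<le> ereal (real n * dist_int (real n * \<beta>))) sequentially"
    by (auto simp: eventually_sequentially)
  then have "ereal c \<le> liminf (\<lambda>n. ereal (real n * dist_int (real n * \<beta>)))"
    by (rule Liminf_bounded)
  then have "0 < liminf (\<lambda>n. ereal (real n * dist_int (real n * \<beta>)))"
    using c by (metis ereal_less(2) order_less_le_trans)
  then show ?thesis by (simp add: Bad_def)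
qed


section \<open>The tree of words with forced blocks\<close>

lemma cyl_bounds:
  fixes x y :: real
  assumes "1 \<le> x" "0 \<le> y" "y \<le> x"
  shows "0 < cyl x y" "cyl x y \<le> 1 / x^2" "1 / (2 * x^2) \<le> cyl x y" "cyl x y \<le> 1"
proof -
  show "0 < cyl x y" using assms by (auto simp: cyl_def intro!: divide_pos_pos mult_pos_pos)
  have "x * x \<le> x * (x + y)" "x * (x + y) \<le> x * (2 * x)" using assms by (auto intro!: mult_left_mono)
  then show le: "cyl x y \<le> 1 / x^2" and "1 / (2 * x^2) \<le> cyl x y"
    unfolding cyl_def power2_eq_square using assms by (auto intro!: divide_left_mono mult_pos_pos)
  have "1 \<le> x^2" using assms by simp
  then have "1 / x^2 \<le> 1" by (subst divide_le_eq_1) auto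
  with le show "cyl x y \<le> 1" by linarith
qed

text \<open>At each node whose denominator passes \<open>y j\<close> a block hitting the \<open>j\<close>-th target is forced;
  the factor \<open>\<Prod>j. 2 * H j ^ 60\<close> in \<open>V\<close> pays for the branches lost there.\<close>

lemma hausdorff_outer_measure_hits_nonzero:
  fixes K :: nat and s t :: real
  assumes s: "19/20 \<le> s" "s < 1" "2 powr (1 - s) * (1 - 2 / (real K + 1)) \<ge> 1" and K: "K \<ge> 1"
    and t: "0 < t" "t < s"
  obtains H0 :: nat where
    "\<And>(m :: nat \<Rightarrow> real) H \<epsilon> \<delta> G y.
      (\<And>j. H0 \<le> H j \<and> 0 < \<epsilon> j \<and> \<epsilon> j \<le> 1 \<and> 2 \<le> real (H j) * \<epsilon> j ^ 2) \<Longrightarrow>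
      (\<And>j. y j = m j / ((real K + 1)^2 * real (H j) ^ 50)) \<Longrightarrow>
      1 < y 0 \<Longrightarrow> (\<And>j. (real K + 1)^2 * real (H j) ^ 60 * y j < y (Suc j)) \<Longrightarrow>
      (\<exists>C. \<forall>n. (\<Prod>j\<le>n. 2 * real (H j) ^ 60) \<le> C * y n powr (s - t)) \<Longrightarrow>
      {\<beta> \<in> Bad. 1 \<le> \<beta> \<and> \<beta> \<le> 3 \<and> (\<forall>j. dist_int (m j * \<beta> - \<delta>) \<le> \<epsilon> j)} \<subseteq> G \<Longrightarrow>
      hausdorff_outer_measure t G \<noteq> 0"
proof -
  from s K show ?thesis
  proof (rule hitting_word, goal_cases)
    case (1 H0)
    note H0 = 1(1) and hit = 1(2)
    show ?thesis
    proof (rule that[of H0])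
      fix m :: "nat \<Rightarrow> real" and H :: "nat \<Rightarrow> nat" and \<epsilon> y :: "nat \<Rightarrow> real" and \<delta> :: real and G :: "real set"
      assume HE: "\<And>j. H0 \<le> H j \<and> 0 < \<epsilon> j \<and> \<epsilon> j \<le> 1 \<and> 2 \<le> real (H j) * \<epsilon> j ^ 2"
        and y: "\<And>j. y j = m j / ((real K + 1)^2 * real (H j) ^ 50)"
        and y0: "1 < y 0" and ystep: "\<And>j. (real K + 1)^2 * real (H j) ^ 60 * y j < y (Suc j)"
        and "\<exists>C. \<forall>n. (\<Prod>j\<le>n. 2 * real (H j) ^ 60) \<le> C * y n powr (s - t)"
        and G: "{\<beta> \<in> Bad. 1 \<le> \<beta> \<and> \<beta> \<le> 3 \<and> (\<forall>j. dist_int (m j * \<beta> - \<delta>) \<le> \<epsilon> j)} \<subseteq> G"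
      then obtain C where C: "\<And>n. (\<Prod>j\<le>n. 2 * real (H j) ^ 60) \<le> C * y n powr (s - t)" by blast
      define A where "A = (real K + 1)^2"
      have A: "A \<ge> 1" "A \<ge> 2" unfolding A_def using K power_mono[of 2 "real K + 1" 2] by auto
      have H2: "real (H j) \<ge> 2" for j using HE[of j] H0 by simp
      have H1: "1 \<le> real (H j) ^ n" for j n using H2[of j] by (intro one_le_power) auto
      have y1: "1 < y j" for j
      proof (induction j)
        case (Suc j)
        have "1 * 1 * y j \<le> (real K + 1)^2 * real (H j) ^ 60 * y j"
          using Suc A H1[of j 60] by (intro mult_right_mono mult_mono) (auto simp: A_def)
        then show ?case using ystep[of j] Suc by linarith
      qed (rule y0)
      have yA: "A * y j < y (Suc j)" "2 * y j < y (Suc j)" for j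
      proof -
        have "A * 1 * y j \<le> A * real (H j) ^ 60 * y j"
          using y1[of j] A H1[of j 60] by (intro mult_right_mono mult_left_mono) auto
        then show 1: "A * y j < y (Suc j)" using ystep[of j] unfolding A_def by linarith
        have "2 * y j \<le> A * y j" using A y1[of j] by (intro mult_right_mono) auto
        then show "2 * y j < y (Suc j)" using 1 by linarith
      qed
      have ysm: "strict_mono y" unfolding strict_mono_Suc_iff
      proof
        fix j show "y j < y (Suc j)" using yA(2)[of j] y1[of j] by linarith
      qed
      note ymono = strict_mono_less[OF ysm] strict_mono_less_eq[OF ysm]
      have ybig: "real j < y j" for j
      proof (induction j)
        case (Suc j) then show ?case using yA(2)[of j] y1[of j] by simp
      qed (use y1[of 0] in auto)
      have finy: "finite {j. y j \<le> b}" for b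
      proof (rule finite_subset)
        show "{j. y j \<le> b} \<subseteq> {..nat \<lceil>b\<rceil>}"
        proof
          fix j assume "j \<in> {j. y j \<le> b}"
          then have "real j \<le> b" using ybig[of j] by auto
          then show "j \<in> {..nat \<lceil>b\<rceil>}" by (simp add: le_nat_iff) linarith
        qed
      qed simp
      define q where "q u = row1 u (0::real) 1" for u
      define p where "p u = row2 u (0::real) 1" for u
      \<comment> \<open>For nonempty \<open>u\<close>, \<open>p u\<close> is the denominator before
        the last digit, so \<open>T j u\<close> says that this digit carried the squared denominator
        past \<open>y j\<close>. For nodes of the tree also \<open>(q u)^2 < A * y j\<close>, hence
        \<open>m j / (q u)^2\<close> lies between \<open>H^50\<close> and \<open>A * H^50\<close>,
        as \<open>hitting_word\<close> asks.\<close>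
      define T where "T j u \<longleftrightarrow> (p u)^2 < y j \<and> y j \<le> (q u)^2" for j u
      define ok where "ok j u g \<longleftrightarrow> g \<noteq> [] \<and> digits_le K g \<and> q (u @ g) \<le> q u * real (H j) ^ 30 \<and>
          (\<forall>\<zeta>\<in>{1..real K + 1}. dist_int (m j * cfv (u @ g) \<zeta> - \<delta>) \<le> \<epsilon> j)" for j u g
      define sel where "sel u = (SOME g. ok (SOME j. T j u) u g)" for u
      define Ch where "Ch u = (if \<exists>j. T j u then {u @ sel u} else (\<lambda>k. u @ [k]) ` {1..K})" for u
      have ChT: "Ch u = {u @ sel u}" if "T j u" for u j using that unfolding Ch_def by auto
      \<comment> \<open>The root \<open>[1]\<close> has denominator 1, below all thresholds because
        \<open>1 < y 0\<close>, and the fixed first digit keeps all points between 1 and 2.\<close>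
      define P where "P u \<longleftrightarrow> digits_le K u \<and> u \<noteq> [] \<and> hd u = 1" for u
      have Pq: "0 \<le> p u" "p u \<le> q u" "1 \<le> q u" "real (length u) - 1 \<le> q u" if "P u" for u
        using row_01_props[of K u] that unfolding P_def p_def q_def by auto
      have Tq: "q u \<le> (real K + 1) * p u" "length u \<ge> 2" if u: "P u" and T: "T j u" for u j
      proof -
        have "u \<noteq> [hd u]"
        proof
          assume "u = [hd u]"
          then have "u = [1]" using u by (simp add: P_def)
          then have "q u = 1" by (simp add: q_def)
          then show False using T y1[of j] by (simp add: T_def)
        qed
        then show "length u \<ge> 2" using u by (cases u) (auto simp: P_def Suc_le_eq)
        then obtain v k where v: "u = v @ [k]" "v \<noteq> []" by (cases u rule: rev_cases) fastforce+
        then show "q u \<le> (real K + 1) * p u"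
          using row_snoc_le[of K v k] u by (simp add: P_def q_def p_def)
      qed
      have Tq2: "(q u)^2 < A * y j" if u: "P u" and T: "T j u" for u j
      proof -
        have "(q u)^2 \<le> ((real K + 1) * p u)^2" using Tq(1)[OF u T] Pq[OF u] by (intro power_mono) auto
        also have "\<dots> = A * (p u)^2" by (simp add: A_def power_mult_distrib)
        also have "\<dots> < A * y j" using T A by (intro mult_strict_left_mono) (auto simp: T_def)
        finally show ?thesis .
      qed
      have Tuniq: "i = j" if u: "P u" and T: "T i u" "T j u" for u i j
      proof -
        have *: "\<not> a < b" if "T a u" "T b u" for a b
        proof
          assume "a < b"
          then have "y (Suc a) \<le> y b" using ymono by simp
          then show False using Tq2[OF u that(1)] yA(1)[of a] that(2) by (simp add: T_def)
        qed
        show ?thesis using *[OF T] *[OF T(2,1)] by linarith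
      qed
      have sel: "ok j u (sel u)" if u: "P u" and T: "T j u" for u j
      proof -
        have "(SOME j. T j u) = j" using Tuniq[OF u _ T] T by (metis someI)
        have q2: "0 < (q u)^2" using Pq[OF u] by (intro zero_less_power) auto
        have AH: "0 < A * real (H j) ^ 50" using A H2[of j] by (intro mult_pos_pos zero_less_power) linarith+
        have my: "m j = y j * (A * real (H j) ^ 50)" using AH y[of j] unfolding A_def[symmetric] by (metis less_irrefl nonzero_eq_divide_eq)
        have "\<exists>g. ok j u g" unfolding ok_def q_def
        proof (rule hit)
          have "y j / (q u)^2 \<le> 1" using T q2 by (simp add: T_def)
          then have "y j / (q u)^2 * (A * real (H j) ^ 50) \<le> 1 * (A * real (H j) ^ 50)"
            using AH by (intro mult_right_mono) auto
          then show "m j / (row1 u 0 1)^2 \<le> (real K + 1)^2 * real (H j) ^ 50"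
            by (simp add: my q_def A_def)
          have "1 \<le> A * y j / (q u)^2" using Tq2[OF u T] q2 by simp
          then have "1 * real (H j) ^ 50 \<le> A * y j / (q u)^2 * real (H j) ^ 50"
            by (intro mult_right_mono) auto
          then show "real (H j) ^ 50 \<le> m j / (row1 u 0 1)^2" by (simp add: my q_def mult_ac)
        qed (use u HE[of j] in \<open>auto simp: P_def\<close>)
        then show ?thesis unfolding sel_def \<open>(SOME j. T j u) = j\<close> by (rule someI_ex)
      qed
      have ChD: "\<exists>e. v = u @ e \<and> e \<noteq> [] \<and> digits_le K e" if u: "P u" and v: "v \<in> Ch u" for u v
        using v sel[OF u] unfolding Ch_def by (auto simp: ok_def split: if_splits)
      have step: "P v" if "P u" "v \<in> Ch u" for u v
        using ChD[OF that] that(1) by (auto simp: P_def)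
      have pv: "q u \<le> p v" if u: "P u" and v: "v \<in> Ch u" for u v
      proof -
        obtain e where e: "v = u @ e" "e \<noteq> []" "digits_le K e" using ChD[OF u v] by auto
        show ?thesis unfolding e(1) p_def q_def row_append
          by (rule row2_ge[OF e(3) _ _ e(2)]) (use Pq[OF u] in \<open>auto simp: p_def q_def\<close>)
      qed
      \<comment> \<open>A block multiplies \<open>q u\<close> by at most \<open>H^30\<close>, so the
        cylinder shrinks by a factor of at most \<open>2 * H^60\<close>; the 2 is the gap between
        the two bounds \<open>1 / (2 * x^2)\<close> and \<open>1 / x^2\<close> for
        \<open>cyl x y\<close>.\<close>
      define loss where "loss j = 2 * real (H j) ^ 60" for j
      have loss: "1 \<le> loss j" for j using H1[of j 60] by (simp add: loss_def)
      \<comment> \<open>Comparison with \<open>p u\<close> instead of \<open>q u\<close> leaves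
        \<open>j\<close> out at the node where \<open>T j\<close> holds and counts it right after
        the block, where \<open>q u <= p v\<close>.\<close>
      define Lam where "Lam u = (\<Prod>j\<in>{j. y j \<le> (p u)^2}. loss j)" for u
      define V where "V u = cyl (q u) (p u) powr s * Lam u" for u
      have Lam1: "1 \<le> Lam u" for u unfolding Lam_def by (intro prod_ge_1) (rule loss)
      have Lam_mono: "Lam u \<le> Lam v" if "0 \<le> p u" "p u \<le> p v" for u v
        unfolding Lam_def
      proof (rule prod_mono2[OF finy])
        have "(p u)^2 \<le> (p v)^2" using that by (intro power_mono) auto
        then show "{j. y j \<le> (p u)^2} \<subseteq> {j. y j \<le> (p v)^2}" by auto
      qed (use loss in \<open>auto intro: order_trans[OF zero_le_one]\<close>)
      have Vsum: "V u \<le> (\<Sum>v\<in>Ch u. V v)" if u: "P u" for u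
      proof (cases "\<exists>j. T j u")
        case False
        have inj: "inj_on (\<lambda>k. u @ [k]) {1..K}" by (auto simp: inj_on_def)
        have "V u \<le> (\<Sum>k=1..K. cyl (real k * q u + p u) (q u) powr s) * Lam u"
          unfolding V_def using cyl_powr_sum[of "q u" "p u" s K] Pq[OF u] s Lam1[of u]
          by (intro mult_right_mono) auto
        also have "\<dots> \<le> (\<Sum>k=1..K. V (u @ [k]))"
          unfolding sum_distrib_right
        proof (rule sum_mono)
          fix k assume "k \<in> {1..K}"
          then have "Lam u \<le> Lam (u @ [k])"
            using pv[OF u, of "u @ [k]"] Pq[OF u] False by (intro Lam_mono) (auto simp: Ch_def)
          moreover have "q (u @ [k]) = real k * q u + p u" "p (u @ [k]) = q u"
            by (simp_all add: q_def p_def row_append)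
          ultimately show "cyl (real k * q u + p u) (q u) powr s * Lam u \<le> V (u @ [k])"
            unfolding V_def using Lam1[of u] by (intro mult_mono) auto
        qed
        also have "\<dots> = (\<Sum>v\<in>Ch u. V v)" using sum.reindex[OF inj, of V] False by (simp add: Ch_def)
        finally show ?thesis .
      next
        case True
        then obtain j where T: "T j u" by auto
        define v where "v = u @ sel u"
        have Ch: "Ch u = {v}" using True by (simp add: Ch_def v_def)
        have Pv: "P v" using step[OF u] Ch by auto
        have quv: "q u \<le> p v" using pv[OF u] Ch by auto
        have "y j \<le> (p v)^2" using T power_mono[OF quv, of 2] Pq[OF u] unfolding T_def by linarith
        moreover have "(p u)^2 \<le> (p v)^2" using quv Pq[OF u] by (intro power_mono) auto
        ultimately have sub: "insert j {i. y i \<le> (p u)^2} \<subseteq> {i. y i \<le> (p v)^2}" by auto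
        have "loss j * Lam u = (\<Prod>i\<in>insert j {i. y i \<le> (p u)^2}. loss i)"
          unfolding Lam_def using finy T by (subst prod.insert) (auto simp: T_def)
        also have "\<dots> \<le> Lam v"
          unfolding Lam_def by (rule prod_mono2[OF finy sub]) (use loss in \<open>auto intro: order_trans[OF zero_le_one]\<close>)
        finally have L: "loss j * Lam u \<le> Lam v" .
        have c: "cyl (q u) (p u) / loss j \<le> cyl (q v) (p v)"
        proof -
          have "q v \<le> q u * real (H j) ^ 30" using sel[OF u T] by (simp add: ok_def v_def)
          then have "(q v)^2 \<le> (q u * real (H j) ^ 30)^2" using Pq[OF Pv] by (intro power_mono) auto
          then have "2 * (q v)^2 \<le> loss j * (q u)^2" by (simp add: loss_def power_mult_distrib mult.commute flip: power_mult)
          moreover have "0 < 2 * (q v)^2" using Pq[OF Pv] by (auto intro!: mult_pos_pos zero_less_power)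
          ultimately have "1 / (loss j * (q u)^2) \<le> 1 / (2 * (q v)^2)" by (intro frac_le) auto
          also have "\<dots> \<le> cyl (q v) (p v)" using cyl_bounds(3) Pq[OF Pv] by auto
          finally have 1: "1 / (loss j * (q u)^2) \<le> cyl (q v) (p v)" .
          have "cyl (q u) (p u) / loss j \<le> 1 / (q u)^2 / loss j"
            using cyl_bounds(2)[of "q u" "p u"] Pq[OF u] loss[of j] by (intro divide_right_mono) auto
          with 1 show ?thesis by (simp add: mult.commute)
        qed
        have "cyl (q u) (p u) powr s \<le> (cyl (q u) (p u) / loss j) powr s * loss j"
        proof -
          have "(cyl (q u) (p u) / loss j) powr s * loss j = cyl (q u) (p u) powr s * (loss j powr 1 / loss j powr s)"
            using cyl_bounds(1)[of "q u" "p u"] Pq[OF u] loss[of j] by (simp add: powr_divide)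
          also have "\<dots> = cyl (q u) (p u) powr s * loss j powr (1 - s)" by (simp add: powr_diff)
          also have "\<dots> \<ge> cyl (q u) (p u) powr s * 1"
            using loss[of j] s by (intro mult_left_mono ge_one_powr_ge_zero) auto
          finally show ?thesis by simp
        qed
        also have "\<dots> \<le> cyl (q v) (p v) powr s * loss j"
          using c s cyl_bounds(1)[of "q u" "p u"] Pq[OF u] loss[of j] by (intro mult_right_mono powr_mono2) auto
        finally have "V u \<le> cyl (q v) (p v) powr s * loss j * Lam u"
          unfolding V_def using Lam1[of u] by (intro mult_right_mono) auto
        also have "\<dots> \<le> cyl (q v) (p v) powr s * Lam v"
          unfolding mult.assoc using L by (intro mult_left_mono) auto
        finally show ?thesis by (simp add: Ch V_def)
      qed
      define C' where "C' = \<bar>C\<bar> + 1"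
      \<comment> \<open>The factor \<open>Lam u\<close> is paid for by lowering the exponent from
        \<open>s\<close> to \<open>t\<close>: if \<open>n\<close> is the last threshold counted,
        then \<open>Lam u <= C * y n powr (s - t)\<close>, and
        \<open>y n <= (q u)^2 <= 1 / cyl (q u) (p u)\<close>.\<close>
      have Vb: "V u \<le> C' * cyl (q u) (p u) powr t" if u: "P u" for u
      proof -
        let ?c = "cyl (q u) (p u)"
        have c: "0 < ?c" "?c \<le> 1" "?c \<le> 1 / (q u)^2" using cyl_bounds[of "q u" "p u"] Pq[OF u] by auto
        have q0: "0 < (q u)^2" using Pq[OF u] by (intro zero_less_power) auto
        have cinv: "(1 / ?c) powr (s - t) = ?c powr - (s - t)"
          unfolding powr_minus_divide using c by (subst powr_divide) auto
        have cq: "((q u)^2) powr (s - t) \<le> ?c powr - (s - t)"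
        proof -
          have "(q u)^2 \<le> 1 / ?c" using c q0 by (simp add: field_simps)
          then have "((q u)^2) powr (s - t) \<le> (1 / ?c) powr (s - t)" using t by (intro powr_mono2) auto
          then show ?thesis unfolding cinv .
        qed
        have "Lam u \<le> C' * ?c powr - (s - t)"
        proof (cases "{j. y j \<le> (p u)^2} = {}")
          case True
          have "1 \<le> (1 / ?c) powr (s - t)" using c t by (intro ge_one_powr_ge_zero) auto
          then have 1: "1 \<le> ?c powr - (s - t)" unfolding cinv .
          have "1 * 1 \<le> C' * ?c powr - (s - t)" using 1 by (intro mult_mono) (auto simp: C'_def)
          then show ?thesis by (simp add: Lam_def True)
        next
          case False
          define n where "n = Max {j. y j \<le> (p u)^2}"
          have n: "y n \<le> (p u)^2" "\<And>j. y j \<le> (p u)^2 \<Longrightarrow> j \<le> n"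
            using Max_in[OF finy False] Max_ge[OF finy] unfolding n_def by auto
          have "{j. y j \<le> (p u)^2} = {..n}"
          proof (intro set_eqI iffI)
            fix j assume "j \<in> {..n}"
            then have "y j \<le> y n" using ymono by simp
            then show "j \<in> {j. y j \<le> (p u)^2}" using n by auto
          qed (use n in auto)
          then have "Lam u = (\<Prod>j\<le>n. 2 * real (H j) ^ 60)" by (simp add: Lam_def loss_def)
          also have "\<dots> \<le> C * y n powr (s - t)" by (rule C)
          also have "\<dots> \<le> C' * y n powr (s - t)" by (intro mult_right_mono) (auto simp: C'_def)
          also have "\<dots> \<le> C' * ((q u)^2) powr (s - t)"
          proof (intro mult_left_mono powr_mono2)
            have "(p u)^2 \<le> (q u)^2" using Pq[OF u] by (intro power_mono) auto
            then show "y n \<le> (q u)^2" using n by linarith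
          qed (use t y1[of n] in \<open>auto simp: C'_def\<close>)
          also have "\<dots> \<le> C' * ?c powr - (s - t)" using cq by (intro mult_left_mono) (auto simp: C'_def)
          finally show ?thesis .
        qed
        then have "V u \<le> ?c powr s * (C' * ?c powr - (s - t))" unfolding V_def by (intro mult_left_mono) auto
        also have "\<dots> = C' * ?c powr (s + - (s - t))" unfolding powr_add by simp
        finally show ?thesis by simp
      qed
      define c where "c = 1 / ((real K + 1) * (real K + 2)^2)"
      show "hausdorff_outer_measure t G \<noteq> 0"
      proof (rule hausdorff_outer_measure_tree_nonzero[where P = P and Ch = Ch and ?r0.0 = "[1]" and V = V
            and sz = "\<lambda>u. cyl (q u) (p u)" and I = "cf_interval K" and C = C' and c = c])
        show "finite (Ch u)" for u by (simp add: Ch_def)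
        show P1: "P [1]" using K by (simp add: P_def)
        show "P v" if "P u" "v \<in> Ch u" for u v by (rule step[OF that])
        show "prefix u v" if "P u" "v \<in> Ch u" for u v using ChD[OF that] by auto
        show "\<not> prefix v v'" if "P u" "v \<in> Ch u" "v' \<in> Ch u" "v \<noteq> v'" for u v v'
          using that by (auto simp: Ch_def split: if_splits)
        show "V u \<le> (\<Sum>v\<in>Ch u. V v)" if "P u" for u by (rule Vsum[OF that])
        show "0 < V [1]" unfolding V_def using Lam1[of "[1]"] cyl_bounds(1)[of "q [1]" "p [1]"] Pq[OF P1]
          by (intro mult_pos_pos) auto
        show "V u \<le> C' * cyl (q u) (p u) powr t" if "P u" for u by (rule Vb[OF that])
        show "0 < cyl (q u) (p u)" if "P u" for u using cyl_bounds(1) Pq[OF that] by auto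
        show "0 < t" "0 < C'" "0 < c" using t by (auto simp: C'_def c_def)
        show "c * cyl (q u) (p u) \<le> dist \<beta> \<beta>'"
          if u: "P u" and v: "v \<in> Ch u" "v' \<in> Ch u" "v \<noteq> v'" and \<beta>: "\<beta> \<in> cf_interval K v" "\<beta>' \<in> cf_interval K v'" for u v v' \<beta> \<beta>'
        proof -
          have "\<not> (\<exists>j. T j u)" using v by (auto simp: Ch_def split: if_splits)
          then have Ch: "Ch u = (\<lambda>k. u @ [k]) ` {1..K}" by (simp add: Ch_def)
          obtain k where k1: "v = u @ [k]" "k \<in> {1..K}" using v(1) unfolding Ch by (rule imageE)
          obtain k' where k2: "v' = u @ [k']" "k' \<in> {1..K}" using v(2) unfolding Ch by (rule imageE)
          note k = k1(1) k2(1) k1(2) k2(2)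
          with v(3) have "k \<noteq> k'" by auto
          obtain z z' where z: "\<beta> = cfv v z" "\<beta>' = cfv v' z'" "z \<in> {1..real K + 1}" "z' \<in> {1..real K + 1}"
            using \<beta> by (auto simp: cf_interval_def)
          define x where "x = cfv [k] z"
          define x' where "x' = cfv [k'] z'"
          have x: "x \<in> {1..real K + 1}" "x' \<in> {1..real K + 1}"
            using cfv_range[of K "[k]" z] cfv_range[of K "[k']" z'] k z by (auto simp: x_def x'_def)
          \<comment> \<open>The digits differ by at least 1, and the reciprocals lie between
            \<open>1 / (K + 1)\<close> and 1. The bound on the tails is what keeps siblings
            apart.\<close>
          have gap: "1 / (real K + 1) \<le> \<bar>x - x'\<bar>"
          proof -
            have "1 / (real K + 1) \<le> 1 / z" "1 / z \<le> 1" "1 / (real K + 1) \<le> 1 / z'" "1 / z' \<le> 1"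
              using z(3,4) by (auto intro!: divide_left_mono)
            moreover have "real k + 1 \<le> real k' \<or> real k' + 1 \<le> real k" using \<open>k \<noteq> k'\<close> by linarith
            ultimately show ?thesis unfolding x_def x'_def by (auto simp: abs_if)
          qed
          have du: "digits_le K u" using u by (simp add: P_def)
          have d: "1 \<le> q u * a + p u" "q u * a + p u \<le> (real K + 2) * q u" if "a \<in> {1..real K + 1}" for a
          proof -
            have "1 * 1 \<le> q u * a" using Pq[OF u] that by (intro mult_mono) auto
            then show "1 \<le> q u * a + p u" using Pq[OF u] by linarith
            have "q u * a + p u \<le> q u * (real K + 1) + q u" using Pq[OF u] that by (intro add_mono mult_left_mono) auto
            then show "q u * a + p u \<le> (real K + 2) * q u" by (simp add: algebra_simps)
          qed
          have "\<bar>\<beta> - \<beta>'\<bar> = \<bar>x - x'\<bar> / ((q u * x + p u) * (q u * x' + p u))"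
          proof -
            have "\<beta> = cfv u x" "\<beta>' = cfv u x'" using z k by (auto simp: cfv_append x_def x'_def)
            then show ?thesis using cfv_diff[OF du, of x x'] x d[OF x(1)] d[OF x(2)]
              by (simp add: q_def p_def abs_mult abs_divide power_abs)
          qed
          also have "\<dots> \<ge> (1 / (real K + 1)) / (((real K + 2) * q u) * ((real K + 2) * q u))"
            using gap d[OF x(1)] d[OF x(2)] Pq[OF u] by (intro frac_le mult_mono) (auto intro!: mult_pos_pos)
          also have "(1 / (real K + 1)) / (((real K + 2) * q u) * ((real K + 2) * q u)) = c * (1 / (q u)^2)"
            by (simp add: c_def power2_eq_square)
          also have "\<dots> \<ge> c * cyl (q u) (p u)"
            using cyl_bounds(2)[of "q u" "p u"] Pq[OF u] by (intro mult_left_mono) (auto simp: c_def)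
          finally show ?thesis by (simp add: dist_real_def)
        qed
        fix x :: "nat \<Rightarrow> nat list"
        assume x: "x 0 = [1]" "\<And>n. P (x n)" "\<And>n. x (Suc n) \<in> Ch (x n)"
        have len: "n < length (x n)" for n
        proof (induction n)
          case 0 show ?case by (simp add: x(1))
        next
          case (Suc n)
          obtain e where "x (Suc n) = x n @ e" "e \<noteq> []" using ChD[OF x(2) x(3), of n] by auto
          then show ?case using Suc by (cases e) auto
        qed
        have qn: "real n \<le> q (x n)" for n using len[of n] Pq(4)[OF x(2), of n] by linarith
        have lim: "(\<lambda>n. cyl (q (x n)) (p (x n))) \<longlonglongrightarrow> 0"
        proof (rule tendsto_sandwich)
          show "eventually (\<lambda>n. 0 \<le> cyl (q (x n)) (p (x n))) sequentially"
            using cyl_bounds(1) Pq[OF x(2)] by (intro always_eventually) (auto intro: less_imp_le)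
          show "eventually (\<lambda>n. cyl (q (x n)) (p (x n)) \<le> 1 / real n) sequentially"
          proof (rule eventually_sequentiallyI[of 1])
            fix n :: nat assume n: "1 \<le> n"
            have q1: "1 \<le> q (x n)" using Pq[OF x(2)] by auto
            have "cyl (q (x n)) (p (x n)) \<le> 1 / (q (x n))^2" using cyl_bounds(2) Pq[OF x(2)] by auto
            also have "\<dots> \<le> 1 / real n"
            proof (intro divide_left_mono mult_pos_pos)
              have "1 * q (x n) \<le> q (x n) * q (x n)" using q1 by (intro mult_right_mono) auto
              then show "real n \<le> (q (x n))^2" using qn[of n] by (simp add: power2_eq_square)
            qed (use n q1 in auto)
            finally show "cyl (q (x n)) (p (x n)) \<le> 1 / real n" .
          qed
        qed (auto intro: lim_1_over_n)
        have sub: "cf_interval K (x (Suc n)) \<subseteq> cf_interval K (x n)" for n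
          using ChD[OF x(2) x(3), of n] cf_interval_append_subset by force
        have dx: "digits_le K (x n)" for n using x(2) by (simp add: P_def)
        have "\<Inter> (range (\<lambda>n. cf_interval K (x n))) \<noteq> {}"
        proof (rule compact_nest)
          show "compact (cf_interval K (x n))" for n
            unfolding cf_interval_def
          proof (rule compact_continuous_image)
            show "continuous_on {1..real K + 1} (cfv (x n))"
              by (rule DERIV_continuous_on[OF cfv_DERIV[OF dx]]) auto
          qed simp
          show "cf_interval K (x n) \<noteq> {}" for n by (simp add: cf_interval_def)
          show "cf_interval K (x n) \<subseteq> cf_interval K (x k)" if "k \<le> n" for k n
            using lift_Suc_antimono_le[of "\<lambda>n. cf_interval K (x n)", OF sub that] .
        qed
        then obtain \<beta> where \<beta>: "\<And>n. \<beta> \<in> cf_interval K (x n)" by auto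
        have "\<beta> \<in> Bad"
          by (rule cf_interval_Bad[OF K]) (use \<beta> dx len in \<open>metis less_imp_le\<close>)
        moreover have "1 \<le> \<beta> \<and> \<beta> \<le> 3"
        proof -
          obtain z where z: "\<beta> = cfv [1] z" "1 \<le> z" using \<beta>[of 0] x(1) by (auto simp: cf_interval_def)
          have "0 < 1 / z" "1 / z \<le> 1" using z(2) by auto
          then have "1 \<le> 1 + 1 / z" "1 + 1 / z \<le> 3" by linarith+
          then show ?thesis unfolding z(1) by simp
        qed
        moreover have "dist_int (m j * \<beta> - \<delta>) \<le> \<epsilon> j" for j
        proof -
          obtain n0 where n0: "y j \<le> real n0" using real_arch_simple by blast
          have "y j \<le> (q (x (Suc n0)))^2"
          proof -
            have "1 * q (x (Suc n0)) \<le> q (x (Suc n0)) * q (x (Suc n0))" using Pq[OF x(2), of "Suc n0"] by (intro mult_right_mono) auto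
            then show ?thesis unfolding power2_eq_square using qn[of "Suc n0"] n0 by linarith
          qed
          then have ex: "\<exists>n. y j \<le> (q (x n))^2" by blast
          define n where "n = (LEAST n. y j \<le> (q (x n))^2)"
          have n: "y j \<le> (q (x n))^2" unfolding n_def by (rule LeastI_ex[OF ex])
          have "n \<noteq> 0"
          proof
            assume "n = 0"
            then have "q (x n) = 1" by (simp add: x(1) q_def)
            then show False using n y1[of j] by simp
          qed
          then obtain k where k: "n = Suc k" using not0_implies_Suc by auto
          have small: "(q (x k))^2 < y j" using not_less_Least[of k "\<lambda>n. y j \<le> (q (x n))^2"] k unfolding n_def by auto
          \<comment> \<open>The step to the first node past \<open>y j\<close> is not a block: a
            block for \<open>i\<close> starts past \<open>y i\<close> with squared denominator below
            \<open>A * y i\<close>, multiplies it by at most \<open>H^60\<close>, and so ends below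
            \<open>y (Suc i)\<close>. Hence a single digit was added, and \<open>T j\<close> holds
            at \<open>x n\<close>.\<close>
          have "\<not> (\<exists>i. T i (x k))"
          proof
            assume "\<exists>i. T i (x k)"
            then obtain i where i: "T i (x k)" by auto
            have xn: "x n = x k @ sel (x k)" using x(3)[of k] ChT[OF i] unfolding k by auto
            have "q (x n) \<le> q (x k) * real (H i) ^ 30" using sel[OF x(2) i] unfolding xn ok_def by auto
            then have "(q (x n))^2 \<le> (q (x k) * real (H i) ^ 30)^2" using Pq[OF x(2), of n] by (intro power_mono) auto
            also have "\<dots> = (q (x k))^2 * real (H i) ^ 60" by (simp add: power_mult_distrib flip: power_mult)
            also have "\<dots> \<le> A * y i * real (H i) ^ 60" using Tq2[OF x(2) i] by (intro mult_right_mono) auto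
            also have "\<dots> < y (Suc i)" using ystep[of i] by (simp add: A_def mult_ac)
            finally have "y j < y (Suc i)" using n by linarith
            then have "j \<le> i" using ymono by simp
            then have "y j \<le> y i" using ymono by simp
            then show False using i small by (simp add: T_def)
          qed
          then obtain a where "x n = x k @ [a]" using x(3)[of k] unfolding k Ch_def by auto
          then have "p (x n) = q (x k)" by (simp add: p_def q_def row_append)
          then have T: "T j (x n)" using n small by (simp add: T_def)
          then have "x (Suc n) = x n @ sel (x n)" using ChT x(3)[of n] by auto
          then obtain \<zeta> where "\<zeta> \<in> {1..real K + 1}" "\<beta> = cfv (x n @ sel (x n)) \<zeta>" using \<beta>[of "Suc n"] by (auto simp: cf_interval_def)
          then show ?thesis using sel[OF x(2) T] by (auto simp: ok_def)
        qed
        ultimately have "\<beta> \<in> G" using G by auto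
        then show "(\<exists>\<beta>\<in>G. \<forall>n. \<beta> \<in> cf_interval K (x n)) \<and> (\<lambda>n. cyl (q (x n)) (p (x n))) \<longlonglongrightarrow> 0"
          using \<beta> lim by blast
      qed
    qed
  qed
qed

section \<open>Inhomogeneous approximations and the main result\<close>

text \<open>Since \<open>u\<close> inverts \<open>P\<close> modulo \<open>q\<close>, some
  \<open>n\<close> between \<open>q\<close> and \<open>2 * q\<close> makes \<open>n * P\<close>
  congruent to the integer \<open>k\<close> nearest to \<open>\<gamma> * q\<close>. Then
  \<open>n * \<alpha> - \<gamma>\<close> is within \<open>2 / q + 1 / (2 * q)\<close> of an integer.
  The lower bound \<open>q <= n\<close> keeps the logarithms of \<open>n\<close> and
  \<open>q\<close> comparable.\<close>

lemma inhomogeneous_approx: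
  fixes \<alpha> \<gamma> :: real and P q u v :: int
  assumes q: "q \<ge> 1" and bez: "u * P + v * q = 1" and close: "\<bar>\<alpha> - of_int P / of_int q\<bar> \<le> 1 / of_int q ^ 2"
  shows "\<exists>n::nat. q \<le> int n \<and> int n < 2 * q \<and> real n * dist_int (real n * \<alpha> - \<gamma>) \<le> 5"
proof -
  define k where "k = round (\<gamma> * of_int q)"
  define n where "n = nat (k * u mod q + q)"
  have m: "0 \<le> k * u mod q" "k * u mod q < q" using q by auto
  have n: "int n = k * u mod q + q" using m q by (simp add: n_def)
  then have nb: "q \<le> int n" "int n < 2 * q" using m by linarith+
  have nn: "int n = k * u - q * (k * u div q) + q" unfolding n by (simp add: minus_mult_div_eq_mod)
  have "int n * P - k = k * (u * P) - k + q * (P - P * (k * u div q))" unfolding nn by (simp add: algebra_simps)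
  also have "u * P = 1 - v * q" using bez by simp
  finally have "int n * P - k = q * (P - P * (k * u div q) - k * v)" by (simp add: algebra_simps)
  then obtain l where l: "int n * P - k = q * l" by blast
  have q0: "0 < real_of_int q" using q by simp
  have nr: "real n < 2 * of_int q" using nb by linarith
  have eq: "real n * \<alpha> - \<gamma> - of_int l = real n * (\<alpha> - of_int P / of_int q) + (of_int k / of_int q - \<gamma>)"
  proof -
    have "real_of_int (int n * P - k) = of_int (q * l)" using l by (simp only:)
    then have "real n * of_int P - of_int k = of_int q * of_int l" by simp
    then show ?thesis using q0 by (simp add: field_simps)
  qed
  have "\<bar>of_int k / of_int q - \<gamma>\<bar> * of_int q \<le> 1 / 2"
  proof -
    have "\<bar>of_int k / of_int q - \<gamma>\<bar> * of_int q = \<bar>(of_int k / of_int q - \<gamma>) * of_int q\<bar>" using q0 by (simp add: abs_mult)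
    also have "(of_int k / of_int q - \<gamma>) * of_int q = of_int k - \<gamma> * of_int q" using q0 by (simp add: field_simps)
    also have "\<bar>\<dots>\<bar> \<le> 1 / 2" unfolding k_def by (rule of_int_round_abs_le)
    finally show ?thesis .
  qed
  then have 1: "\<bar>of_int k / of_int q - \<gamma>\<bar> \<le> 1 / 2 / of_int q" using q0 by (simp add: pos_le_divide_eq)
  have "\<bar>real n * (\<alpha> - of_int P / of_int q)\<bar> \<le> (2 * of_int q) * (1 / of_int q ^ 2)"
    unfolding abs_mult using nr close q0 by (intro mult_mono) auto
  also have "\<dots> = 2 / of_int q" using q0 by (simp add: power2_eq_square)
  finally have 2: "\<bar>real n * (\<alpha> - of_int P / of_int q)\<bar> \<le> 2 / of_int q" .
  have "dist_int (real n * \<alpha> - \<gamma>) \<le> \<bar>real n * \<alpha> - \<gamma> - of_int l\<bar>" by (rule dist_int_le)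
  also have "\<dots> \<le> 2 / of_int q + 1 / 2 / of_int q" unfolding eq by (rule order_trans[OF abs_triangle_ineq add_mono[OF 2 1]])
  also have "\<dots> = (5 / 2) / of_int q" by (simp add: field_simps)
  finally have d: "dist_int (real n * \<alpha> - \<gamma>) \<le> (5 / 2) / of_int q" .
  have "real n * dist_int (real n * \<alpha> - \<gamma>) \<le> (2 * of_int q) * ((5 / 2) / of_int q)"
    using nr d q0 by (intro mult_mono) auto
  also have "\<dots> = 5" using q0 by simp
  finally show ?thesis using nb by blast
qed

text \<open>The number \<alpha> is its integer part plus \<open>1 / x 1\<close>, and
  \<open>x 1\<close> is the value of the word of the next \<open>t\<close> partial quotients at
  \<open>x (Suc t)\<close>. Hence the denominators of \<alpha> are numerators of that word. The
  determinant gives the Bezout relation, and the recursion doubles the denominator at least every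
  second step.\<close>

lemma cf_denom_approx:
  assumes irr: "\<alpha> \<notin> \<rat>"
  shows "cf_denom \<alpha> t \<ge> 1" "cf_denom \<alpha> t \<le> cf_denom \<alpha> (Suc t)" "2 ^ i \<le> cf_denom \<alpha> (2 * i)"
    "\<exists>P u v. u * P + v * cf_denom \<alpha> t = 1 \<and> \<bar>\<alpha> - of_int P / of_int (cf_denom \<alpha> t)\<bar> \<le> 1 / of_int (cf_denom \<alpha> t) ^ 2"
proof -
  define x where "x = cf_complete_quotient \<alpha>"
  have x_irr: "x k \<notin> \<rat>" for k
  proof (induction k)
    case (Suc k)
    have "frac (x k) \<notin> \<rat>"
    proof
      assume "frac (x k) \<in> \<rat>"
      then have "frac (x k) + of_int \<lfloor>x k\<rfloor> \<in> \<rat>" by (intro Rats_add) auto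
      then show False using Suc by (simp add: frac_def)
    qed
    then show ?case using Rats_inverse[of "1 / frac (x k)"] by (auto simp: x_def inverse_eq_divide)
  qed (use irr in \<open>simp add: x_def\<close>)
  have fr: "0 < frac (x k)" "frac (x k) < 1" for k
  proof -
    have "frac (x k) \<noteq> 0" using x_irr[of k] by (auto simp: frac_eq_0_iff elim!: Ints_cases)
    then show "0 < frac (x k)" "frac (x k) < 1" using frac_ge_0[of "x k"] frac_lt_1[of "x k"] by linarith+
  qed
  have xS: "x (Suc k) = 1 / frac (x k)" "1 < x (Suc k)" for k using fr[of k] by (auto simp: x_def)
  define a where "a k = nat (cf_partial_quotient \<alpha> k)" for k
  have pq: "cf_partial_quotient \<alpha> k = \<lfloor>x k\<rfloor>" for k by (simp add: cf_partial_quotient_def x_def)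
  have a: "int (a (Suc k)) = \<lfloor>x (Suc k)\<rfloor>" "1 \<le> a (Suc k)" "x (Suc k) = real (a (Suc k)) + 1 / x (Suc (Suc k))" for k
  proof -
    have "1 \<le> \<lfloor>x (Suc k)\<rfloor>" using xS(2)[of k] by linarith
    then show 1: "int (a (Suc k)) = \<lfloor>x (Suc k)\<rfloor>" unfolding a_def pq by simp
    then show "1 \<le> a (Suc k)" using \<open>1 \<le> \<lfloor>x (Suc k)\<rfloor>\<close> by linarith
    have "real (a (Suc k)) = of_int \<lfloor>x (Suc k)\<rfloor>" using 1 by (metis of_int_of_nat_eq)
    then show "x (Suc k) = real (a (Suc k)) + 1 / x (Suc (Suc k))" using xS(1)[of "Suc k"] fr[of "Suc k"] by (simp add: frac_def)
  qed
  define w where "w t = map (\<lambda>i. a (Suc i)) [0..<t]" for t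
  have wS: "w (Suc t) = w t @ [a (Suc t)]" for t by (simp add: w_def)
  define Q where "Q = cf_denom \<alpha>"
  have Q: "Q 0 = 1" "Q (Suc 0) = int (a (Suc 0))" "Q (Suc (Suc t)) = int (a (Suc (Suc t))) * Q (Suc t) + Q t" for t
    unfolding Q_def a(1) by (simp_all add: pq)
  have row2: "int (row1 (w (Suc t)) 1 0) = Q (Suc t) \<and> int (row2 (w (Suc t)) 1 0) = Q t" for t
  proof (induction t)
    case 0 show ?case by (simp add: w_def Q)
  next
    case (Suc t)
    then show ?case unfolding wS[of "Suc t"] by (simp add: row_append Q)
  qed
  have row: "int (row1 (w t) 1 0) = Q t" for t
    using row2[of "t - 1"] by (cases t) (auto simp: w_def Q)
  have pos: "1 \<le> Q t \<and> Q t \<le> Q (Suc t)" for t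
  proof (induction t)
    case 0 show ?case using a(2)[of 0] by (simp add: Q)
  next
    case (Suc t)
    have "1 * Q (Suc t) \<le> int (a (Suc (Suc t))) * Q (Suc t)"
      using Suc a(2)[of "Suc t"] by (intro mult_right_mono) linarith+
    then show ?case unfolding Q(3) using Suc by linarith
  qed
  then show p1: "cf_denom \<alpha> t \<ge> 1" "cf_denom \<alpha> t \<le> cf_denom \<alpha> (Suc t)" for t by (auto simp: Q_def)
  have "2 ^ i \<le> Q (2 * i)" for i
  proof (induction i)
    case (Suc i)
    have "1 * Q (Suc (2 * i)) \<le> int (a (Suc (Suc (2 * i)))) * Q (Suc (2 * i))"
      using pos[of "Suc (2 * i)"] a(2)[of "Suc (2 * i)"] by (intro mult_right_mono) linarith+
    then have "2 * Q (2 * i) \<le> Q (Suc (Suc (2 * i)))" unfolding Q(3) using pos[of "2 * i"] by linarith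
    then have "2 * 2 ^ i \<le> Q (Suc (Suc (2 * i)))" using Suc by linarith
    then show ?case by simp
  qed (simp add: Q)
  then show "2 ^ i \<le> cf_denom \<alpha> (2 * i)" for i by (simp add: Q_def)
  \<comment> \<open>Any bound for the finitely many digits makes the lemmas on
    \<open>digits_le\<close> applicable; the 1 is inserted for the empty word at
    \<open>t = 0\<close>.\<close>
  define K where "K = Max (insert 1 (set (w t)))"
  have dK: "digits_le K (w t)" unfolding digits_le_def
  proof
    fix k assume k: "k \<in> set (w t)"
    then have "k \<le> K" unfolding K_def by (intro Max_ge) auto
    moreover have "1 \<le> k" using k a(2) by (auto simp: w_def)
    ultimately show "k \<in> {1..K}" by simp
  qed
  have cf: "x 1 = cfv (w t) (x (Suc t))" for t
  proof (induction t)
    case (Suc t)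
    then show ?case unfolding wS cfv_append using a(3)[of t] by simp
  qed (simp add: w_def)
  define z where "z = x (Suc t)"
  have z: "1 < z" using xS by (simp add: z_def)
  define r where "r = cf_denom \<alpha> t"
  define r' where "r' = int (row2 (w t) 1 0)"
  define p where "p = int (row1 (w t) 0 1)"
  define p' where "p' = int (row2 (w t) 0 1)"
  have reals: "row1 (w t) 1 0 = real_of_int r" "row2 (w t) 1 0 = real_of_int r'" "row1 (w t) 0 1 = real_of_int p" "row2 (w t) 0 1 = real_of_int p'"
    using row_of_nat(1)[of "w t" 1 0, where ?'a = real] row_of_nat(1)[of "w t" 0 1, where ?'a = real]
      row_of_nat(2)[of "w t" 1 0] row_of_nat(2)[of "w t" 0 1] row[of t, symmetric, unfolded Q_def]
    by (simp_all add: r_def r'_def p_def p'_def)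
  define e where "e = r * p' - r' * p"
  have er: "real_of_int e = (-1) ^ length (w t)"
    unfolding e_def using row_det[of "w t", where ?'a = real] by (simp add: reals)
  have "real_of_int (e * e) = 1" unfolding of_int_mult er by (simp flip: power_add)
  then have e: "e * e = 1" by linarith
  have ea: "\<bar>real_of_int e\<bar> = 1" unfolding er by simp
  define P where "P = \<lfloor>\<alpha>\<rfloor> * r + p"
  have "(- e * r') * P + (e * p' + e * r' * \<lfloor>\<alpha>\<rfloor>) * r = e * e"
    unfolding P_def by (simp add: e_def algebra_simps)
  then have bez: "(- e * r') * P + (e * p' + e * r' * \<lfloor>\<alpha>\<rfloor>) * r = 1" using e by simp
  have r1: "1 \<le> real_of_int r" using p1(1)[of t] by (simp add: r_def)
  have r'0: "0 \<le> real_of_int r'" by (simp add: r'_def)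
  have rp: "0 < real_of_int r * z + of_int r'" "0 < real_of_int p * z + of_int p'"
    using row_pos[OF dK, of z] z by (auto simp: reals)
  have "\<alpha> = of_int \<lfloor>\<alpha>\<rfloor> + 1 / x 1" using xS(1)[of 0] fr[of 0] by (simp add: x_def frac_def)
  also have "x 1 = (of_int r * z + of_int r') / (of_int p * z + of_int p')"
    using cf[of t] cfv_eq[OF dK, of z] z by (simp add: z_def reals)
  finally have \<alpha>: "\<alpha> = of_int \<lfloor>\<alpha>\<rfloor> + 1 / ((of_int r * z + of_int r') / (of_int p * z + of_int p'))" .
  have "of_int P / of_int r = of_int \<lfloor>\<alpha>\<rfloor> + of_int p / real_of_int r"
    using r1 by (simp add: P_def field_simps)
  with \<alpha> have "\<alpha> - of_int P / of_int r = (of_int p * z + of_int p') / (of_int r * z + of_int r') - of_int p / of_int r"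
    by (simp only: divide_divide_eq_right mult_1 add_diff_cancel_left)
  also have "\<dots> = ((of_int p * z + of_int p') * of_int r - of_int p * (of_int r * z + of_int r')) / ((of_int r * z + of_int r') * of_int r)"
    using rp r1 by (subst diff_frac_eq) auto
  also have "(of_int p * z + of_int p') * of_int r - of_int p * (of_int r * z + of_int r') = real_of_int e"
    by (simp add: e_def algebra_simps)
  finally have "\<bar>\<alpha> - of_int P / of_int r\<bar> = 1 / ((of_int r * z + of_int r') * of_int r)"
    using rp r1 ea by (simp add: abs_divide abs_mult)
  also have "\<dots> \<le> 1 / of_int r ^ 2"
  proof (intro divide_left_mono)
    have "of_int r * 1 \<le> of_int r * z" using r1 z by (intro mult_left_mono) auto
    then have "real_of_int r \<le> of_int r * z + of_int r'" using r'0 by linarith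
    then show "real_of_int r ^ 2 \<le> (of_int r * z + of_int r') * of_int r"
      unfolding power2_eq_square using r1 by (intro mult_right_mono) auto
    show "0 < (of_int r * z + of_int r') * of_int r * real_of_int r ^ 2"
      using rp r1 by (intro mult_pos_pos) auto
  qed simp
  finally show "\<exists>P u v. u * P + v * cf_denom \<alpha> t = 1 \<and> \<bar>\<alpha> - of_int P / of_int (cf_denom \<alpha> t)\<bar> \<le> 1 / of_int (cf_denom \<alpha> t) ^ 2"
    using bez unfolding r_def by blast
qed

text \<open>Only denominators of even index \<open>2 * i\<close> are used: they are at least
  \<open>2 ^ i\<close> whatever the partial quotients are, which gives the lower bound for
  \<open>ln (n i)\<close>. The upper bound is the defining property of \<open>K_set\<close>.\<close>

lemma K_set_approximations:
  fixes \<alpha> \<gamma> :: real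
  assumes "\<alpha> \<in> K_set"
  obtains C :: real and n :: "nat \<Rightarrow> nat" where "C \<ge> 1"
    "\<And>i. i \<ge> 1 \<Longrightarrow> real i * ln 2 \<le> ln (real (n i)) \<and> ln (real (n i)) \<le> C * real i"
    "\<And>i. i \<ge> 1 \<Longrightarrow> n i \<ge> 2" "\<And>i. real (n i) * dist_int (real (n i) * \<alpha> - \<gamma>) \<le> 5"
proof -
  have irr: "\<alpha> \<notin> \<rat>" and fin: "(SUP t\<in>{1..}. ereal (ln (real_of_int (cf_denom \<alpha> t)) / real t)) < \<infinity>"
    using assms by (auto simp: K_set_def)
  note q = cf_denom_approx[OF irr]
  from fin obtain M where M: "(SUP t\<in>{1..}. ereal (ln (real_of_int (cf_denom \<alpha> t)) / real t)) < ereal M"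
    using ereal_dense2 by blast
  have qM: "ln (real_of_int (cf_denom \<alpha> t)) \<le> M * real t" if "t \<ge> 1" for t
  proof -
    have "ereal (ln (real_of_int (cf_denom \<alpha> t)) / real t) \<le> (SUP t\<in>{1..}. ereal (ln (real_of_int (cf_denom \<alpha> t)) / real t))"
      using that by (intro SUP_upper) auto
    then have "ereal (ln (real_of_int (cf_denom \<alpha> t)) / real t) < ereal M" using M by (rule order_le_less_trans)
    then show ?thesis using that by (simp add: field_simps)
  qed
  have "\<exists>n::nat. cf_denom \<alpha> (2 * i) \<le> int n \<and> int n < 2 * cf_denom \<alpha> (2 * i) \<and> real n * dist_int (real n * \<alpha> - \<gamma>) \<le> 5" for i
    using q(4)[of "2 * i"] inhomogeneous_approx[OF q(1)] by blast
  then obtain n :: "nat \<Rightarrow> nat" where n: "\<And>i. cf_denom \<alpha> (2 * i) \<le> int (n i)" "\<And>i. int (n i) < 2 * cf_denom \<alpha> (2 * i)"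
    "\<And>i. real (n i) * dist_int (real (n i) * \<alpha> - \<gamma>) \<le> 5" by metis
  show ?thesis
  proof (rule that[of "\<bar>2 * M\<bar> + 1" n])
    fix i :: nat assume i: "i \<ge> 1"
    have 1: "2 ^ i \<le> int (n i)" using q(3)[of i] n(1)[of i] by linarith
    then have r: "2 ^ i \<le> real (n i)" by (metis of_int_le_iff of_int_numeral of_int_of_nat_eq of_int_power)
    have "(2::int) ^ 1 \<le> 2 ^ i" using i by (intro power_increasing) auto
    then have "2 \<le> int (n i)" using 1 unfolding power_one_right by (rule order_trans)
    then show n2: "n i \<ge> 2" by simp
    have "ln (2 ^ i) \<le> ln (real (n i))" using r n2 by (subst ln_le_cancel_iff) auto
    then have lo: "real i * ln 2 \<le> ln (real (n i))" by (simp add: ln_realpow)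
    have q0: "0 < real_of_int (cf_denom \<alpha> (2 * i))" using q(1)[of "2 * i"] by simp
    have "real (n i) \<le> 2 * of_int (cf_denom \<alpha> (2 * i))" using n(2)[of i] by linarith
    then have "ln (real (n i)) \<le> ln (2 * of_int (cf_denom \<alpha> (2 * i)))" using n2 q0 by (subst ln_le_cancel_iff) auto
    also have "\<dots> = ln 2 + ln (of_int (cf_denom \<alpha> (2 * i)))" using q0 by (simp add: ln_mult)
    also have "\<dots> \<le> 1 + M * real (2 * i)" using qM[of "2 * i"] i ln2_le_25_over_36 by (intro add_mono) auto
    also have "\<dots> \<le> real i + \<bar>2 * M\<bar> * real i"
    proof -
      have "2 * M * real i \<le> \<bar>2 * M\<bar> * real i" by (intro mult_right_mono) auto
      moreover have "1 + M * real (2 * i) = 1 + 2 * M * real i" "1 \<le> real i" using i by auto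
      ultimately show ?thesis by linarith
    qed
    also have "\<dots> = (\<bar>2 * M\<bar> + 1) * real i" by (simp add: algebra_simps)
    finally show "real i * ln 2 \<le> ln (real (n i)) \<and> ln (real (n i)) \<le> (\<bar>2 * M\<bar> + 1) * real i" using lo by simp
  qed (use n in auto)
qed


section \<open>Choice of the parameters and the count\<close>

lemma exp_growth_bounded:
  fixes a b b' c d k :: real
  assumes "a > 0" "b > 0" "b' > 0" "c > 0" "d > 0" "k > 0"
  shows "\<exists>M. \<forall>N::nat. exp ((real N + 1) * (a + b * (real N + 1)) - k * (c * 2 ^ N - d - b' * (real N + 1))) \<le> M"
proof -
  have "((\<lambda>N::nat. exp ((real N + 1) * (a + b * (real N + 1)) - k * (c * 2 ^ N - d - b' * (real N + 1)))) \<longlongrightarrow> 0) at_top"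
    using assms by real_asymp
  then have "Bseq (\<lambda>N::nat. exp ((real N + 1) * (a + b * (real N + 1)) - k * (c * 2 ^ N - d - b' * (real N + 1))))"
    by (intro convergent_imp_Bseq) (auto simp: convergent_def)
  then show ?thesis unfolding Bseq_def by auto
qed

lemma eventually_two_power_gt:
  fixes a b c :: real
  assumes "b > 0" "c > 0"
  shows "eventually (\<lambda>j::nat. a + b * (real j + 1) < c * 2 ^ j) sequentially"
proof -
  have "filterlim (\<lambda>j::nat. c * 2 ^ j - (a + b * (real j + 1))) at_top sequentially"
    using assms by real_asymp
  then have "eventually (\<lambda>j::nat. 0 < c * 2 ^ j - (a + b * (real j + 1))) sequentially"
    unfolding filterlim_at_top_dense by blast
  then show ?thesis by eventually_elim simp
qed

text \<open>As \<open>K\<close> grows, the expression tends to \<open>2 powr (1 - s)\<close>, which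
  exceeds 1.\<close>

lemma exists_digit_bound:
  fixes s :: real
  assumes "s < 1"
  shows "\<exists>K::nat. K \<ge> 1 \<and> 2 powr (1 - s) * (1 - 2 / (real K + 1)) \<ge> 1"
proof -
  have "((\<lambda>K::nat. 2 powr (1 - s) * (1 - 2 / (real K + 1))) \<longlongrightarrow> 2 powr (1 - s) * (1 - 0)) sequentially"
    by (intro tendsto_mult tendsto_diff tendsto_const) real_asymp
  moreover have "1 < 2 powr (1 - s) * (1 - 0)" using assms by (simp add: gr_one_powr)
  ultimately have "eventually (\<lambda>K::nat. 1 < 2 powr (1 - s) * (1 - 2 / (real K + 1))) sequentially"
    by (rule order_tendstoD(1))
  then have "eventually (\<lambda>K::nat. K \<ge> 1 \<and> 2 powr (1 - s) * (1 - 2 / (real K + 1)) \<ge> 1) sequentially"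
    using eventually_ge_at_top[of "1::nat"] by eventually_elim auto
  then show ?thesis by (auto simp: eventually_sequentially)
qed

lemma hits_dimension:
  fixes m :: "nat \<Rightarrow> nat" and C \<delta> :: real and B :: nat
  assumes C: "C \<ge> 1" and B: "B \<ge> 2"
    and m: "\<And>j. ln 2 * real B ^ j \<le> ln (real (m j))" "\<And>j. ln (real (m j)) \<le> C * real B ^ j" "\<And>j. m j \<ge> 2"
    and gap: "\<And>j. 2 * C * real B ^ j \<le> ln (real (m (Suc j)))"
  shows "1 \<le> hausdorff_dim {\<beta> \<in> Bad. 1 \<le> \<beta> \<and> \<beta> \<le> 3 \<and> (\<exists>j0. \<forall>j\<ge>j0. dist_int (real (m j) * \<beta> - \<delta>) \<le> 1 / (5 * ln (real (m j))))}"
    (is "1 \<le> hausdorff_dim ?G")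
proof (rule hausdorff_dim_ge_1)
  fix t :: real assume t: "0 < t" "t < 1"
  \<comment> \<open>The gap between \<open>t\<close> and \<open>s\<close> pays for the losses, and
    19/20 is what the exponents of the hitting blocks require.\<close>
  define s where "s = max ((t + 1) / 2) (19/20)"
  have s: "19/20 \<le> s" "s < 1" "t < s" using t by (auto simp: s_def less_max_iff_disj)
  obtain K :: nat where K: "K \<ge> 1" "2 powr (1 - s) * (1 - 2 / (real K + 1)) \<ge> 1" using exists_digit_bound[OF s(2)] by auto
  show "hausdorff_outer_measure t ?G \<noteq> 0"
  proof (rule hausdorff_outer_measure_hits_nonzero[OF s(1,2) K(2,1) t(1) s(3)], goal_cases)
    case tree: (1 H0)
    obtain D0 :: nat where D0: "50 * C^2 \<le> real D0" using real_arch_simple by blast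
    \<comment> \<open>With \<open>H j = D ^ (j + 1)\<close> and
      \<open>\<epsilon> = 1 / (5 * L j)\<close>, the condition
      \<open>2 <= H j * \<epsilon>^2\<close> reads \<open>50 * (L j)^2 <= H j\<close>. As
      \<open>L j <= C * B ^ j\<close>, it suffices that \<open>D\<close> exceeds both
      \<open>50 * C^2\<close> and \<open>B^2\<close>.\<close>
    define D where "D = D0 + B^2 + H0 + 2"
    have D: "D \<ge> 2" "50 * C^2 \<le> real D" "real B ^ 2 \<le> real D" "H0 \<le> D"
    proof -
      have "real D = real D0 + real B ^ 2 + real H0 + 2" by (simp add: D_def)
      moreover have "0 \<le> real D0" "0 \<le> real B ^ 2" "0 \<le> real H0" by simp_all
      ultimately show "50 * C^2 \<le> real D" "real B ^ 2 \<le> real D" using D0 by linarith+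
    qed (auto simp: D_def)
    define b where "b = ln (real D)"
    have b: "b > 0" using D by (simp add: b_def)
    define d where "d = ln ((real K + 1)^2)"
    have A1: "1 < (real K + 1)^2" using K(1) by (intro one_less_power) auto
    have d: "d > 0" using A1 by (simp add: d_def)
    define L where "L j = ln (real (m j))" for j
    have mL: "real (m j) = exp (L j)" for j using m(3)[of j] by (simp add: L_def)
    have Bj: "2 ^ j \<le> real B ^ j" "1 \<le> real B ^ j" for j using B by (auto intro!: power_mono one_le_power)
    have L2: "ln 2 * 2 ^ j \<le> L j" "ln 2 \<le> L j" for j
    proof -
      have "ln 2 * 2 ^ j \<le> ln 2 * real B ^ j" using Bj by (intro mult_left_mono) auto
      then show "ln 2 * 2 ^ j \<le> L j" using m(1)[of j] unfolding L_def by (rule order_trans)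
      have "ln 2 * 1 \<le> ln 2 * real B ^ j" using Bj(2)[of j] by (intro mult_left_mono) auto
      then show "ln 2 \<le> L j" using m(1)[of j] unfolding L_def by linarith
    qed
    define H where "H j = D ^ (j + 1)" for j
    have Hexp: "real (H j) ^ k = exp (real k * (b * (real j + 1)))" for j k
    proof -
      have "real D = exp b" using D by (simp add: b_def)
      then have "real (H j) ^ k = exp b ^ ((j + 1) * k)" by (simp only: H_def power_mult of_nat_power)
      also have "\<dots> = exp (real ((j + 1) * k) * b)" by (rule exp_of_nat_mult[symmetric])
      also have "real ((j + 1) * k) * b = real k * (b * (real j + 1))" by (simp add: algebra_simps)
      finally show ?thesis .
    qed
    define y where "y j = exp (L j - d - 50 * b * (real j + 1))" for j
    have y: "y j = real (m j) / ((real K + 1)^2 * real (H j) ^ 50)" for j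
    proof -
      have "(real K + 1)^2 = exp d" using A1 by (simp add: d_def)
      then show ?thesis unfolding y_def Hexp mL by (simp add: exp_diff exp_add algebra_simps)
    qed
    \<comment> \<open>The first inequality will give \<open>y j > 1\<close>, the second the required
      distance of consecutive thresholds. Both hold from some \<open>j0\<close> on, and the finitely
      many earlier targets are dropped.\<close>
    have "eventually (\<lambda>j::nat. d + 50 * b * (real j + 1) < ln 2 * 2 ^ j \<and> (d + 50 * b) + 60 * b * (real j + 1) < 1 * 2 ^ j) sequentially"
      by (intro eventually_conj eventually_two_power_gt) (use b in auto)
    then obtain j0 where j0: "\<And>j. j \<ge> j0 \<Longrightarrow> d + 50 * b * (real j + 1) < ln 2 * 2 ^ j \<and> (d + 50 * b) + 60 * b * (real j + 1) < 2 ^ j"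
      unfolding eventually_sequentially by auto
    \<comment> \<open>The product of the losses up to \<open>N\<close> is at most the exponential of
      a quadratic polynomial in \<open>N\<close>, whereas \<open>y N\<close> grows like the
      exponential of a multiple of \<open>2 ^ N\<close> at least.\<close>
    obtain M where M: "\<And>N::nat. exp ((real N + 1) * (ln 2 + 60 * b * (real N + 1)) - (s - t) * (ln 2 * 2 ^ N - d - 50 * b * (real N + 1))) \<le> M"
      using exp_growth_bounded[of "ln 2" "60 * b" "50 * b" "ln 2" d "s - t"] b d s by auto
    show "hausdorff_outer_measure t ?G \<noteq> 0"
    proof (rule tree[where m = "\<lambda>j. real (m (j0 + j))" and H = "\<lambda>j. H (j0 + j)" and \<epsilon> = "\<lambda>j. 1 / (5 * L (j0 + j))" and y = "\<lambda>j. y (j0 + j)" and \<delta> = \<delta>])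
      fix j
      let ?j = "j0 + j"
      show "H0 \<le> H ?j \<and> 0 < 1 / (5 * L ?j) \<and> 1 / (5 * L ?j) \<le> 1 \<and> 2 \<le> real (H ?j) * (1 / (5 * L ?j)) ^ 2"
      proof (intro conjI)
        have "D ^ 1 \<le> D ^ (?j + 1)" using D by (intro power_increasing) auto
        with D(4) show "H0 \<le> H ?j" unfolding H_def power_one_right by (rule order_trans)
        have Lp: "1 / 5 \<le> L ?j" using L2(2)[of ?j] ln2_ge_two_thirds by linarith
        then show "0 < 1 / (5 * L ?j)" "1 / (5 * L ?j) \<le> 1" by auto
        have "L ?j ^ 2 \<le> (C * real B ^ ?j) ^ 2" using m(2)[of ?j] Lp by (intro power_mono) (auto simp: L_def)
        also have "\<dots> = C^2 * (real B ^ 2) ^ ?j" by (simp add: power_mult_distrib mult.commute flip: power_mult)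
        finally have "50 * L ?j ^ 2 \<le> (50 * C^2) * (real B ^ 2) ^ ?j" by simp
        also have "\<dots> \<le> real D * real D ^ ?j" using D by (intro mult_mono power_mono) auto
        also have "\<dots> = real (H ?j)" by (simp add: H_def)
        finally have "2 \<le> real (H ?j) / (25 * L ?j ^ 2)" using Lp by (subst pos_le_divide_eq) auto
        then show "2 \<le> real (H ?j) * (1 / (5 * L ?j)) ^ 2" by (simp add: power_divide power_mult_distrib)
      qed
      show "y ?j = real (m ?j) / ((real K + 1)^2 * real (H ?j) ^ 50)" by (rule y)
      show "(real K + 1)^2 * real (H ?j) ^ 60 * y ?j < y (j0 + Suc j)"
      proof -
        have "(real K + 1)^2 = exp d" using A1 by (simp add: d_def)
        then have "(real K + 1)^2 * real (H ?j) ^ 60 * y ?j = exp (d + 60 * (b * (real ?j + 1)) + (L ?j - d - 50 * b * (real ?j + 1)))"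
          unfolding Hexp y_def exp_add by simp
        also have "\<dots> < exp (L (Suc ?j) - d - 50 * b * (real (Suc ?j) + 1))"
        proof -
          have "(d + 50 * b) + 60 * b * (real ?j + 1) < 2 ^ ?j" using j0[of ?j] by simp
          also have "\<dots> \<le> 1 * real B ^ ?j" using Bj by simp
          also have "\<dots> \<le> C * real B ^ ?j" using C Bj by (intro mult_right_mono) auto
          also have "\<dots> = 2 * C * real B ^ ?j - C * real B ^ ?j" by simp
          also have "\<dots> \<le> L (Suc ?j) - L ?j" using gap[of ?j] m(2)[of ?j] by (simp add: L_def)
          finally show ?thesis by (simp add: algebra_simps)
        qed
        finally show ?thesis by (simp add: y_def)
      qed
    next
      show "1 < y (j0 + 0)" using j0[of j0] L2(1)[of j0] by (simp add: y_def)
      show "\<exists>C. \<forall>n. (\<Prod>j\<le>n. 2 * real (H (j0 + j)) ^ 60) \<le> C * y (j0 + n) powr (s - t)"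
      proof (intro exI[of _ M] allI)
        fix n
        define N where "N = j0 + n"
        have one: "1 \<le> 2 * real (H N) ^ 60"
        proof -
          have "0 \<le> real 60 * (b * (real N + 1))" using b by simp
          then have "1 \<le> exp (real 60 * (b * (real N + 1)))" by simp
          then show ?thesis unfolding Hexp by linarith
        qed
        have "(\<Prod>j\<le>n. 2 * real (H (j0 + j)) ^ 60) \<le> (\<Prod>j\<le>n. 2 * real (H N) ^ 60)"
        proof (rule prod_mono)
          fix j assume "j \<in> {..n}"
          then have "H (j0 + j) \<le> H N" unfolding H_def N_def using D by (intro power_increasing) auto
          then show "0 \<le> 2 * real (H (j0 + j)) ^ 60 \<and> 2 * real (H (j0 + j)) ^ 60 \<le> 2 * real (H N) ^ 60"
            by (auto intro!: power_mono)
        qed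
        also have "\<dots> = (2 * real (H N) ^ 60) ^ (n + 1)" by simp
        also have "\<dots> \<le> (2 * real (H N) ^ 60) ^ (N + 1)" by (intro power_increasing one) (simp add: N_def)
        also have "\<dots> = exp ((real N + 1) * (ln 2 + 60 * b * (real N + 1)))"
        proof -
          have "2 * real (H N) ^ 60 = exp (ln 2 + 60 * b * (real N + 1))" unfolding Hexp by (simp add: exp_add)
          then have "(2 * real (H N) ^ 60) ^ (N + 1) = exp (real (N + 1) * (ln 2 + 60 * b * (real N + 1)))"
            by (simp only: exp_of_nat_mult)
          then show ?thesis by (simp add: add.commute)
        qed
        also have "\<dots> \<le> M * exp ((s - t) * (ln 2 * 2 ^ N - d - 50 * b * (real N + 1)))"
          using M[of N] unfolding exp_diff by (subst (asm) pos_divide_le_eq) auto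
        also have "\<dots> \<le> M * y N powr (s - t)"
        proof (rule mult_left_mono)
          have "y N powr (s - t) = exp ((s - t) * (L N - d - 50 * b * (real N + 1)))"
            by (simp add: y_def powr_def)
          then show "exp ((s - t) * (ln 2 * 2 ^ N - d - 50 * b * (real N + 1))) \<le> y N powr (s - t)"
            using L2(1)[of N] s by (simp add: mult_left_mono)
          show "0 \<le> M" using M[of 0] by (meson exp_ge_zero order_trans)
        qed
        finally show "(\<Prod>j\<le>n. 2 * real (H (j0 + j)) ^ 60) \<le> M * y (j0 + n) powr (s - t)" by (simp add: N_def)
      qed
      show "{\<beta> \<in> Bad. 1 \<le> \<beta> \<and> \<beta> \<le> 3 \<and> (\<forall>j. dist_int (real (m (j0 + j)) * \<beta> - \<delta>) \<le> 1 / (5 * L (j0 + j)))} \<subseteq> ?G"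
      proof safe
        fix \<beta> assume h: "\<forall>j. dist_int (real (m (j0 + j)) * \<beta> - \<delta>) \<le> 1 / (5 * L (j0 + j))"
        show "\<exists>j0. \<forall>j\<ge>j0. dist_int (real (m j) * \<beta> - \<delta>) \<le> 1 / (5 * ln (real (m j)))"
        proof (intro exI allI impI)
          fix j assume "j \<ge> j0"
          then show "dist_int (real (m j) * \<beta> - \<delta>) \<le> 1 / (5 * ln (real (m j)))"
            using h[rule_format, of "j - j0"] by (simp add: L_def)
        qed
      qed
    qed
  qed
qed

text \<open>The bound \<open>m j <= N\<close> holds as soon as \<open>C * B ^ j <= ln N\<close>,
  that is for all \<open>j\<close> up to \<open>(ln (ln N) - ln C) / ln B\<close>.\<close>

lemma count_log_log:
  fixes m :: "nat \<Rightarrow> nat" and C :: real and B :: nat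
  assumes C: "C \<ge> 1" and B: "B \<ge> 2" and m: "\<And>j. ln (real (m j)) \<le> C * real B ^ j" "\<And>j. m j \<ge> 2" "strict_mono m"
    and S: "\<And>j. j \<ge> j0 \<Longrightarrow> Q (m j)"
  shows "\<exists>c::real. \<exists>N0::nat. c > 0 \<and> (\<forall>N::nat. N \<ge> N0 \<longrightarrow> real (card {n \<in> {1..N}. Q n}) \<ge> c * ln (ln (real N)))"
proof -
  define b where "b = ln (real B)"
  have b: "b > 0" using B by (simp add: b_def)
  have "filterlim (\<lambda>N::nat. ln (ln (real N))) at_top sequentially" by real_asymp
  \<comment> \<open>Half of \<open>ln (ln N)\<close> absorbs \<open>C\<close> and the first
    \<open>j0\<close> indices; the other half yields the constant
    \<open>1 / (2 * b)\<close>.\<close>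
  then have "eventually (\<lambda>N::nat. 2 * (ln C + real j0 * b) < ln (ln (real N)) \<and> 0 < ln (ln (real N)) \<and> N \<ge> 2) sequentially"
    unfolding filterlim_at_top_dense by (intro eventually_conj eventually_ge_at_top) auto
  then obtain N0 :: nat where N0: "\<And>N. N \<ge> N0 \<Longrightarrow> 2 * (ln C + real j0 * b) < ln (ln (real N)) \<and> 0 < ln (ln (real N)) \<and> N \<ge> 2"
    unfolding eventually_sequentially by blast
  have "1 / (2 * b) * ln (ln (real N)) \<le> real (card {n \<in> {1..N}. Q n})" if N: "N \<ge> N0" for N
  proof -
    define x where "x = ln (ln (real N))"
    have x: "2 * (ln C + real j0 * b) < x" "0 < x" and N2: "N \<ge> 2" using N0[OF N] by (auto simp: x_def)
    have lnN: "ln (real N) = exp x"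
    proof -
      have "0 < ln (real N)" using N2 by simp
      then show ?thesis by (simp add: x_def)
    qed
    define J where "J = nat \<lfloor>(x - ln C) / b\<rfloor>"
    have lC: "0 \<le> ln C" using C by simp
    have "0 \<le> real j0 * b" using b by simp
    then have "0 \<le> x - ln C" using x(1) lC by argo
    then have x0: "0 \<le> (x - ln C) / b" using b by simp
    have J: "real J \<le> (x - ln C) / b" "(x - ln C) / b < real J + 1"
      unfolding J_def using x0 by linarith+
    have le: "m j \<le> N" if "j \<le> J" for j
    proof -
      have "real j * b \<le> real J * b" using that b by (intro mult_right_mono) auto
      also have "\<dots> \<le> x - ln C" using J(1) b by (simp add: pos_le_divide_eq)
      finally have jb: "ln C + real j * b \<le> x" by simp
      have "ln (real (m j)) \<le> C * real B ^ j" by (rule m)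
      also have "\<dots> = exp (ln C + real j * b)"
        using C B by (simp add: exp_add b_def exp_of_nat_mult)
      also have "\<dots> \<le> ln (real N)" unfolding lnN using jb by simp
      finally show "m j \<le> N" using m(2)[of j] N2 by (subst (asm) ln_le_cancel_iff) auto
    qed
    have sub: "m ` {j0..J} \<subseteq> {n \<in> {1..N}. Q n}"
    proof safe
      fix j assume j: "j \<in> {j0..J}"
      show "m j \<in> {1..N}" using le[of j] m(2)[of j] j by auto
      show "Q (m j)" using S j by auto
    qed
    have "card (m ` {j0..J}) = J + 1 - j0"
      using strict_mono_imp_inj_on[OF m(3)] by (subst card_image) (auto intro: inj_on_subset)
    then have "J + 1 - j0 \<le> card {n \<in> {1..N}. Q n}"
      using card_mono[OF _ sub] by simp
    then have "real J + 1 - real j0 \<le> real (card {n \<in> {1..N}. Q n})" by linarith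
    moreover have "1 / (2 * b) * x \<le> (x - ln C) / b - real j0"
    proof -
      have "x / 2 \<le> x - ln C - real j0 * b" using x by simp
      then have "x / 2 / b \<le> (x - ln C - real j0 * b) / b" using b by (intro divide_right_mono) auto
      then show ?thesis using b by (simp add: diff_divide_distrib)
    qed
    ultimately show ?thesis using J(2) unfolding x_def[symmetric] by linarith
  qed
  then show ?thesis using b by (intro exI[of _ "1 / (2 * b)"] exI[of _ N0]) auto
qed

theorem theorem1p1:
  fixes \<alpha> \<gamma> \<delta> :: real
  assumes "\<alpha> \<in> K_set"
  shows "\<exists>G. G \<subseteq> Bad \<and> hausdorff_dim G = 1 \<and>
    (\<forall>\<beta>\<in>G. \<exists>c::real. \<exists>N0::nat. c > 0 \<and>
      (\<forall>N::nat. N \<ge> N0 \<longrightarrow>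
        real (card {n \<in> {1..N}.
            real n * dist_int (real n * \<alpha> - \<gamma>) * dist_int (real n * \<beta> - \<delta>)
              \<le> 1 / ln (real n)})
          \<ge> c * ln (ln (real N))))"
proof -
  obtain C :: real and n :: "nat \<Rightarrow> nat" where C: "C \<ge> 1"
    and n: "\<And>i. i \<ge> 1 \<Longrightarrow> real i * ln 2 \<le> ln (real (n i)) \<and> ln (real (n i)) \<le> C * real i"
      "\<And>i. i \<ge> 1 \<Longrightarrow> n i \<ge> 2" "\<And>i. real (n i) * dist_int (real (n i) * \<alpha> - \<gamma>) \<le> 5"
    using K_set_approximations[OF assms] by blast
  obtain B0 :: nat where B0: "2 * C / ln 2 \<le> real B0" using real_arch_simple by blast
  \<comment> \<open>This size of \<open>B\<close> makes the upper bound for \<open>ln (m j)\<close>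
    at most half the lower bound for \<open>ln (m (Suc j))\<close>, which separates the thresholds
    of the tree and makes \<open>m\<close> strictly increasing.\<close>
  define B where "B = B0 + 2"
  have "2 * C \<le> real B0 * ln 2" using B0 by (simp add: field_simps)
  moreover have "0 < ln (2::real)" by simp
  moreover have "ln 2 * real B = real B0 * ln 2 + 2 * ln 2" by (simp add: B_def algebra_simps)
  ultimately have B: "B \<ge> 2" "2 * C \<le> ln 2 * real B" unfolding B_def[symmetric] by (simp add: B_def, linarith)
  define m where "m j = n (B ^ j)" for j
  have B1: "B ^ j \<ge> 1" for j using B by simp
  have m: "ln 2 * real B ^ j \<le> ln (real (m j))" "ln (real (m j)) \<le> C * real B ^ j" "m j \<ge> 2" for j
    using n(1,2)[OF B1[of j]] by (auto simp: m_def mult.commute)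
  have gap: "2 * C * real B ^ j \<le> ln (real (m (Suc j)))" for j
  proof -
    have "2 * C * real B ^ j \<le> (ln 2 * real B) * real B ^ j" using B by (intro mult_right_mono) auto
    then show ?thesis using m(1)[of "Suc j"] by simp
  qed
  have sm: "strict_mono m" unfolding strict_mono_Suc_iff
  proof
    fix j
    have "0 < C * real B ^ j" using C B by (intro mult_pos_pos) auto
    then have "ln (real (m j)) < ln (real (m (Suc j)))" using gap[of j] m(2)[of j] by linarith
    then show "m j < m (Suc j)" using m(3)[of j] m(3)[of "Suc j"] by (subst (asm) ln_less_cancel_iff) auto
  qed
  \<comment> \<open>The 5 in the target radius cancels the 5 that bounds the first two factors of
    the product. The restriction to \<open>{1..3}\<close> serves the upper bound on the
    dimension.\<close>
  define G where "G = {\<beta> \<in> Bad. 1 \<le> \<beta> \<and> \<beta> \<le> 3 \<and> (\<exists>j0. \<forall>j\<ge>j0. dist_int (real (m j) * \<beta> - \<delta>) \<le> 1 / (5 * ln (real (m j))))}"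
  show ?thesis
  proof (intro exI[of _ G] conjI ballI)
    show "G \<subseteq> Bad" by (auto simp: G_def)
    have "1 \<le> hausdorff_dim G" unfolding G_def by (rule hits_dimension[OF C B(1) m gap])
    moreover have "hausdorff_dim G \<le> 1" by (rule hausdorff_dim_le_1) (auto simp: G_def)
    ultimately show "hausdorff_dim G = 1" by (rule antisym[rotated])
    fix \<beta> assume "\<beta> \<in> G"
    then obtain j0 where j0: "\<And>j. j \<ge> j0 \<Longrightarrow> dist_int (real (m j) * \<beta> - \<delta>) \<le> 1 / (5 * ln (real (m j)))"
      by (auto simp: G_def)
    show "\<exists>c N0. c > 0 \<and> (\<forall>N\<ge>N0. c * ln (ln (real N)) \<le> real (card {n \<in> {1..N}.
        real n * dist_int (real n * \<alpha> - \<gamma>) * dist_int (real n * \<beta> - \<delta>) \<le> 1 / ln (real n)}))"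
    proof (rule count_log_log[OF C B(1) m(2,3) sm])
      fix j assume "j \<ge> j0"
      have "real (m j) * dist_int (real (m j) * \<alpha> - \<gamma>) * dist_int (real (m j) * \<beta> - \<delta>) \<le> 5 * (1 / (5 * ln (real (m j))))"
        using n(3)[of "B ^ j"] j0[OF \<open>j \<ge> j0\<close>] unfolding m_def[symmetric] by (intro mult_mono) auto
      then show "real (m j) * dist_int (real (m j) * \<alpha> - \<gamma>) * dist_int (real (m j) * \<beta> - \<delta>) \<le> 1 / ln (real (m j))"
        by simp
    qed
  qed
qed

end
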